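(* Let $X$ be a Lévy process, let $\theta\in(0,\infty)$ and let $T_\theta\sim\mathrm{Exp}(\theta)$ be independent of $X$. The random vectors $(\overline\tau_{T_\theta}(X),\overline X_{T_\theta})$ and $(T_\theta-\overline\tau_{T_\theta}(X),X_{T_\theta}-\overline X_{T_\theta})$ are independent and infinitely divisible, with respective Fourier–Laplace transforms given by $$\Psi_\theta^+(u,v):=\mathbb{E}\big[e^{u\overline\tau_{T_\theta}(X)+v\overline X_{T_\theta}}\big]=\frac{\varphi_+(-\theta,0)}{\varphi_+(u-\theta,v)},$$ $$\Psi_\theta^-(u,-v):=\mathbb{E}\big[e^{u(T_\theta-\overline\tau_{T_\theta}(X))-v(X_{T_\theta}-\overline X_{T_\theta})}\big]=\frac{\varphi_-(-\theta,0)}{\varphi_-(u-\theta,v)},$$ for any $u,v\in\mathbb{C}$ with $\Re u\le0$, $\Re v\le 0$. Here, with $A_+:=(0,\infty)$ and $A_-:=(-\infty,0]$, $$\varphi_\pm(a,b):=\exp\left(\int_0^\infty\int_{A_\pm}\big(e^{-t}-e^{at+b|x|}\big)t^{-1}\,\mathbb{P}(X_t\in\mathrm{d}x)\,\mathrm{d}t\right)$$ for any $a,b\in\mathbb{C}$ such that the integral exists, which includes all $a,b$ with $\Re a<0$, $\Re b\le0$. Moreover, the characteristic exponent $\Psi$ of $X_1$ satisfies $$\frac{\theta}{\theta-u-\Psi(v)}=\Psi_\theta^+(u,v)\,\Psi_\theta^-(u,v)\qquad\text{for all }u,v\in\mathbb{C}\text{ with }\Re u=\Re v=0.$$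
   Context: A Lévy process $X=(X_t)_{t\ge0}$ is real-valued with stationary independent increments and càdlàg paths, started at zero; it is assumed not identically equal to zero. $\mathrm{Exp}(\theta)$ is the exponential law with mean $1/\theta$. $\overline X_t:=\sup_{s\le t}X_s$ and $\overline\tau_t(X):=\inf\{s\in[0,t]:\max\{X_s,X_{s-}\}=\overline X_t\}$, where $X_{s-}:=\lim_{r\uparrow s}X_r$ for $s>0$ and $X_{0-}:=X_0$; these are evaluated at the random time $t=T_\theta$. The characteristic exponent $\Psi$ is defined by $\mathbb{E}\exp(vX_1)=\exp\Psi(v)$ for $v\in\mathbb{C}$ with $\Re v=0$ (the usual continuous version with $\Psi(0)=0$, so that $\mathbb{E}\exp(vX_t)=\exp(t\Psi(v))$). *)

theory Defs
  imports "HOL-Probability.Probability"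
begin

definition cadlag :: "(real \<Rightarrow> real) \<Rightarrow> bool" where
  "cadlag x \<longleftrightarrow>
     (\<forall>t\<ge>0. (x \<longlongrightarrow> x t) (at_right t)) \<and>
     (\<forall>t>0. \<exists>l. (x \<longlongrightarrow> l) (at_left t))"

text \<open>Processes are indexed by \<^typ>\<open>real\<close>, but only times \<open>t \<ge> 0\<close> are constrained or used.\<close>

definition levy_process :: "'w measure \<Rightarrow> (real \<Rightarrow> 'w \<Rightarrow> real) \<Rightarrow> bool" where
  "levy_process M X \<longleftrightarrow>
     prob_space M \<and>
     (\<forall>t\<ge>0. X t \<in> borel_measurable M) \<and>
     (\<forall>\<omega>\<in>space M. X 0 \<omega> = 0) \<and>
     (\<forall>\<omega>\<in>space M. cadlag (\<lambda>t. X t \<omega>)) \<and>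
     (\<forall>s\<ge>0. \<forall>t\<ge>0.
        distr M borel (\<lambda>\<omega>. X (s + t) \<omega> - X s \<omega>) = distr M borel (\<lambda>\<omega>. X t \<omega> - X 0 \<omega>)) \<and>
     (\<forall>(n::nat) (t::nat \<Rightarrow> real). 0 \<le> t 0 \<and> (\<forall>i<n. t i \<le> t (Suc i)) \<longrightarrow>
        prob_space.indep_vars M (\<lambda>_. borel) (\<lambda>i \<omega>. X (t (Suc i)) \<omega> - X (t i) \<omega>) {..<n})"

text \<open>The two sigma-algebras generated by the random variable and by the whole process are
  independent; \<^const>\<open>prob_space.indep_var\<close> would force both to have the same type.\<close>

definition indep_of_process ::
    "'w measure \<Rightarrow> ('w \<Rightarrow> real) \<Rightarrow> (real \<Rightarrow> 'w \<Rightarrow> real) \<Rightarrow> bool" where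
  "indep_of_process M T X \<longleftrightarrow>
     prob_space.indep_set M
       (sigma_sets (space M) {T -` B \<inter> space M | B. B \<in> sets borel})
       (sigma_sets (space M) {X t -` B \<inter> space M | t B. 0 \<le> t \<and> B \<in> sets borel})"

definition running_sup :: "(real \<Rightarrow> real) \<Rightarrow> real \<Rightarrow> real" where
  "running_sup x t = (SUP s\<in>{0..t}. x s)"

definition left_limit :: "(real \<Rightarrow> real) \<Rightarrow> real \<Rightarrow> real" where
  "left_limit x s = (if s = 0 then x 0 else Lim (at_left s) x)"

definition sup_time :: "(real \<Rightarrow> real) \<Rightarrow> real \<Rightarrow> real" where
  "sup_time x t = Inf {s \<in> {0..t}. max (x s) (left_limit x s) = running_sup x t}"

text \<open>A law is infinitely divisible if for each \<open>n \<ge> 1\<close> it is the law of a sum of \<open>n\<close>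
  i.i.d. summands.\<close>

definition infinitely_divisible :: "'a::euclidean_space measure \<Rightarrow> bool" where
  "infinitely_divisible \<mu> \<longleftrightarrow>
     prob_space \<mu> \<and> sets \<mu> = sets borel \<and>
     (\<forall>n\<ge>(1::nat). \<exists>\<nu>. prob_space \<nu> \<and> sets \<nu> = sets borel \<and>
        \<mu> = distr (PiM {..<n} (\<lambda>_. \<nu>)) borel (\<lambda>y. \<Sum>i<n. y i))"

text \<open>The parameter \<open>A\<close> is instantiated with the half-lines \<open>{0<..}\<close> and \<open>{..0}\<close>.\<close>

definition phi_integrand :: "complex \<Rightarrow> complex \<Rightarrow> real \<Rightarrow> real \<Rightarrow> complex" where
  "phi_integrand a b t x =
     (exp (- of_real t) - exp (a * of_real t + b * of_real \<bar>x\<bar>)) / of_real t"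

definition phi_integral_exists ::
    "'w measure \<Rightarrow> (real \<Rightarrow> 'w \<Rightarrow> real) \<Rightarrow> real set \<Rightarrow> complex \<Rightarrow> complex \<Rightarrow> bool" where
  "phi_integral_exists M X A a b \<longleftrightarrow>
     (\<forall>t>0. set_integrable (distr M borel (X t)) A (phi_integrand a b t)) \<and>
     set_integrable lborel {0<..}
       (\<lambda>t. LINT x:A|distr M borel (X t). norm (phi_integrand a b t x)) \<and>
     set_integrable lborel {0<..}
       (\<lambda>t. LINT x:A|distr M borel (X t). phi_integrand a b t x)"

definition phi ::
    "'w measure \<Rightarrow> (real \<Rightarrow> 'w \<Rightarrow> real) \<Rightarrow> real set \<Rightarrow> complex \<Rightarrow> complex \<Rightarrow> complex" where
  "phi M X A a b =
     exp (LINT t:{0<..}|lborel. LINT x:A|distr M borel (X t). phi_integrand a b t x)"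

definition Psi_plus ::
    "'w measure \<Rightarrow> (real \<Rightarrow> 'w \<Rightarrow> real) \<Rightarrow> ('w \<Rightarrow> real) \<Rightarrow> complex \<Rightarrow> complex \<Rightarrow> complex" where
  "Psi_plus M X T u v =
     (LINT \<omega>|M. exp (u * of_real (sup_time (\<lambda>t. X t \<omega>) (T \<omega>))
                    + v * of_real (running_sup (\<lambda>t. X t \<omega>) (T \<omega>))))"

definition Psi_minus ::
    "'w measure \<Rightarrow> (real \<Rightarrow> 'w \<Rightarrow> real) \<Rightarrow> ('w \<Rightarrow> real) \<Rightarrow> complex \<Rightarrow> complex \<Rightarrow> complex" where
  "Psi_minus M X T u v =
     (LINT \<omega>|M. exp (u * of_real (T \<omega> - sup_time (\<lambda>t. X t \<omega>) (T \<omega>))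
                    + v * of_real (X (T \<omega>) \<omega> - running_sup (\<lambda>t. X t \<omega>) (T \<omega>))))"

text \<open>Continuity together with \<open>\<Psi> 0 = 0\<close> singles out one logarithm on the imaginary axis;
  the values of \<open>\<Psi>\<close> off that axis are irrelevant.\<close>

definition is_characteristic_exponent ::
    "'w measure \<Rightarrow> (real \<Rightarrow> 'w \<Rightarrow> real) \<Rightarrow> (complex \<Rightarrow> complex) \<Rightarrow> bool" where
  "is_characteristic_exponent M X \<Psi> \<longleftrightarrow>
     continuous_on {v. Re v = 0} \<Psi> \<and> \<Psi> 0 = 0 \<and>
     (\<forall>v. Re v = 0 \<longrightarrow> (LINT \<omega>|M. exp (v * of_real (X 1 \<omega>))) = exp (\<Psi> v))"

end

theory Submission
  imports Defs
begin

text \<open>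
  Let \<open>S\<close> be a random walk and let \<open>k\<close> be the first index at which \<open>S\<close> attains its maximum over
  \<open>{0..m}\<close>.  Up to \<open>k\<close> the walk stays strictly below its value at \<open>k\<close>, after \<open>k\<close> it never exceeds this
  value, and these two events concern disjoint sets of steps.  Hence the expectation of a product
  of a function of \<open>(k, S k)\<close> and a function of \<open>(m - k, S m - S k)\<close> is a convolution over \<open>k\<close>
  (\<open>argmax_factorization\<close>).  If \<open>m\<close> is replaced by an independent geometric variable, the convolution
  turns into a product of two generating functions (\<open>geometric_factorization\<close>): the two pairs are
  independent.  The identity of Spitzer (\<open>spitzer_asc\<close>, \<open>spitzer_low\<close>) evaluates both factors as
  exponentials of series in \<open>\<Sum>k. s^k / k * E[exp (v * S k); S k \<in> A]\<close> with \<open>A\<close> one of the two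
  half-lines.

  The theorem is the limit of this statement for \<open>S k = X (k / (n+1))\<close>, where the number of the cell
  of the grid that contains \<open>T\<close> is geometric.  The series becomes a Riemann sum of the integral in the
  exponent of \<open>\<phi>\<close>.  Two obstacles are removed by one device.  The path may come close to its supremum
  more than once, so that the first maximum on the grid may converge to a wrong time; and \<open>X t\<close> may
  have an atom at \<open>0\<close>, where the indicator of a half-line jumps.  Subtracting \<open>e * t\<close> from the path
  with a small slope \<open>e > 0\<close> breaks ties in favour of early times, and for almost every slope the
  tilted process has no atom at \<open>0\<close> for almost all times (\<open>slopes_without_atoms\<close>).  First the mesh and then
  the slope tends to \<open>0\<close>; the filter \<open>iterated\<close> expresses this.  The integral in the exponent is
  controlled at small times by \<open>E (min 1 \<bar>X t\<bar>) \<le> C * sqrt t\<close> (\<open>small_time_bound\<close>).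

  The limit gives \<open>E (f Y * g Z) = E (f Y) * E (g Z)\<close> for continuous bounded \<open>f\<close> and \<open>g\<close>
  (\<open>expectation_product\<close>), hence independence, and the two formulas for the transforms.  For imaginary
  arguments the product of the transforms is \<open>E (exp (u * T + v * X T))\<close>, which the grid turns into a
  geometric series (\<open>product_Psi\<close>).

  For infinite divisibility, the formula of the transform of \<open>Y\<close> at real arguments reads
  \<open>E (exp (- a * Y1 - b * Y2)) = exp (- \<integral>\<integral> (1 - exp (- a * t - b * x)) \<Pi>(dt, dx))\<close> with the measure
  \<open>\<Pi>(dt, dx) = exp (- \<theta> * t) / t * P(X t \<in> dx) dt\<close> on \<open>x > 0\<close>, and the transform of \<open>Z\<close> is analogous.
  The measure \<open>\<Pi>\<close> is cut into countably many finite pieces (\<open>jump_pieces\<close>); the sum of independent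
  compound Poisson variables with the intensities \<open>\<Pi> / n\<close> is the law of an \<open>n\<close>-th part, because Laplace
  transforms determine laws on a quadrant (\<open>laplace_uniqueness\<close>).
\<close>

section \<open>Iterated limits\<close>

text \<open>
  The double limit in which \<open>n\<close> tends to infinity before \<open>k\<close> does.  As a filter it inherits the
  limit rules for sums, products and continuous functions.
\<close>

definition iterated :: "(nat \<times> nat) filter" where
  "iterated = Abs_filter (\<lambda>P. \<forall>\<^sub>F k in sequentially. \<forall>\<^sub>F n in sequentially. P (k, n))"

lemma eventually_iterated:
  "eventually P iterated \<longleftrightarrow> (\<forall>\<^sub>F k in sequentially. \<forall>\<^sub>F n in sequentially. P (k, n))"
  unfolding iterated_def
proof (rule eventually_Abs_filter, rule is_filter.intro)
  show "\<forall>\<^sub>F k in sequentially. \<forall>\<^sub>F n in sequentially. True" by simp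
next
  fix P Q :: "nat \<times> nat \<Rightarrow> bool"
  assume "\<forall>\<^sub>F k in sequentially. \<forall>\<^sub>F n in sequentially. P (k, n)"
    "\<forall>\<^sub>F k in sequentially. \<forall>\<^sub>F n in sequentially. Q (k, n)"
  then show "\<forall>\<^sub>F k in sequentially. \<forall>\<^sub>F n in sequentially. P (k, n) \<and> Q (k, n)"
    by eventually_elim (rule eventually_conj)
next
  fix P Q :: "nat \<times> nat \<Rightarrow> bool"
  assume "\<forall>x. P x \<longrightarrow> Q x" "\<forall>\<^sub>F k in sequentially. \<forall>\<^sub>F n in sequentially. P (k, n)"
  then show "\<forall>\<^sub>F k in sequentially. \<forall>\<^sub>F n in sequentially. Q (k, n)"
    by (auto elim!: eventually_mono)
qed

lemma iterated_neq_bot [simp]: "iterated \<noteq> bot"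
  unfolding trivial_limit_def eventually_iterated by simp

lemma tendsto_iteratedI:
  assumes "\<And>k. (\<lambda>n. a k n) \<longlonglongrightarrow> b k" "b \<longlonglongrightarrow> l"
  shows "((\<lambda>(k, n). a k n) \<longlongrightarrow> l) iterated"
proof (rule topological_tendstoI)
  fix S assume S: "open S" "l \<in> S"
  have "\<forall>\<^sub>F k in sequentially. b k \<in> S"
    using topological_tendstoD[OF assms(2) S] .
  then show "\<forall>\<^sub>F p in iterated. (case p of (k, n) \<Rightarrow> a k n) \<in> S"
    unfolding eventually_iterated
    by eventually_elim (use topological_tendstoD[OF assms(1) S(1)] in auto)
qed

lemma tendsto_iterated_inner:
  assumes "a \<longlonglongrightarrow> l"
  shows "((\<lambda>(k, n). a n) \<longlongrightarrow> l) iterated"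
  using assms by (intro tendsto_iteratedI[where b="\<lambda>_. l"]) auto

section \<open>Cadlag paths and the time of the supremum\<close>

lemma cadlag_right: "cadlag x \<Longrightarrow> 0 \<le> s \<Longrightarrow> (x \<longlongrightarrow> x s) (at_right s)"
  by (simp add: cadlag_def)

lemma cadlag_left:
  assumes "cadlag x" "0 < s" shows "(x \<longlongrightarrow> left_limit x s) (at_left s)"
proof -
  obtain l where l: "(x \<longlongrightarrow> l) (at_left s)" using assms by (auto simp: cadlag_def)
  then have "Lim (at_left s) x = l" by (intro tendsto_Lim) (auto simp: trivial_limit_at_left_real)
  with l assms show ?thesis by (simp add: left_limit_def)
qed

text \<open>
  The bound is pushed below \<open>c\<close> by a fixed amount \<open>c - c'\<close> so that compactness can preserve the strict
  inequality.
\<close>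

lemma cadlag_locally_less:
  assumes x: "cadlag x" and s: "0 \<le> s" and less: "max (x s) (left_limit x s) < c"
  shows "\<exists>d>0. \<exists>c'<c. \<forall>r. 0 \<le> r \<and> \<bar>r - s\<bar> < d \<longrightarrow> x r \<le> c'"
proof -
  obtain c' where c': "max (x s) (left_limit x s) < c'" "c' < c" using dense[OF less] by auto
  have "\<forall>\<^sub>F r in at_right s. x r < c'"
    using order_tendstoD(2)[OF cadlag_right[OF x s]] c' by auto
  then obtain b where b: "b > s" "\<And>y. s < y \<Longrightarrow> y < b \<Longrightarrow> x y < c'"
    by (auto simp: eventually_at_right_field)
  obtain a where a: "a < s" "\<And>y. 0 \<le> y \<Longrightarrow> a < y \<Longrightarrow> y < s \<Longrightarrow> x y < c'"
  proof (cases "s = 0")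
    case True then show ?thesis using that[of "s - 1"] by auto
  next
    case False
    have "\<forall>\<^sub>F r in at_left s. x r < c'"
      using order_tendstoD(2)[OF cadlag_left[OF x]] c' False s by auto
    then show ?thesis using that by (auto simp: eventually_at_left_field)
  qed
  have le: "x r \<le> c'" if r: "0 \<le> r \<and> \<bar>r - s\<bar> < min (b - s) (s - a)" for r
  proof (cases r s rule: linorder_cases)
      case less then show ?thesis using r a(2)[of r] by auto
    next
      case equal then show ?thesis using c' by auto
    next
      case greater then show ?thesis using r b(2)[of r] by auto
    qed
  have "0 < min (b - s) (s - a)" using a b by auto
  with le c' show ?thesis by blast
qed

lemma cadlag_left_limit_le:
  assumes x: "cadlag x" and s: "0 \<le> s" and "a < s"
    and le: "\<And>r. 0 \<le> r \<Longrightarrow> a < r \<Longrightarrow> r \<le> s \<Longrightarrow> x r \<le> c"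
  shows "left_limit x s \<le> c"
proof (cases "s = 0")
  case True then show ?thesis using le[of s] \<open>a < s\<close> by (simp add: left_limit_def)
next
  case False
  then have "0 < s" using s by simp
  have "\<forall>\<^sub>F r in at_left s. x r \<le> c"
    unfolding eventually_at_left_field
    by (rule exI[of _ "max a 0"]) (use \<open>0 < s\<close> \<open>a < s\<close> le in auto)
  then show ?thesis
    by (rule tendsto_upperbound[OF cadlag_left[OF x \<open>0 < s\<close>]])
       (simp add: trivial_limit_at_left_real)
qed

text \<open>
  Compactness of the interval.  The property \<open>Q\<close> serves two purposes: it is trivial for the
  boundedness of paths, and \<open>Q c'\<close> means \<open>c' < c\<close> for strict bounds of the supremum.
\<close>

lemma local_upper_bound_imp_global:
  fixes x :: "real \<Rightarrow> real" and Q :: "real \<Rightarrow> bool"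
  assumes t: "0 \<le> t"
    and loc: "\<And>s. 0 \<le> s \<Longrightarrow> s \<le> t \<Longrightarrow> \<exists>d>0. \<exists>c. Q c \<and> (\<forall>r. 0 \<le> r \<and> \<bar>r - s\<bar> < d \<longrightarrow> x r \<le> c)"
  shows "\<exists>c. Q c \<and> (\<forall>r\<in>{0..t}. x r \<le> c)"
proof -
  have "0 \<le> (0::real) \<longrightarrow> (\<exists>c. Q c \<and> (\<forall>r\<in>{0..t}. x r \<le> c))"
  proof (rule Bolzano[OF t, where P = "\<lambda>a b. 0 \<le> a \<longrightarrow> (\<exists>c. Q c \<and> (\<forall>r\<in>{a..b}. x r \<le> c))"])
    fix a b c :: real
    assume trans: "0 \<le> a \<longrightarrow> (\<exists>c. Q c \<and> (\<forall>r\<in>{a..b}. x r \<le> c))"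
      "0 \<le> b \<longrightarrow> (\<exists>d. Q d \<and> (\<forall>r\<in>{b..c}. x r \<le> d))" "a \<le> b" "b \<le> c"
    show "0 \<le> a \<longrightarrow> (\<exists>d. Q d \<and> (\<forall>r\<in>{a..c}. x r \<le> d))"
    proof
      assume a: "0 \<le> a"
      obtain c1 where c1: "Q c1" "\<forall>r\<in>{a..b}. x r \<le> c1" using trans a by auto
      obtain c2 where c2: "Q c2" "\<forall>r\<in>{b..c}. x r \<le> c2" using trans a by auto
      have "Q (max c1 c2)" using c1 c2 by (simp add: max_def)
      moreover have "\<forall>r\<in>{a..c}. x r \<le> max c1 c2"
      proof
        fix r assume "r \<in> {a..c}"
        then show "x r \<le> max c1 c2" using c1(2) c2(2) by (cases "r \<le> b") (auto simp: le_max_iff_disj)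
      qed
      ultimately show "\<exists>c'. Q c' \<and> (\<forall>r\<in>{a..c}. x r \<le> c')" by blast
    qed
  next
    fix s assume local: "0 \<le> s" "s \<le> t"
    then obtain d c where d: "d > 0" "Q c" "\<forall>r. 0 \<le> r \<and> \<bar>r - s\<bar> < d \<longrightarrow> x r \<le> c"
      using loc by blast
    show "\<exists>d>0. \<forall>a b. a \<le> s \<and> s \<le> b \<and> b - a < d \<longrightarrow> 0 \<le> a \<longrightarrow> (\<exists>c. Q c \<and> (\<forall>r\<in>{a..b}. x r \<le> c))"
    proof (rule exI[of _ d], intro conjI allI impI d(1))
      fix a b assume "a \<le> s \<and> s \<le> b \<and> b - a < d" "0 \<le> a"
      then show "\<exists>c. Q c \<and> (\<forall>r\<in>{a..b}. x r \<le> c)"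
        using d by (intro exI[of _ c]) auto
    qed
  qed
  then show ?thesis by simp
qed

lemma cadlag_bdd_above:
  assumes "cadlag x" shows "bdd_above (x ` {0..t})"
proof (cases "0 \<le> t")
  case True
  have "\<exists>c. True \<and> (\<forall>r\<in>{0..t}. x r \<le> c)"
  proof (rule local_upper_bound_imp_global[OF True])
    fix s :: real assume "0 \<le> s"
    from cadlag_locally_less[OF assms this, of "max (x s) (left_limit x s) + 1"]
    show "\<exists>d>0. \<exists>c. True \<and> (\<forall>r. 0 \<le> r \<and> \<bar>r - s\<bar> < d \<longrightarrow> x r \<le> c)" by auto
  qed
  then show ?thesis by (auto simp: bdd_above_def)
qed auto

lemma cadlag_uniformly_less:
  assumes "cadlag x" "0 \<le> t" "\<And>s. 0 \<le> s \<Longrightarrow> s \<le> t \<Longrightarrow> max (x s) (left_limit x s) < c"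
  shows "running_sup x t < c"
proof -
  have "\<exists>c'. c' < c \<and> (\<forall>r\<in>{0..t}. x r \<le> c')"
    by (rule local_upper_bound_imp_global) (use assms cadlag_locally_less in auto)
  then obtain c' where "c' < c" "\<forall>r\<in>{0..t}. x r \<le> c'" by auto
  moreover have "running_sup x t \<le> c'"
    unfolding running_sup_def by (rule cSUP_least) (use assms calculation in auto)
  ultimately show ?thesis by simp
qed

lemma running_sup_upper:
  assumes "cadlag x" "0 \<le> s" "s \<le> t" shows "x s \<le> running_sup x t"
  unfolding running_sup_def by (rule cSUP_upper) (use assms cadlag_bdd_above in auto)

lemma running_sup_mono:
  assumes "cadlag x" "0 \<le> s" "s \<le> t" shows "running_sup x s \<le> running_sup x t"
  unfolding running_sup_def by (rule cSUP_subset_mono) (use assms cadlag_bdd_above in auto)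

lemma max_left_limit_le_running_sup:
  assumes "cadlag x" "0 \<le> s" "s \<le> t"
  shows "max (x s) (left_limit x s) \<le> running_sup x t"
  using cadlag_left_limit_le[of x s "s - 1" "running_sup x t"] running_sup_upper[OF assms(1)] assms
  by auto

text \<open>
  The infimum is attained: near a time at which the value and the left limit are both below the
  supremum, all values and left limits stay below it, so that no attaining time can be near.
\<close>

lemma sup_time_props:
  assumes x: "cadlag x" and t: "0 \<le> t"
  shows sup_time_nonneg: "0 \<le> sup_time x t" and sup_time_le: "sup_time x t \<le> t"
    and sup_time_attains: "max (x (sup_time x t)) (left_limit x (sup_time x t)) = running_sup x t"
proof -
  define K where "K = {s \<in> {0..t}. max (x s) (left_limit x s) = running_sup x t}"
  have \<tau>: "sup_time x t = Inf K" by (simp add: sup_time_def K_def)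
  have "K \<noteq> {}"
  proof
    assume "K = {}"
    then have "\<And>s. 0 \<le> s \<Longrightarrow> s \<le> t \<Longrightarrow> max (x s) (left_limit x s) < running_sup x t"
      using max_left_limit_le_running_sup[OF x] by (fastforce simp: K_def less_le)
    from cadlag_uniformly_less[OF x t this] show False by simp
  qed
  have bdd: "bdd_below K" by (auto simp: K_def)
  obtain k where "k \<in> K" using \<open>K \<noteq> {}\<close> by auto
  have nn: "0 \<le> Inf K" by (rule cInf_greatest[OF \<open>K \<noteq> {}\<close>]) (auto simp: K_def)
  have le: "Inf K \<le> t" using cInf_lower[OF \<open>k \<in> K\<close> bdd] \<open>k \<in> K\<close> by (auto simp: K_def)
  show "0 \<le> sup_time x t" "sup_time x t \<le> t" using nn le \<tau> by auto
  show "max (x (sup_time x t)) (left_limit x (sup_time x t)) = running_sup x t"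
  proof (rule ccontr)
    assume "\<not> ?thesis"
    then have "max (x (Inf K)) (left_limit x (Inf K)) < running_sup x t"
      using max_left_limit_le_running_sup[OF x nn le] \<tau> by auto
    from cadlag_locally_less[OF x nn this] obtain d c where d: "d > 0" "c < running_sup x t"
      "\<And>r. 0 \<le> r \<Longrightarrow> \<bar>r - Inf K\<bar> < d \<Longrightarrow> x r \<le> c" by blast
    obtain s where s: "s \<in> K" "s < Inf K + d"
      using cInf_lessD[OF \<open>K \<noteq> {}\<close>, of "Inf K + d"] d(1) by auto
    have "Inf K \<le> s" by (rule cInf_lower[OF s(1) bdd])
    have "x s \<le> c" using d(3)[of s] s \<open>Inf K \<le> s\<close> nn by auto
    moreover have "left_limit x s \<le> c"
      by (rule cadlag_left_limit_le[OF x, of s "Inf K - d"])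
         (use d s \<open>Inf K \<le> s\<close> nn in \<open>auto simp: abs_if\<close>)
    ultimately show False using s d(2) by (auto simp: K_def)
  qed
qed

lemma running_sup_before_sup_time:
  assumes x: "cadlag x" and t: "0 \<le> t" and s: "0 \<le> s" "s < sup_time x t"
  shows "running_sup x s < running_sup x t"
proof (rule cadlag_uniformly_less[OF x s(1)])
  fix r assume r: "0 \<le> r" "r \<le> s"
  have "r \<le> t" using r s sup_time_le[OF x t] by simp
  show "max (x r) (left_limit x r) < running_sup x t"
  proof (rule ccontr)
    assume "\<not> ?thesis"
    then have "max (x r) (left_limit x r) = running_sup x t"
      using max_left_limit_le_running_sup[OF x r(1) \<open>r \<le> t\<close>] by auto
    then have "sup_time x t \<le> r"
      unfolding sup_time_def using r \<open>r \<le> t\<close> by (intro cInf_lower) auto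
    with r s show False by simp
  qed
qed

text \<open>
  Reduces the measurability of the time of the supremum to that of the running supremum.
\<close>

lemma sup_time_le_iff:
  assumes x: "cadlag x" and t: "0 \<le> t" and s: "0 \<le> s"
  shows "sup_time x t \<le> s \<longleftrightarrow> running_sup x (min s t) = running_sup x t"
proof
  assume le: "sup_time x t \<le> s"
  have "running_sup x t \<le> running_sup x (min s t)"
    using max_left_limit_le_running_sup[OF x sup_time_nonneg[OF x t], of "min s t"]
      sup_time_attains[OF x t] sup_time_le[OF x t] le by simp
  then show "running_sup x (min s t) = running_sup x t"
    using running_sup_mono[OF x, of "min s t" t] s t by auto
next
  assume eq: "running_sup x (min s t) = running_sup x t"
  show "sup_time x t \<le> s"
  proof (rule ccontr)
    assume "\<not> sup_time x t \<le> s"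
    then have "s < sup_time x t" by simp
    with running_sup_before_sup_time[OF x t s this] eq sup_time_le[OF x t] show False
      by (simp add: min_def split: if_splits)
  qed
qed

lemma running_sup_right_continuous:
  assumes x: "cadlag x" and t: "0 \<le> t" and u: "\<And>n. t \<le> u n" "u \<longlonglongrightarrow> t"
  shows "(\<lambda>n. running_sup x (u n)) \<longlonglongrightarrow> running_sup x t"
proof (rule order_tendstoI)
  fix a assume "a < running_sup x t"
  then show "\<forall>\<^sub>F n in sequentially. a < running_sup x (u n)"
    using running_sup_mono[OF x t u(1)] by (intro always_eventually) (auto intro: less_le_trans)
next
  fix a assume a: "running_sup x t < a"
  obtain a' where a': "running_sup x t < a'" "a' < a" using dense[OF a] by auto
  have "\<forall>\<^sub>F r in at_right t. x r < a'"
    using order_tendstoD(2)[OF cadlag_right[OF x t]] running_sup_upper[OF x t order_refl] a' by auto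
  then obtain b where b: "b > t" "\<And>y. t < y \<Longrightarrow> y < b \<Longrightarrow> x y < a'"
    by (auto simp: eventually_at_right_field)
  have "\<forall>\<^sub>F n in sequentially. u n < b" using order_tendstoD(2)[OF u(2) b(1)] .
  then show "\<forall>\<^sub>F n in sequentially. running_sup x (u n) < a"
  proof eventually_elim
    case (elim n)
    have "running_sup x (u n) \<le> a'"
      unfolding running_sup_def
    proof (rule cSUP_least)
      show "{0..u n} \<noteq> {}" using t u(1)[of n] by auto
      fix s assume s: "s \<in> {0..u n}"
      show "x s \<le> a'"
        using running_sup_upper[OF x, of s t] s a' b(2)[of s] elim by (cases "s \<le> t") auto
    qed
    with a' show ?case by simp
  qed
qed

section \<open>Maxima of discretised paths\<close>

definition first_argmax :: "(nat \<Rightarrow> real) \<Rightarrow> nat \<Rightarrow> nat" where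
  "first_argmax y n = (LEAST k. k \<le> n \<and> (\<forall>j\<le>n. y j \<le> y k))"

lemma first_argmax_props:
  shows first_argmax_le: "first_argmax y n \<le> n"
    and first_argmax_ge: "j \<le> n \<Longrightarrow> y j \<le> y (first_argmax y n)"
    and first_argmax_first: "j < first_argmax y n \<Longrightarrow> y j < y (first_argmax y n)"
proof -
  have "finite (y ` {..n})" "y ` {..n} \<noteq> {}" by auto
  then have "Max (y ` {..n}) \<in> y ` {..n}" by (rule Max_in)
  then obtain k where k: "k \<le> n" "Max (y ` {..n}) = y k" by force
  then have "k \<le> n \<and> (\<forall>j\<le>n. y j \<le> y k)" by (metis Max_ge \<open>finite (y ` {..n})\<close> atMost_iff imageI)
  then have *: "first_argmax y n \<le> n \<and> (\<forall>j\<le>n. y j \<le> y (first_argmax y n))"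
    unfolding first_argmax_def by (rule LeastI)
  then show "first_argmax y n \<le> n" "j \<le> n \<Longrightarrow> y j \<le> y (first_argmax y n)" by auto
  assume j: "j < first_argmax y n"
  from not_less_Least[OF j[unfolded first_argmax_def]] * j
  obtain i where "i \<le> n" "y j < y i" by (auto simp: not_le)
  with * show "y j < y (first_argmax y n)" by (meson less_le_trans)
qed

lemma first_argmax_eq_iff:
  "first_argmax y n = k \<longleftrightarrow> k \<le> n \<and> (\<forall>j\<le>n. y j \<le> y k) \<and> (\<forall>j<k. y j < y k)"
proof
  assume "first_argmax y n = k"
  then show "k \<le> n \<and> (\<forall>j\<le>n. y j \<le> y k) \<and> (\<forall>j<k. y j < y k)"
    using first_argmax_le[of y n] first_argmax_ge[of _ n y] first_argmax_first[of _ y n] by auto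
next
  assume k: "k \<le> n \<and> (\<forall>j\<le>n. y j \<le> y k) \<and> (\<forall>j<k. y j < y k)"
  show "first_argmax y n = k"
    unfolding first_argmax_def by (rule Least_equality) (use k in \<open>force simp: not_le[symmetric]\<close>)+
qed

definition grid :: "nat \<Rightarrow> nat \<Rightarrow> real" where
  "grid n k = real k / real (Suc n)"

text \<open>
  One more than the rounded-down index, so that its grid point lies strictly to the right of \<open>t\<close>.
  Right-continuity then applies, and the values start at \<open>1\<close>.
\<close>

definition grid_index :: "nat \<Rightarrow> real \<Rightarrow> nat" where
  "grid_index n t = Suc (nat \<lfloor>t * real (Suc n)\<rfloor>)"

lemma grid_nonneg [simp]: "0 \<le> grid n k" by (simp add: grid_def)

lemma grid_mono: "j \<le> k \<Longrightarrow> grid n j \<le> grid n k" by (simp add: grid_def divide_right_mono)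

lemma grid_index_bounds:
  assumes "0 \<le> t"
  shows "t < grid n (grid_index n t)" "grid n (grid_index n t) \<le> t + 1 / real (Suc n)"
proof -
  have fl: "real (nat \<lfloor>t * real (Suc n)\<rfloor>) = of_int \<lfloor>t * real (Suc n)\<rfloor>"
    using assms by (intro of_nat_nat) simp
  have "t * real (Suc n) < real (grid_index n t)" "real (grid_index n t) \<le> t * real (Suc n) + 1"
    unfolding grid_index_def of_nat_Suc[of "nat _"] fl
    using floor_correct[of "t * real (Suc n)"] by linarith+
  then show "t < grid n (grid_index n t)" "grid n (grid_index n t) \<le> t + 1 / real (Suc n)"
    by (simp_all add: grid_def field_simps del: of_nat_Suc)
qed

lemma squeeze_right:
  assumes "\<And>n. t \<le> f n" "\<And>n. f n \<le> t + 1 / real (Suc n)" shows "f \<longlonglongrightarrow> t"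
proof (rule tendsto_sandwich)
  show "(\<lambda>n. t) \<longlonglongrightarrow> t" by simp
  have "(\<lambda>n. t + 1 / real (Suc n)) \<longlonglongrightarrow> t + 0"
    by (intro tendsto_add tendsto_const) (use LIMSEQ_inverse_real_of_nat in \<open>simp add: divide_inverse\<close>)
  then show "(\<lambda>n. t + 1 / real (Suc n)) \<longlonglongrightarrow> t" by simp
qed (use assms in auto)

lemma grid_index_tendsto:
  assumes "0 \<le> t" shows "(\<lambda>n. grid n (grid_index n t)) \<longlonglongrightarrow> t"
  by (rule squeeze_right) (use grid_index_bounds[OF assms] in \<open>auto intro: less_imp_le\<close>)

lemma cadlag_tendsto_right:
  assumes x: "cadlag x" and t: "0 \<le> t" and u: "\<And>n. t \<le> u n" "u \<longlonglongrightarrow> t"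
  shows "(\<lambda>n. x (u n)) \<longlonglongrightarrow> x t"
proof -
  have "continuous (at_right t) x" using cadlag_right[OF x t] by (simp add: continuous_within)
  then have "(x \<longlongrightarrow> x t) (at t within {t..})"
    using cadlag_right[OF x t] by (simp add: at_within_Ici_at_right)
  then have "continuous (at t within {t..}) x" by (simp add: continuous_within)
  then have "(x \<circ> u) \<longlonglongrightarrow> x t"
    using u by (auto simp: continuous_within_sequentially)
  then show ?thesis by (simp add: o_def)
qed

lemma cadlag_tendsto_left:
  assumes x: "cadlag x" and t: "0 < t" and u: "\<And>n. u n < t" "u \<longlonglongrightarrow> t"
  shows "(\<lambda>n. x (u n)) \<longlonglongrightarrow> left_limit x t"
  by (rule filterlim_compose[OF cadlag_left[OF x t]])
     (use u in \<open>auto simp: filterlim_at less_imp_neq\<close>)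

text \<open>
  At the time of the supremum either the value or the left limit is the supremum; accordingly the time
  is approached by grid points from the right or strictly from the left.
\<close>

lemma grid_points_attaining_sup:
  assumes x: "cadlag x" and t: "0 \<le> t"
  obtains r where "\<And>n. r n \<le> grid_index n t" "(\<lambda>n. grid n (r n)) \<longlonglongrightarrow> sup_time x t"
    "(\<lambda>n. x (grid n (r n))) \<longlonglongrightarrow> running_sup x t"
proof -
  define \<tau> where "\<tau> = sup_time x t"
  have \<tau>: "0 \<le> \<tau>" "\<tau> \<le> t" using sup_time_nonneg[OF x t] sup_time_le[OF x t] by (auto simp: \<tau>_def)
  define c where "c n = nat \<lceil>\<tau> * real (Suc n)\<rceil>" for n
  have c_real: "real (c n) = of_int \<lceil>\<tau> * real (Suc n)\<rceil>" for n
    using \<tau> by (simp add: c_def of_nat_nat)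
  have c_le: "c n \<le> grid_index n t" for n
  proof -
    have "\<tau> * real (Suc n) \<le> t * real (Suc n)" using \<tau> by (intro mult_right_mono) auto
    then have "\<lceil>\<tau> * real (Suc n)\<rceil> \<le> \<lfloor>t * real (Suc n)\<rfloor> + 1" by linarith
    then show ?thesis unfolding c_def grid_index_def by linarith
  qed
  have cb: "\<tau> * real (Suc n) \<le> real (c n)" "real (c n) < \<tau> * real (Suc n) + 1" for n
    unfolding c_real using ceiling_correct[of "\<tau> * real (Suc n)"] by linarith+
  have att: "x \<tau> = running_sup x t \<or> (x \<tau> < running_sup x t \<and> left_limit x \<tau> = running_sup x t)"
    using sup_time_attains[OF x t] unfolding \<tau>_def[symmetric] by (auto simp: max_def split: if_splits)
  then show ?thesis
  proof
    assume eq: "x \<tau> = running_sup x t"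
    have b: "\<tau> \<le> grid n (c n)" "grid n (c n) \<le> \<tau> + 1 / real (Suc n)" for n
      using cb[of n] by (simp_all add: grid_def field_simps del: of_nat_Suc)
    have lim: "(\<lambda>n. grid n (c n)) \<longlonglongrightarrow> \<tau>" by (rule squeeze_right[OF b])
    have "(\<lambda>n. x (grid n (c n))) \<longlonglongrightarrow> running_sup x t"
      using cadlag_tendsto_right[OF x \<tau>(1) b(1) lim] eq by simp
    with that[of c] c_le lim show ?thesis by (simp add: \<tau>_def)
  next
    assume eq: "x \<tau> < running_sup x t \<and> left_limit x \<tau> = running_sup x t"
    then have "\<tau> \<noteq> 0" by (auto simp: left_limit_def)
    with \<tau> have pos: "0 < \<tau>" by simp
    then have "0 < c n" for n
      using cb(1)[of n] by (metis mult_pos_pos of_nat_0_less_iff order_less_le_trans zero_less_Suc)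
    then have r1: "real (c n - 1) = real (c n) - 1" for n by (simp add: of_nat_diff Suc_leI)
    have b: "grid n (c n - 1) < \<tau>" "\<tau> - 1 / real (Suc n) \<le> grid n (c n - 1)" for n
      unfolding grid_def r1 using cb[of n] by (simp_all add: field_simps del: of_nat_Suc)
    have "(\<lambda>n. - grid n (c n - 1)) \<longlonglongrightarrow> - \<tau>"
      by (rule squeeze_right) (use b in \<open>auto simp: algebra_simps intro: less_imp_le\<close>)
    from tendsto_minus[OF this] have lim: "(\<lambda>n. grid n (c n - 1)) \<longlonglongrightarrow> \<tau>" by simp
    have "(\<lambda>n. x (grid n (c n - 1))) \<longlonglongrightarrow> running_sup x t"
      using cadlag_tendsto_left[OF x pos b(1) lim] eq by simp
    moreover have "c n - 1 \<le> grid_index n t" for n using c_le[of n] by simp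
    ultimately show ?thesis using that[of "\<lambda>n. c n - 1"] lim by (simp add: \<tau>_def)
  qed
qed

text \<open>
  The path on the grid with a linear drift subtracted.  A slope \<open>e > 0\<close> makes later points
  less attractive for the maximum, which breaks ties.
\<close>

definition tilted :: "(real \<Rightarrow> real) \<Rightarrow> real \<Rightarrow> nat \<Rightarrow> nat \<Rightarrow> real" where
  "tilted x e n j = x (grid n j) - e * grid n j"

text \<open>
  Lower bound: compare with grid points near the time of the supremum, where the tilt costs at most
  \<open>e * (sup_time x t + 1)\<close>.  Upper bound: the grid reaches only slightly beyond \<open>t\<close>, and the running supremum is
  right-continuous.
\<close>

lemma grid_max_bounds:
  assumes x: "cadlag x" and t: "0 \<le> t" and e: "0 \<le> e" and \<eta>: "0 < \<eta>"
  shows "\<forall>\<^sub>F n in sequentially.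
    running_sup x t - e * (sup_time x t + 1) - \<eta>
      < tilted x e n (first_argmax (tilted x e n) (grid_index n t)) \<and>
    tilted x e n (first_argmax (tilted x e n) (grid_index n t)) < running_sup x t + \<eta>"
proof -
  obtain r where r: "\<And>n. r n \<le> grid_index n t" "(\<lambda>n. grid n (r n)) \<longlonglongrightarrow> sup_time x t"
    "(\<lambda>n. x (grid n (r n))) \<longlonglongrightarrow> running_sup x t"
    using grid_points_attaining_sup[OF x t] by blast
  have rs: "(\<lambda>n. running_sup x (grid n (grid_index n t))) \<longlonglongrightarrow> running_sup x t"
    by (rule running_sup_right_continuous[OF x t])
       (use grid_index_bounds(1)[OF t] grid_index_tendsto[OF t] in \<open>auto intro: less_imp_le\<close>)
  have "\<forall>\<^sub>F n in sequentially. running_sup x t - \<eta> < x (grid n (r n))"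
    using order_tendstoD(1)[OF r(3)] \<eta> by auto
  moreover have "\<forall>\<^sub>F n in sequentially. grid n (r n) < sup_time x t + 1"
    using order_tendstoD(2)[OF r(2)] by auto
  moreover have "\<forall>\<^sub>F n in sequentially. running_sup x (grid n (grid_index n t)) < running_sup x t + \<eta>"
    using order_tendstoD(2)[OF rs] \<eta> by auto
  ultimately show ?thesis
  proof eventually_elim
    case (elim n)
    let ?k = "first_argmax (tilted x e n) (grid_index n t)"
    have "tilted x e n (r n) \<le> tilted x e n ?k" using r(1) by (rule first_argmax_ge)
    moreover have "e * grid n (r n) \<le> e * (sup_time x t + 1)" using elim e by (intro mult_left_mono) auto
    ultimately have 1: "running_sup x t - e * (sup_time x t + 1) - \<eta> < tilted x e n ?k"
      using elim by (simp add: tilted_def)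
    have "x (grid n ?k) \<le> running_sup x (grid n (grid_index n t))"
      by (intro running_sup_upper x grid_nonneg grid_mono first_argmax_le)
    moreover have "0 \<le> e * grid n ?k" using e by simp
    ultimately show ?case using 1 elim by (simp add: tilted_def)
  qed
qed

lemma grid_max_tendsto:
  assumes x: "cadlag x" and t: "0 \<le> t"
  shows "(\<lambda>n. tilted x 0 n (first_argmax (tilted x 0 n) (grid_index n t))) \<longlonglongrightarrow> running_sup x t"
proof (rule order_tendstoI)
  fix a assume "a < running_sup x t"
  with grid_max_bounds[OF x t, of 0 "running_sup x t - a"]
  show "\<forall>\<^sub>F n in sequentially. a < tilted x 0 n (first_argmax (tilted x 0 n) (grid_index n t))"
    by (auto elim: eventually_mono)
next
  fix a assume "running_sup x t < a"
  with grid_max_bounds[OF x t, of 0 "a - running_sup x t"]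
  show "\<forall>\<^sub>F n in sequentially. tilted x 0 n (first_argmax (tilted x 0 n) (grid_index n t)) < a"
    by (auto elim: eventually_mono)
qed

context
  fixes x :: "real \<Rightarrow> real" and t :: real and e :: "nat \<Rightarrow> real"
  assumes x: "cadlag x" and t: "0 \<le> t" and e: "\<And>k. 0 < e k" "e \<longlonglongrightarrow> 0"
begin

lemma slope_small:
  assumes "0 < \<eta>" shows "\<forall>\<^sub>F k in sequentially. e k * (sup_time x t + 1) < \<eta>"
proof -
  have "(\<lambda>k. e k * (sup_time x t + 1)) \<longlonglongrightarrow> 0 * (sup_time x t + 1)"
    by (intro tendsto_intros e)
  then show ?thesis using order_tendstoD(2)[of _ "0::real" _ \<eta>] assms by simp
qed

lemma tilted_max_tendsto:
  "((\<lambda>(k, n). tilted x (e k) n (first_argmax (tilted x (e k) n) (grid_index n t)))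
     \<longlongrightarrow> running_sup x t) iterated"
proof (rule order_tendstoI)
  fix a assume a: "a < running_sup x t"
  then have "\<forall>\<^sub>F k in sequentially. e k * (sup_time x t + 1) < (running_sup x t - a) / 2"
    by (intro slope_small) auto
  then show "\<forall>\<^sub>F p in iterated. a < (case p of (k, n) \<Rightarrow>
      tilted x (e k) n (first_argmax (tilted x (e k) n) (grid_index n t)))"
    unfolding eventually_iterated
  proof eventually_elim
    case (elim k)
    from grid_max_bounds[OF x t less_imp_le[OF e(1)[of k]], of "(running_sup x t - a) / 2"]
    show ?case by (rule eventually_mono) (use elim a in \<open>auto simp: field_simps\<close>)
  qed
next
  fix a assume a: "running_sup x t < a"
  show "\<forall>\<^sub>F p in iterated. (case p of (k, n) \<Rightarrow>
      tilted x (e k) n (first_argmax (tilted x (e k) n) (grid_index n t))) < a"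
    unfolding eventually_iterated
  proof (rule always_eventually, rule allI)
    fix k
    from grid_max_bounds[OF x t less_imp_le[OF e(1)[of k]], of "a - running_sup x t"]
    show "\<forall>\<^sub>F n in sequentially. (case (k, n) of (k, n) \<Rightarrow>
      tilted x (e k) n (first_argmax (tilted x (e k) n) (grid_index n t))) < a"
      by (rule eventually_mono) (use a in auto)
  qed
qed

text \<open>
  The argmax is not too early, because before \<open>a < sup_time x t\<close> the path stays below the supremum by a
  fixed gap, which exceeds the cost of a small tilt.  It is not too late, because a value that is hardly above the
  supremum cannot pay for a tilt at a time \<open>a > sup_time x t\<close>; this uses a positive slope.
\<close>

lemma tilted_argmax_tendsto:
  "((\<lambda>(k, n). grid n (first_argmax (tilted x (e k) n) (grid_index n t)))
     \<longlongrightarrow> sup_time x t) iterated"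
proof (rule order_tendstoI)
  let ?\<tau> = "sup_time x t"
  fix a assume a: "a < ?\<tau>"
  show "\<forall>\<^sub>F p in iterated. a < (case p of (k, n) \<Rightarrow>
      grid n (first_argmax (tilted x (e k) n) (grid_index n t)))"
  proof (cases "0 \<le> a")
    case False
    then show ?thesis by (intro always_eventually) (auto intro: less_le_trans[OF _ grid_nonneg])
  next
    case True
    \<comment> \<open>Half of the gap is reserved for the tilt, the other half for the error of the grid.\<close>
    define \<delta> where "\<delta> = (running_sup x t - running_sup x a) / 2"
    have \<delta>: "0 < \<delta>" using running_sup_before_sup_time[OF x t True a] by (simp add: \<delta>_def)
    from slope_small[OF \<delta>] show ?thesis
      unfolding eventually_iterated
    proof eventually_elim
      case (elim k)
      from grid_max_bounds[OF x t less_imp_le[OF e(1)[of k]] \<delta>]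
      show ?case
      proof (rule eventually_mono)
        fix n
        let ?j = "first_argmax (tilted x (e k) n) (grid_index n t)"
        assume "running_sup x t - e k * (?\<tau> + 1) - \<delta> < tilted x (e k) n ?j
          \<and> tilted x (e k) n ?j < running_sup x t + \<delta>"
        then have 1: "running_sup x t - e k * (?\<tau> + 1) - \<delta> < tilted x (e k) n ?j" ..
        have "a < grid n ?j"
        proof (rule ccontr)
          assume "\<not> a < grid n ?j"
          then have "x (grid n ?j) \<le> running_sup x a" by (intro running_sup_upper x) auto
          moreover have "0 \<le> e k * grid n ?j" using e(1)[of k] by simp
          ultimately show False using 1 elim unfolding \<delta>_def tilted_def by argo
        qed
        then show "a < (case (k, n) of (k, n) \<Rightarrow>
          grid n (first_argmax (tilted x (e k) n) (grid_index n t)))" by simp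
      qed
    qed
  qed
next
  let ?\<tau> = "sup_time x t"
  fix a assume a: "?\<tau> < a"
  obtain r where r: "\<And>n. r n \<le> grid_index n t" "(\<lambda>n. grid n (r n)) \<longlonglongrightarrow> ?\<tau>"
    "(\<lambda>n. x (grid n (r n))) \<longlonglongrightarrow> running_sup x t"
    using grid_points_attaining_sup[OF x t] by blast
  have rs: "(\<lambda>n. running_sup x (grid n (grid_index n t))) \<longlonglongrightarrow> running_sup x t"
    by (rule running_sup_right_continuous[OF x t])
       (use grid_index_bounds(1)[OF t] grid_index_tendsto[OF t] in \<open>auto intro: less_imp_le\<close>)
  show "\<forall>\<^sub>F p in iterated. (case p of (k, n) \<Rightarrow>
      grid n (first_argmax (tilted x (e k) n) (grid_index n t))) < a"
    unfolding eventually_iterated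
  proof (rule always_eventually, rule allI)
    fix k
    have ek: "0 < e k" by (rule e)
    have "(\<lambda>n. running_sup x (grid n (grid_index n t)) - tilted x (e k) n (r n))
       \<longlonglongrightarrow> running_sup x t - (running_sup x t - e k * ?\<tau>)"
      unfolding tilted_def by (intro tendsto_intros r rs)
    moreover have "running_sup x t - (running_sup x t - e k * ?\<tau>) < e k * a"
      using ek a by simp
    ultimately have "\<forall>\<^sub>F n in sequentially.
        running_sup x (grid n (grid_index n t)) - tilted x (e k) n (r n) < e k * a"
      by (rule order_tendstoD(2))
    then show "\<forall>\<^sub>F n in sequentially. (case (k, n) of (k, n) \<Rightarrow>
        grid n (first_argmax (tilted x (e k) n) (grid_index n t))) < a"
    proof eventually_elim
      case (elim n)
      let ?j = "first_argmax (tilted x (e k) n) (grid_index n t)"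
      have "tilted x (e k) n (r n) \<le> tilted x (e k) n ?j" using r(1) by (rule first_argmax_ge)
      moreover have "x (grid n ?j) \<le> running_sup x (grid n (grid_index n t))"
        by (intro running_sup_upper x grid_nonneg grid_mono first_argmax_le)
      ultimately have "e k * grid n ?j < e k * a" using elim by (simp add: tilted_def)
      then show ?case using ek by simp
    qed
  qed
qed

lemma tilted_end_tendsto:
  "((\<lambda>(k, n). tilted x (e k) n (grid_index n t)) \<longlongrightarrow> x t) iterated"
proof (rule tendsto_iteratedI)
  have g: "(\<lambda>n. grid n (grid_index n t)) \<longlonglongrightarrow> t" by (rule grid_index_tendsto[OF t])
  have "(\<lambda>n. x (grid n (grid_index n t))) \<longlonglongrightarrow> x t"
    by (rule cadlag_tendsto_right[OF x t _ g]) (use grid_index_bounds(1)[OF t] in \<open>auto intro: less_imp_le\<close>)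
  with g show "(\<lambda>n. tilted x (e k) n (grid_index n t)) \<longlonglongrightarrow> x t - e k * t" for k
    unfolding tilted_def by (intro tendsto_intros)
  have "(\<lambda>k. x t - e k * t) \<longlonglongrightarrow> x t - 0 * t" by (intro tendsto_intros e)
  then show "(\<lambda>k. x t - e k * t) \<longlonglongrightarrow> x t" by simp
qed

end

section \<open>Power series, exponentials and Fourier uniqueness\<close>

text \<open>
  The recursion says that the generating function \<open>f\<close> of \<open>a\<close> satisfies \<open>f' = g' * f\<close>, where \<open>g\<close> has the
  coefficients \<open>c k / k\<close>; hence \<open>f * exp (- g)\<close> is constant.
\<close>

lemma exp_power_series_of_recursion:
  fixes a c :: "nat \<Rightarrow> complex"
  assumes a0: "a 0 = 1"
    and rec: "\<And>n. of_nat n * a n = (\<Sum>k=1..n. c k * a (n - k))"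
    and a: "\<And>n. norm (a n) \<le> 1" and c: "\<And>n. norm (c n) \<le> 1" and s: "norm s < 1"
  shows "(\<lambda>n. a n * s ^ n) sums exp (\<Sum>k. c (Suc k) * s ^ Suc k / of_nat (Suc k))"
proof -
  \<comment> \<open>The division by zero gives \<open>b 0 = 0\<close>, as required for a power series without constant term.\<close>
  define b where "b k = c k / of_nat k" for k
  have b0: "b 0 = 0" by (simp add: b_def)
  have b: "norm (b n) \<le> 1" for n
  proof (cases "n = 0")
    case False
    then have "norm (b n) \<le> 1 / real n" using c[of n] by (simp add: b_def norm_divide divide_right_mono)
    also have "\<dots> \<le> 1" using False by simp
    finally show ?thesis .
  qed (simp add: b0)
  have ncb: "norm (d n * z ^ n) \<le> norm z ^ n" if "\<And>n. norm (d n) \<le> 1" for d :: "nat \<Rightarrow> complex" and z n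
    using that[of n] by (simp add: norm_mult norm_power mult_left_le_one_le)
  have nsum: "summable (\<lambda>n. norm (d n * z ^ n))" if "\<And>n. norm (d n) \<le> 1" "norm z < 1"
    for d :: "nat \<Rightarrow> complex" and z
    by (rule summable_comparison_test'[of "\<lambda>n. norm z ^ n" 0]) (use ncb[OF that(1)] that(2) in auto)
  define f where "f z = (\<Sum>n. a n * z ^ n)" for z
  define g where "g z = (\<Sum>n. b n * z ^ n)" for z
  have der: "((\<lambda>z. \<Sum>n. d n * z ^ n) has_field_derivative (\<Sum>n. diffs d n * z ^ n)) (at z)"
    if d: "\<And>n. norm (d n) \<le> 1" and z: "norm z < 1" for d :: "nat \<Rightarrow> complex" and z
  proof -
    obtain r where r: "norm z < r" "r < 1" using dense[OF z] by auto
    then have r0: "0 \<le> r" using norm_ge_zero[of z] by linarith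
    have "summable (\<lambda>n. d n * complex_of_real r ^ n)"
      by (rule summable_norm_cancel, rule nsum[OF d]) (use r r0 in auto)
    then show ?thesis by (rule termdiffs_strong) (use r r0 in auto)
  qed
  have da: "diffs a n = (\<Sum>i\<le>n. diffs b i * a (n - i))" for n
  proof -
    have "diffs a n = of_nat (Suc n) * a (Suc n)" by (simp add: diffs_def)
    also have "\<dots> = (\<Sum>k=1..Suc n. c k * a (Suc n - k))" by (rule rec)
    also have "\<dots> = (\<Sum>i\<le>n. c (Suc i) * a (n - i))"
      using sum.shift_bounds_cl_Suc_ivl[of "\<lambda>k. c k * a (Suc n - k)" 0 n]
      by (simp add: atLeast0AtMost)
    also have "\<dots> = (\<Sum>i\<le>n. diffs b i * a (n - i))"
      by (simp add: diffs_def b_def del: of_nat_Suc)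
    finally show ?thesis .
  qed
  have c1: "norm (diffs b n) \<le> 1" for n
    using c[of "Suc n"] by (simp add: diffs_def b_def del: of_nat_Suc)
  have f': "(\<Sum>n. diffs a n * z ^ n) = (\<Sum>n. diffs b n * z ^ n) * f z" if z: "norm z < 1" for z
  proof -
    have "(\<lambda>n. \<Sum>i\<le>n. (diffs b i * z ^ i) * (a (n - i) * z ^ (n - i))) sums
        ((\<Sum>n. diffs b n * z ^ n) * f z)"
      unfolding f_def by (rule Cauchy_product_sums) (use nsum[OF c1 z] nsum[OF a z] in auto)
    moreover have "(\<Sum>i\<le>n. (diffs b i * z ^ i) * (a (n - i) * z ^ (n - i))) = diffs a n * z ^ n" for n
    proof -
      have "(diffs b i * z ^ i) * (a (n - i) * z ^ (n - i)) = diffs b i * a (n - i) * z ^ n"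
        if "i \<le> n" for i
        using that by (simp add: power_add[symmetric] mult_ac)
      then show ?thesis unfolding da sum_distrib_right by (intro sum.cong) auto
    qed
    ultimately show ?thesis by (simp add: sums_iff)
  qed
  have "\<exists>k. \<forall>z\<in>ball 0 1. f z * exp (- g z) = k"
  proof (rule has_field_derivative_zero_constant)
    fix z :: complex assume "z \<in> ball 0 1"
    then have z: "norm z < 1" by simp
    have "(f has_field_derivative (\<Sum>n. diffs b n * z ^ n) * f z) (at z)"
      using der[where d = a, OF a z] unfolding f'[OF z] by (simp add: f_def[abs_def])
    moreover have "(g has_field_derivative (\<Sum>n. diffs b n * z ^ n)) (at z)"
      using der[where d = b, OF b z] by (simp add: g_def[abs_def])
    ultimately have "((\<lambda>z. f z * exp (- g z)) has_field_derivative 0) (at z)"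
      by (auto intro!: derivative_eq_intros)
    then show "((\<lambda>z. f z * exp (- g z)) has_field_derivative 0) (at z within ball 0 1)"
      by (rule has_field_derivative_at_within)
  qed simp
  then obtain k where k: "\<And>z. norm z < 1 \<Longrightarrow> f z * exp (- g z) = k" by auto
  have "f 0 = 1" using a0 by (simp add: f_def powser_zero)
  moreover have "g 0 = 0" using b0 by (simp add: g_def powser_zero)
  ultimately have "k = 1" using k[of 0] by simp
  then have "f s = exp (g s)" using k[OF s] by (simp add: exp_minus field_simps)
  moreover have "(\<lambda>n. a n * s ^ n) sums f s"
    unfolding f_def by (rule summable_sums, rule summable_norm_cancel, rule nsum[OF a s])
  moreover have "g s = (\<Sum>k. c (Suc k) * s ^ Suc k / of_nat (Suc k))"
    unfolding g_def using suminf_split_head[OF summable_norm_cancel[OF nsum[where d = b, OF b s]]]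
    by (simp add: b_def mult.commute)
  ultimately show ?thesis by simp
qed

lemma exp_increment_limit:
  fixes z :: complex
  shows "(\<lambda>n. of_nat (Suc n) * (exp (z / of_nat (Suc n)) - 1)) \<longlonglongrightarrow> z"
proof (cases "z = 0")
  case False
  have "((\<lambda>h. (exp h - 1) / h) \<longlongrightarrow> 1) (at (0::complex))"
    using DERIV_exp[of "0::complex"] by (simp add: DERIV_def)
  moreover have "filterlim (\<lambda>n. z / of_nat (Suc n)) (at 0) sequentially"
    unfolding filterlim_at
  proof
    have "(\<lambda>n. z * of_real (inverse (real (Suc n)))) \<longlonglongrightarrow> z * of_real 0"
      by (intro tendsto_intros LIMSEQ_inverse_real_of_nat)
    then show "(\<lambda>n. z / of_nat (Suc n)) \<longlonglongrightarrow> 0" by (simp add: divide_inverse)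
  qed (use False in \<open>auto simp del: of_nat_Suc\<close>)
  ultimately have "(\<lambda>n. (exp (z / of_nat (Suc n)) - 1) / (z / of_nat (Suc n))) \<longlonglongrightarrow> 1"
    by (rule filterlim_compose)
  then have "(\<lambda>n. z * ((exp (z / of_nat (Suc n)) - 1) / (z / of_nat (Suc n)))) \<longlonglongrightarrow> z * 1"
    by (intro tendsto_intros)
  moreover have "z * ((exp (z / of_nat (Suc n)) - 1) / (z / of_nat (Suc n))) =
      of_nat (Suc n) * (exp (z / of_nat (Suc n)) - 1)" for n
    using False by (simp del: of_nat_Suc)
  ultimately show ?thesis by simp
qed simp

text \<open>
  A signed measure with vanishing Fourier transform is zero.  The positive and the negative part of the
  density have equal mass; normalised, they give laws of \<open>S\<close> with the same characteristic function.
\<close>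

lemma zero_of_fourier_zero:
  fixes W S :: "'a \<Rightarrow> real" and f :: "real \<Rightarrow> complex"
  assumes M: "prob_space M" and S[measurable]: "S \<in> borel_measurable M" and W: "integrable M W"
    and zero: "\<And>v. (\<integral>\<omega>. of_real (W \<omega>) * iexp (v * S \<omega>) \<partial>M) = 0"
    and f[measurable]: "f \<in> borel_measurable borel" and bdd: "\<And>x. norm (f x) \<le> B"
  shows "(\<integral>\<omega>. of_real (W \<omega>) * f (S \<omega>) \<partial>M) = 0"
proof -
  interpret prob_space M by (rule M)
  have [measurable]: "W \<in> borel_measurable M" using W by simp
  define p where "p \<omega> = max 0 (W \<omega>)" for \<omega>
  define q where "q \<omega> = max 0 (- W \<omega>)" for \<omega>
  have [measurable]: "p \<in> borel_measurable M" "q \<in> borel_measurable M" unfolding p_def[abs_def] q_def[abs_def] by auto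
  have ip: "integrable M p" and iq: "integrable M q"
    unfolding p_def[abs_def] q_def[abs_def] using W by (auto intro!: integrable_max)
  have Wpq: "W \<omega> = p \<omega> - q \<omega>" for \<omega> by (auto simp: p_def q_def)
  have pq0: "0 \<le> p \<omega>" "0 \<le> q \<omega>" for \<omega> by (auto simp: p_def q_def)
  have int: "integrable M (\<lambda>\<omega>. of_real (r \<omega>) * h (S \<omega>))"
    if r: "integrable M r" and h[measurable]: "h \<in> borel_measurable borel" "\<And>x. norm (h x) \<le> C"
    for r :: "'a \<Rightarrow> real" and h :: "real \<Rightarrow> complex" and C
  proof (rule Bochner_Integration.integrable_bound[of _ "\<lambda>\<omega>. C * r \<omega>"])
    show "integrable M (\<lambda>\<omega>. C * r \<omega>)" using r by simp
    have [measurable]: "r \<in> borel_measurable M" using r by simp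
    show "(\<lambda>\<omega>. of_real (r \<omega>) * h (S \<omega>)) \<in> borel_measurable M" by measurable
    have "norm (r \<omega>) * norm (h (S \<omega>)) \<le> norm (C * r \<omega>)" for \<omega>
      using mult_left_mono[OF h(2)[of "S \<omega>"], of "norm (r \<omega>)"] order_trans[OF norm_ge_zero h(2)[of 0]]
      by (simp add: abs_mult mult.commute)
    then show "AE \<omega> in M. norm (of_real (r \<omega>) * h (S \<omega>)) \<le> norm (C * r \<omega>)" by (simp add: norm_mult)
  qed
  have diff: "(\<integral>\<omega>. of_real (W \<omega>) * h (S \<omega>) \<partial>M) =
      (\<integral>\<omega>. of_real (p \<omega>) * h (S \<omega>) \<partial>M) - (\<integral>\<omega>. of_real (q \<omega>) * h (S \<omega>) \<partial>M)"
    if "h \<in> borel_measurable borel" "\<And>x. norm (h x) \<le> C" for h :: "real \<Rightarrow> complex" and C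
    unfolding Wpq using int[OF ip that] int[OF iq that]
    by (simp add: left_diff_distrib Bochner_Integration.integral_diff)
  define m where "m = (\<integral>\<omega>. p \<omega> \<partial>M)"
  have mq: "m = (\<integral>\<omega>. q \<omega> \<partial>M)"
  proof -
    have "(\<integral>\<omega>. complex_of_real (W \<omega>) \<partial>M) = 0" using zero[of 0] by simp
    then have "(\<integral>\<omega>. W \<omega> \<partial>M) = 0" by simp
    then show ?thesis using ip iq by (simp add: Wpq m_def)
  qed
  have m0: "0 \<le> m" unfolding m_def using pq0 by (intro integral_nonneg_AE) auto
  show ?thesis
  proof (cases "m = 0")
    case True
    have "AE \<omega> in M. p \<omega> = 0" "AE \<omega> in M. q \<omega> = 0"
      using True mq pq0 integral_nonneg_eq_0_iff_AE[OF ip] integral_nonneg_eq_0_iff_AE[OF iq]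
      by (auto simp: m_def)
    then have "AE \<omega> in M. of_real (W \<omega>) * f (S \<omega>) = 0" by eventually_elim (simp add: Wpq)
    then show ?thesis by (rule integral_eq_zero_AE)
  next
    case False
    with m0 have m: "0 < m" by simp
    define \<nu> where "\<nu> r = distr (density M (\<lambda>\<omega>. ennreal (r \<omega> / m))) borel S" for r :: "'a \<Rightarrow> real"
    have \<nu>: "real_distribution (\<nu> r)"
      if r: "integrable M r" "\<And>\<omega>. 0 \<le> r \<omega>" "(\<integral>\<omega>. r \<omega> \<partial>M) = m" for r
    proof -
      have [measurable]: "r \<in> borel_measurable M" using r by simp
      have "(\<integral>\<^sup>+\<omega>. ennreal (r \<omega> / m) \<partial>M) = ennreal (\<integral>\<omega>. r \<omega> / m \<partial>M)"
        using r m by (intro nn_integral_eq_integral) auto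
      also have "\<dots> = 1" using r(3) m by simp
      finally have "prob_space (density M (\<lambda>\<omega>. ennreal (r \<omega> / m)))"
        by (intro prob_spaceI) (simp add: emeasure_density cong: nn_integral_cong)
      then have "prob_space (\<nu> r)" unfolding \<nu>_def by (rule prob_space.prob_space_distr) simp
      then show ?thesis by (auto simp: real_distribution_def real_distribution_axioms_def \<nu>_def)
    qed
    have int\<nu>: "(\<integral>x. h x \<partial>\<nu> r) = (\<integral>\<omega>. of_real (r \<omega>) * h (S \<omega>) \<partial>M) / m"
      if r: "integrable M r" "\<And>\<omega>. 0 \<le> r \<omega>" and h[measurable]: "h \<in> borel_measurable borel"
      for r and h :: "real \<Rightarrow> complex"
    proof -
      have [measurable]: "r \<in> borel_measurable M" using r by simp
      have "(\<integral>x. h x \<partial>\<nu> r) = (\<integral>\<omega>. h (S \<omega>) \<partial>density M (\<lambda>\<omega>. ennreal (r \<omega> / m)))"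
        unfolding \<nu>_def by (rule integral_distr) auto
      also have "\<dots> = (\<integral>\<omega>. (r \<omega> / m) *\<^sub>R h (S \<omega>) \<partial>M)"
        by (rule integral_density) (use r m in auto)
      also have "\<dots> = (\<integral>\<omega>. of_real (r \<omega>) * h (S \<omega>) / m \<partial>M)"
        by (simp add: scaleR_conv_of_real)
      finally show ?thesis by simp
    qed
    have dp: "real_distribution (\<nu> p)" by (rule \<nu>[OF ip pq0(1)]) (simp add: m_def)
    have dq: "real_distribution (\<nu> q)" by (rule \<nu>[OF iq pq0(2)]) (simp add: mq)
    have "char (\<nu> p) = char (\<nu> q)"
    proof
      fix v :: real
      have meas: "(\<lambda>x. iexp (v * x)) \<in> borel_measurable borel" by measurable
      have "norm (iexp (v * x)) \<le> 1" for x :: real by simp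
      then show "char (\<nu> p) v = char (\<nu> q) v"
        unfolding char_def int\<nu>[OF ip pq0(1) meas] int\<nu>[OF iq pq0(2) meas]
        using diff[OF meas, of 1] zero[of v] by simp
    qed
    then have "\<nu> p = \<nu> q" by (rule Levy_uniqueness[OF dp dq])
    then have "(\<integral>\<omega>. of_real (p \<omega>) * f (S \<omega>) \<partial>M) = (\<integral>\<omega>. of_real (q \<omega>) * f (S \<omega>) \<partial>M)"
      using int\<nu>[OF ip pq0(1) f] int\<nu>[OF iq pq0(2) f] m by simp
    then show ?thesis using diff[OF f bdd] by simp
  qed
qed

text \<open>
  Formal version of the factorisation argument.  Let \<open>A\<close>, \<open>B\<close>, \<open>C\<close>, \<open>D\<close> be the generating series in \<open>X\<close>,
  with \<open>c 0\<close> and \<open>d 0\<close> replaced by \<open>0\<close>.  Since \<open>A * B\<close> is the geometric series \<open>\<Sum> z^n X^n\<close>, its logarithmic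
  derivative gives \<open>X * (A * B)' = (C + D) * (A * B)\<close>, that is \<open>E * B + A * F = 0\<close> with the defects
  \<open>E = X * A' - C * A\<close> and \<open>F = X * B' - D * B\<close>.  If the defects vanish below order \<open>n\<close>, then comparison at order \<open>n\<close>
  leaves \<open>E_n + F_n = 0\<close>.
\<close>

lemma wiener_hopf_coefficients:
  fixes A B c d :: "nat \<Rightarrow> complex" and z :: complex
  assumes A0: "A 0 = 1" and B0: "B 0 = 1"
    and AB: "\<And>n. (\<Sum>k\<le>n. A k * B (n - k)) = z ^ n"
    and cd: "\<And>k. c k + d k = z ^ k"
    and less: "\<And>j. j < n \<Longrightarrow> of_nat j * A j = (\<Sum>k=1..j. c k * A (j - k))"
      "\<And>j. j < n \<Longrightarrow> of_nat j * B j = (\<Sum>k=1..j. d k * B (j - k))"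
  shows "(of_nat n * A n - (\<Sum>k=1..n. c k * A (n - k))) + (of_nat n * B n - (\<Sum>k=1..n. d k * B (n - k))) = 0"
proof -
  define FA where "FA = Abs_fps A"
  define FB where "FB = Abs_fps B"
  define FC where "FC = Abs_fps (\<lambda>k. if k = 0 then 0 else c k)"
  define FD where "FD = Abs_fps (\<lambda>k. if k = 0 then 0 else d k)"
  define E where "E = fps_X * fps_deriv FA - FC * FA"
  define F where "F = fps_X * fps_deriv FB - FD * FB"
  have head: "(\<Sum>k=1..j. u k * w (j - k)) = fps_nth (Abs_fps (\<lambda>k. if k = 0 then 0 else u k) * Abs_fps w) j"
    for u w :: "nat \<Rightarrow> complex" and j
    by (auto simp: fps_mult_nth sum.atLeast_Suc_atMost intro!: sum.cong)
  have Ej: "fps_nth E j = of_nat j * A j - (\<Sum>k=1..j. c k * A (j - k))" for j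
    unfolding head[of c A j] by (cases j) (simp_all add: E_def FA_def FC_def)
  have Fj: "fps_nth F j = of_nat j * B j - (\<Sum>k=1..j. d k * B (j - k))" for j
    unfolding head[of d B j] by (cases j) (simp_all add: F_def FB_def FD_def)
  have P: "FA * FB = Abs_fps (\<lambda>n. z ^ n)"
    by (rule fps_ext) (simp add: FA_def FB_def fps_mult_nth AB atLeast0AtMost)
  have "fps_X * fps_deriv (FA * FB) = (FC + FD) * (FA * FB)"
  proof (rule fps_ext)
    fix j
    have CD: "FC + FD = Abs_fps (\<lambda>k. if k = 0 then 0 else z ^ k)"
      by (rule fps_ext) (simp add: FC_def FD_def cd)
    have "fps_nth ((FC + FD) * (FA * FB)) j = (\<Sum>k=1..j. z ^ k * z ^ (j - k))"
      unfolding P CD head[of "\<lambda>k. z ^ k" "\<lambda>k. z ^ k" j] ..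
    also have "\<dots> = (\<Sum>k=1..j. z ^ j)" by (rule sum.cong) (auto simp: power_add[symmetric])
    also have "\<dots> = of_nat j * z ^ j" by simp
    also have "\<dots> = fps_nth (fps_X * fps_deriv (FA * FB)) j" unfolding P by (cases j) simp_all
    finally show "fps_nth (fps_X * fps_deriv (FA * FB)) j = fps_nth ((FC + FD) * (FA * FB)) j" ..
  qed
  then have "E * FB + FA * F = 0" unfolding E_def F_def by (simp add: algebra_simps)
  then have "0 = fps_nth (E * FB) n + fps_nth (F * FA) n"
    by (metis fps_add_nth fps_zero_nth mult.commute)
  also have "\<dots> = (\<Sum>k=0..n. fps_nth E k * B (n - k)) + (\<Sum>k=0..n. fps_nth F k * A (n - k))"
    by (simp add: fps_mult_nth FA_def FB_def)
  also have "(\<Sum>k=0..n. fps_nth E k * B (n - k)) = (\<Sum>k=0..n. if k = n then fps_nth E n else 0)"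
    by (rule sum.cong) (use less(1) B0 in \<open>auto simp: Ej\<close>)
  also have "(\<Sum>k=0..n. fps_nth F k * A (n - k)) = (\<Sum>k=0..n. if k = n then fps_nth F n else 0)"
    by (rule sum.cong) (use less(2) A0 in \<open>auto simp: Fj\<close>)
  finally show ?thesis by (simp add: Ej Fj)
qed

section \<open>The first maximum of a random walk and the identity of Spitzer\<close>

definition walk :: "(nat \<Rightarrow> real) \<Rightarrow> nat \<Rightarrow> real" where
  "walk \<omega> n = (\<Sum>i<n. \<omega> i)"

definition later_steps :: "nat \<Rightarrow> (nat \<Rightarrow> real) \<Rightarrow> nat \<Rightarrow> real" where
  "later_steps k \<omega> = (\<lambda>j. \<omega> (j + k))"

definition strict_ladder :: "nat \<Rightarrow> (nat \<Rightarrow> real) \<Rightarrow> bool" where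
  "strict_ladder n \<omega> \<longleftrightarrow> (\<forall>j<n. walk \<omega> j < walk \<omega> n)"

definition stays_nonpos :: "nat \<Rightarrow> (nat \<Rightarrow> real) \<Rightarrow> bool" where
  "stays_nonpos n \<omega> \<longleftrightarrow> (\<forall>j\<le>n. walk \<omega> j \<le> 0)"

lemma walk_0 [simp]: "walk \<omega> 0 = 0" by (simp add: walk_def)

lemma walk_later_steps: "walk (later_steps k \<omega>) j = walk \<omega> (k + j) - walk \<omega> k"
proof -
  have "walk \<omega> (k + j) = walk \<omega> k + (\<Sum>i=k..<k + j. \<omega> i)"
    unfolding walk_def by (metis add_diff_cancel_left' atLeast0LessThan le_add1 sum.atLeastLessThan_concat zero_le)
  also have "(\<Sum>i=k..<k + j. \<omega> i) = walk (later_steps k \<omega>) j"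
    using sum.shift_bounds_nat_ivl[of \<omega> 0 k j] by (simp add: walk_def later_steps_def atLeast0LessThan add.commute)
  finally show ?thesis by simp
qed

lemma strict_ladder_nonneg: "strict_ladder n \<omega> \<Longrightarrow> 0 \<le> walk \<omega> n"
  by (cases n) (auto simp: strict_ladder_def dest!: spec[of _ 0] intro: less_imp_le)

lemma walk_comb_seq: "j \<le> k \<Longrightarrow> walk (comb_seq k \<omega> \<omega>') j = walk \<omega> j"
  by (simp add: walk_def comb_seq_def)

lemma later_steps_comb_seq [simp]: "later_steps k (comb_seq k \<omega> \<omega>') = \<omega>'"
  by (simp add: later_steps_def comb_seq_def)

text \<open>
  The decomposition of the path at its first maximum: strictness before \<open>k\<close> and weakness after \<open>k\<close>
  single out exactly one index.
\<close>

lemma first_argmax_walk_eq_iff: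
  "first_argmax (walk \<omega>) n = k \<longleftrightarrow> k \<le> n \<and> strict_ladder k \<omega> \<and> stays_nonpos (n - k) (later_steps k \<omega>)"
proof -
  have "(\<forall>j\<le>n. walk \<omega> j \<le> walk \<omega> k) \<longleftrightarrow> (\<forall>j\<le>n - k. walk \<omega> (k + j) \<le> walk \<omega> k)"
    if "k \<le> n" "\<forall>j<k. walk \<omega> j < walk \<omega> k"
  proof (intro iffI allI impI)
    fix j assume *: "\<forall>j\<le>n - k. walk \<omega> (k + j) \<le> walk \<omega> k" "j \<le> n"
    show "walk \<omega> j \<le> walk \<omega> k"
    proof (cases "j < k")
      case True then show ?thesis using that by (auto intro: less_imp_le)
    next
      case False then show ?thesis using *(1)[rule_format, of "j - k"] *(2) by simp
    qed
  qed (use that in auto)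
  then show ?thesis
    unfolding first_argmax_eq_iff strict_ladder_def stays_nonpos_def walk_later_steps by auto
qed

locale random_walk =
  fixes D :: "real measure"
  assumes prob_D: "prob_space D" and sets_D [measurable_cong]: "sets D = sets borel"
begin

sublocale D: prob_space D by (rule prob_D)

sublocale sequence_space D ..

lemma coordinate_measurable [measurable]: "(\<lambda>\<omega>. \<omega> i) \<in> borel_measurable S"
  using measurable_component_singleton[of i UNIV "\<lambda>_. D"] measurable_cong_sets[OF refl sets_D] by auto

lemma walk_measurable [measurable]: "(\<lambda>\<omega>. walk \<omega> n) \<in> borel_measurable S"
  unfolding walk_def by measurable

lemma later_steps_measurable [measurable]: "later_steps k \<in> measurable S S"
  unfolding later_steps_def by (intro measurable_PiM_single') (auto simp: space_PiM)

lemma strict_ladder_measurable [measurable]: "Measurable.pred S (strict_ladder n)"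
  unfolding strict_ladder_def by measurable

lemma stays_nonpos_measurable [measurable]: "Measurable.pred S (stays_nonpos n)"
  unfolding stays_nonpos_def by measurable

text \<open>
  The first \<open>k\<close> steps are independent of the later ones: glueing two independent sequences at \<open>k\<close> does not
  change the law.
\<close>

lemma integral_split:
  fixes f g :: "(nat \<Rightarrow> real) \<Rightarrow> complex"
  assumes [measurable]: "f \<in> borel_measurable S" "g \<in> borel_measurable S"
    and f: "\<And>\<omega>. norm (f \<omega>) \<le> B" and g: "\<And>\<omega>. norm (g \<omega>) \<le> C"
    and past: "\<And>\<omega> \<omega>'. f (comb_seq k \<omega> \<omega>') = f \<omega>"
  shows "(\<integral>\<omega>. f \<omega> * g (later_steps k \<omega>) \<partial>S) = (\<integral>\<omega>. f \<omega> \<partial>S) * (\<integral>\<omega>. g \<omega> \<partial>S)"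
proof -
  interpret P: pair_prob_space S S ..
  have B: "0 \<le> B" using order_trans[OF norm_ge_zero f] .
  have "(\<integral>\<omega>. f \<omega> * g (later_steps k \<omega>) \<partial>S) =
      (\<integral>\<omega>. f \<omega> * g (later_steps k \<omega>) \<partial>distr (S \<Otimes>\<^sub>M S) S (\<lambda>(\<omega>, \<omega>'). comb_seq k \<omega> \<omega>'))"
    by (simp add: PiM_comb_seq)
  also have "\<dots> = (\<integral>x. f (fst x) * g (snd x) \<partial>(S \<Otimes>\<^sub>M S))"
    by (subst integral_distr) (auto simp: measurable_comb_seq split_beta' past intro!: Bochner_Integration.integral_cong)
  also have "\<dots> = (\<integral>\<omega>. (\<integral>\<omega>'. f \<omega> * g \<omega>' \<partial>S) \<partial>S)"
  proof (subst P.integral_fst'[symmetric])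
    show "integrable (S \<Otimes>\<^sub>M S) (\<lambda>x. f (fst x) * g (snd x))"
      by (rule P.integrable_const_bound[of _ "B * C"])
         (use f g B in \<open>auto simp: norm_mult intro!: mult_mono\<close>)
  qed simp
  also have "\<dots> = (\<integral>\<omega>. f \<omega> \<partial>S) * (\<integral>\<omega>. g \<omega> \<partial>S)"
    by simp
  finally show ?thesis .
qed

definition asc :: "nat \<Rightarrow> (real \<Rightarrow> complex) \<Rightarrow> complex" where
  "asc n f = (\<integral>\<omega>. of_bool (strict_ladder n \<omega>) * f (walk \<omega> n) \<partial>S)"

definition low :: "nat \<Rightarrow> (real \<Rightarrow> complex) \<Rightarrow> complex" where
  "low n f = (\<integral>\<omega>. of_bool (stays_nonpos n \<omega>) * f (walk \<omega> n) \<partial>S)"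

definition on_set :: "real set \<Rightarrow> nat \<Rightarrow> (real \<Rightarrow> complex) \<Rightarrow> complex" where
  "on_set A n f = (\<integral>\<omega>. of_bool (walk \<omega> n \<in> A) * f (walk \<omega> n) \<partial>S)"

lemma asc_0 [simp]: "asc 0 f = f 0" by (simp add: asc_def strict_ladder_def P.prob_space)

lemma low_0 [simp]: "low 0 f = f 0" by (simp add: low_def stays_nonpos_def P.prob_space)

text \<open>
  On the event that the first argmax is \<open>k\<close>, the first factor depends on the first \<open>k\<close> steps and the second one on
  the later steps, which form a walk of the same law.
\<close>

lemma argmax_factorization:
  fixes F G :: "nat \<Rightarrow> real \<Rightarrow> complex"
  assumes [measurable]: "\<And>k. F k \<in> borel_measurable borel" "\<And>k. G k \<in> borel_measurable borel"
    and F: "\<And>k x. norm (F k x) \<le> B" and G: "\<And>k x. norm (G k x) \<le> C"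
  shows "(\<integral>\<omega>. F (first_argmax (walk \<omega>) n) (walk \<omega> (first_argmax (walk \<omega>) n)) *
      G (n - first_argmax (walk \<omega>) n) (walk \<omega> n - walk \<omega> (first_argmax (walk \<omega>) n)) \<partial>S)
    = (\<Sum>k\<le>n. asc k (F k) * low (n - k) (G (n - k)))"
proof -
  define u where "u k \<omega> = of_bool (strict_ladder k \<omega>) * F k (walk \<omega> k)" for k \<omega>
  define w where "w k \<omega> = of_bool (stays_nonpos k \<omega>) * G k (walk \<omega> k)" for k \<omega>
  have [measurable]: "u k \<in> borel_measurable S" "w k \<in> borel_measurable S" for k
    unfolding u_def[abs_def] w_def[abs_def] by measurable
  have B: "0 \<le> B" using order_trans[OF norm_ge_zero F] .
  have C: "0 \<le> C" using order_trans[OF norm_ge_zero G] .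
  have ub: "norm (u k \<omega>) \<le> B" and wb: "norm (w k \<omega>) \<le> C" for k \<omega>
    using F G B C by (auto simp: u_def w_def)
  have "F (first_argmax (walk \<omega>) n) (walk \<omega> (first_argmax (walk \<omega>) n)) *
      G (n - first_argmax (walk \<omega>) n) (walk \<omega> n - walk \<omega> (first_argmax (walk \<omega>) n))
      = (\<Sum>k\<le>n. u k \<omega> * w (n - k) (later_steps k \<omega>))" (is "?l = _") for \<omega>
  proof -
    let ?k = "first_argmax (walk \<omega>) n"
    have k: "?k \<le> n" by (rule first_argmax_le)
    have "(\<Sum>k\<le>n. u k \<omega> * w (n - k) (later_steps k \<omega>)) = (\<Sum>k\<le>n. if k = ?k then ?l else 0)"
    proof (rule sum.cong[OF refl])
      fix k assume k: "k \<in> {..n}"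
      show "u k \<omega> * w (n - k) (later_steps k \<omega>) = (if k = ?k then ?l else 0)"
        using first_argmax_walk_eq_iff[of \<omega> n k] k by (auto simp: u_def w_def walk_later_steps)
    qed
    then show ?thesis using k by simp
  qed
  then have "(\<integral>\<omega>. F (first_argmax (walk \<omega>) n) (walk \<omega> (first_argmax (walk \<omega>) n)) *
      G (n - first_argmax (walk \<omega>) n) (walk \<omega> n - walk \<omega> (first_argmax (walk \<omega>) n)) \<partial>S)
      = (\<integral>\<omega>. (\<Sum>k\<le>n. u k \<omega> * w (n - k) (later_steps k \<omega>)) \<partial>S)" by simp
  also have "\<dots> = (\<Sum>k\<le>n. \<integral>\<omega>. u k \<omega> * w (n - k) (later_steps k \<omega>) \<partial>S)"
  proof (rule Bochner_Integration.integral_sum, rule P.integrable_const_bound[of _ "B * C"])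
    show "AE \<omega> in S. norm (u k \<omega> * w (n - k) (later_steps k \<omega>)) \<le> B * C" for k
      unfolding norm_mult by (intro always_eventually allI mult_mono ub wb B norm_ge_zero)
  qed measurable
  also have "\<dots> = (\<Sum>k\<le>n. (\<integral>\<omega>. u k \<omega> \<partial>S) * (\<integral>\<omega>. w (n - k) \<omega> \<partial>S))"
    by (intro sum.cong refl integral_split[OF _ _ ub wb])
       (auto simp: u_def strict_ladder_def walk_comb_seq)
  finally show ?thesis by (simp add: asc_def low_def u_def w_def)
qed

text \<open>
  Signed weights whose integrals against a multiplicative function of \<open>walk \<omega> n\<close> are the defects of the
  recursions \<open>n * a n = (\<Sum>k=1..n. c k * a (n - k))\<close> behind the identity of Spitzer.
\<close>

definition up_weight :: "nat \<Rightarrow> (nat \<Rightarrow> real) \<Rightarrow> real" where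
  "up_weight n \<omega> = real n * of_bool (strict_ladder n \<omega>) -
     (\<Sum>k=1..n. of_bool (walk \<omega> k > 0) * of_bool (strict_ladder (n - k) (later_steps k \<omega>)))"

definition down_weight :: "nat \<Rightarrow> (nat \<Rightarrow> real) \<Rightarrow> real" where
  "down_weight n \<omega> = real n * of_bool (stays_nonpos n \<omega>) -
     (\<Sum>k=1..n. of_bool (walk \<omega> k \<le> 0) * of_bool (stays_nonpos (n - k) (later_steps k \<omega>)))"

lemma weights_measurable [measurable]:
  "up_weight n \<in> borel_measurable S" "down_weight n \<in> borel_measurable S"
  unfolding up_weight_def[abs_def] down_weight_def[abs_def] by measurable

lemma weights_integrable: "integrable S (up_weight n)" "integrable S (down_weight n)"
proof -
  have "norm (up_weight n \<omega>) \<le> 2 * real n" "norm (down_weight n \<omega>) \<le> 2 * real n" for \<omega>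
  proof -
    have *: "\<bar>\<Sum>k=1..n. of_bool (P k) * of_bool (Q k)\<bar> \<le> real n" for P Q :: "nat \<Rightarrow> bool"
    proof -
      have "\<bar>\<Sum>k=1..n. of_bool (P k) * of_bool (Q k) :: real\<bar> \<le> (\<Sum>k=1..n. 1)"
        by (rule order_trans[OF sum_abs], rule sum_mono) auto
      then show ?thesis by simp
    qed
    have **: "\<bar>real n * of_bool R\<bar> \<le> real n" for R by auto
    show "norm (up_weight n \<omega>) \<le> 2 * real n" "norm (down_weight n \<omega>) \<le> 2 * real n"
      unfolding up_weight_def down_weight_def real_norm_def
      using *[of "\<lambda>k. walk \<omega> k > 0" "\<lambda>k. strict_ladder (n - k) (later_steps k \<omega>)"]
        *[of "\<lambda>k. walk \<omega> k \<le> 0" "\<lambda>k. stays_nonpos (n - k) (later_steps k \<omega>)"]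
        **[of "strict_ladder n \<omega>"] **[of "stays_nonpos n \<omega>"]
      by linarith+
  qed
  then show "integrable S (up_weight n)" "integrable S (down_weight n)"
    by (auto intro!: P.integrable_const_bound[of _ "2 * real n"])
qed

text \<open>
  Every term forces \<open>walk \<omega> n > 0\<close>.  The other weight lives where \<open>walk \<omega> n \<le> 0\<close>, so that the sum
  of the two determines each of them.
\<close>

lemma up_weight_support:
  assumes "\<not> 0 < walk \<omega> n" shows "up_weight n \<omega> = 0"
proof -
  have "real n * of_bool (strict_ladder n \<omega>) = 0"
    using assms by (cases n) (auto simp: strict_ladder_def)
  moreover have "\<not> (walk \<omega> k > 0 \<and> strict_ladder (n - k) (later_steps k \<omega>))" if "k \<in> {1..n}" for k
  proof
    assume *: "walk \<omega> k > 0 \<and> strict_ladder (n - k) (later_steps k \<omega>)"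
    then have "0 < n - k \<Longrightarrow> walk \<omega> k < walk \<omega> n"
      using that by (auto simp: strict_ladder_def walk_later_steps dest!: spec[of _ 0])
    with * assms that show False by (cases "k = n") auto
  qed
  then have "(\<Sum>k=1..n. of_bool (walk \<omega> k > 0) * of_bool (strict_ladder (n - k) (later_steps k \<omega>))) = (0::real)"
    by (intro sum.neutral) auto
  ultimately show ?thesis by (simp add: up_weight_def)
qed

lemma down_weight_support:
  assumes "0 < walk \<omega> n" shows "down_weight n \<omega> = 0"
proof -
  have "real n * of_bool (stays_nonpos n \<omega>) = 0"
    using assms by (auto simp: stays_nonpos_def not_le)
  moreover have "\<not> (walk \<omega> k \<le> 0 \<and> stays_nonpos (n - k) (later_steps k \<omega>))" if "k \<in> {1..n}" for k
    using assms that by (auto simp: stays_nonpos_def walk_later_steps dest!: spec[of _ "n - k"])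
  then have "(\<Sum>k=1..n. of_bool (walk \<omega> k \<le> 0) * of_bool (stays_nonpos (n - k) (later_steps k \<omega>))) = (0::real)"
    by (intro sum.neutral) auto
  ultimately show ?thesis by (simp add: down_weight_def)
qed

text \<open>
  Multiplicativity of \<open>e\<close> distributes \<open>e (walk \<omega> n)\<close> over the steps before and after \<open>k\<close>, which are
  independent.
\<close>

lemma weighted_integral:
  fixes e :: "real \<Rightarrow> complex" and Q R :: "nat \<Rightarrow> (nat \<Rightarrow> real) \<Rightarrow> bool"
  assumes [measurable]: "e \<in> borel_measurable borel"
      "\<And>n. Measurable.pred S (Q n)" "A \<in> sets borel"
    and mult: "\<And>x y. e (x + y) = e x * e y"
    and Qb: "\<And>n \<omega>. Q n \<omega> \<Longrightarrow> norm (e (walk \<omega> n)) \<le> 1" and Ab: "\<And>x. x \<in> A \<Longrightarrow> norm (e x) \<le> 1"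
  shows "(\<integral>\<omega>. of_real (real n * of_bool (Q n \<omega>) - (\<Sum>k=1..n. of_bool (walk \<omega> k \<in> A) * of_bool (Q (n - k) (later_steps k \<omega>))))
      * e (walk \<omega> n) \<partial>S) =
    of_nat n * (\<integral>\<omega>. of_bool (Q n \<omega>) * e (walk \<omega> n) \<partial>S) -
    (\<Sum>k=1..n. on_set A k e * (\<integral>\<omega>. of_bool (Q (n - k) \<omega>) * e (walk \<omega> (n - k)) \<partial>S))"
proof -
  define u where "u k \<omega> = of_bool (walk \<omega> k \<in> A) * e (walk \<omega> k)" for k \<omega>
  define w where "w k \<omega> = of_bool (Q k \<omega>) * e (walk \<omega> k)" for k \<omega>
  have [measurable]: "u k \<in> borel_measurable S" "w k \<in> borel_measurable S" for k
    unfolding u_def[abs_def] w_def[abs_def] by measurable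
  have ub: "norm (u k \<omega>) \<le> 1" and wb: "norm (w k \<omega>) \<le> 1" for k \<omega>
    using Qb Ab by (auto simp: u_def w_def)
  have iw: "integrable S (w n)" by (rule P.integrable_const_bound[of _ 1]) (use wb in auto)
  have iuw: "integrable S (\<lambda>\<omega>. u k \<omega> * w (n - k) (later_steps k \<omega>))" for k
    by (rule P.integrable_const_bound[of _ 1]) (use mult_mono[OF ub wb] in \<open>auto simp: norm_mult\<close>)
  have "of_real (real n * of_bool (Q n \<omega>) - (\<Sum>k=1..n. of_bool (walk \<omega> k \<in> A) * of_bool (Q (n - k) (later_steps k \<omega>))))
      * e (walk \<omega> n) = of_nat n * w n \<omega> - (\<Sum>k=1..n. u k \<omega> * w (n - k) (later_steps k \<omega>))" for \<omega>
  proof -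
    have "of_bool (walk \<omega> k \<in> A) * of_bool (Q (n - k) (later_steps k \<omega>)) * e (walk \<omega> n) =
        u k \<omega> * w (n - k) (later_steps k \<omega>)" if "k \<in> {1..n}" for k
      using mult[of "walk \<omega> k" "walk \<omega> n - walk \<omega> k"] that
      by (simp add: u_def w_def walk_later_steps)
    then have "(\<Sum>k=1..n. of_bool (walk \<omega> k \<in> A) * of_bool (Q (n - k) (later_steps k \<omega>)) * e (walk \<omega> n)) =
        (\<Sum>k=1..n. u k \<omega> * w (n - k) (later_steps k \<omega>))"
      by (rule sum.cong[OF refl])
    moreover have "complex_of_real (of_bool P) = of_bool P" for P by simp
    ultimately show ?thesis
      unfolding of_real_diff left_diff_distrib of_real_sum of_real_mult
        sum_distrib_right of_real_of_nat_eq by (simp only: w_def mult.assoc)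
  qed
  then have "(\<integral>\<omega>. of_real (real n * of_bool (Q n \<omega>) - (\<Sum>k=1..n. of_bool (walk \<omega> k \<in> A) * of_bool (Q (n - k) (later_steps k \<omega>))))
      * e (walk \<omega> n) \<partial>S) = (\<integral>\<omega>. of_nat n * w n \<omega> - (\<Sum>k=1..n. u k \<omega> * w (n - k) (later_steps k \<omega>)) \<partial>S)"
    by simp
  also have "\<dots> = of_nat n * (\<integral>\<omega>. w n \<omega> \<partial>S) - (\<Sum>k=1..n. \<integral>\<omega>. u k \<omega> * w (n - k) (later_steps k \<omega>) \<partial>S)"
    using iw iuw by (simp add: Bochner_Integration.integral_diff Bochner_Integration.integral_sum)
  also have "(\<Sum>k=1..n. \<integral>\<omega>. u k \<omega> * w (n - k) (later_steps k \<omega>) \<partial>S) =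
      (\<Sum>k=1..n. (\<integral>\<omega>. u k \<omega> \<partial>S) * (\<integral>\<omega>. w (n - k) \<omega> \<partial>S))"
    by (intro sum.cong refl integral_split[OF _ _ ub wb]) (auto simp: u_def walk_comb_seq)
  finally show ?thesis by (simp add: u_def w_def on_set_def)
qed

lemma up_weight_integral:
  assumes "e \<in> borel_measurable borel" "\<And>x y. e (x + y) = e x * e y" "\<And>x. 0 \<le> x \<Longrightarrow> norm (e x) \<le> 1"
  shows "(\<integral>\<omega>. of_real (up_weight n \<omega>) * e (walk \<omega> n) \<partial>S) =
    of_nat n * asc n e - (\<Sum>k=1..n. on_set {0<..} k e * asc (n - k) e)"
proof -
  have "0 \<le> walk \<omega> n" if "strict_ladder n \<omega>" for n \<omega>
    using that by (rule strict_ladder_nonneg)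
  then show ?thesis
    unfolding up_weight_def asc_def
    using weighted_integral[of e strict_ladder "{0<..}" n] assms by (auto simp: less_imp_le)
qed

lemma down_weight_integral:
  assumes "e \<in> borel_measurable borel" "\<And>x y. e (x + y) = e x * e y" "\<And>x. x \<le> 0 \<Longrightarrow> norm (e x) \<le> 1"
  shows "(\<integral>\<omega>. of_real (down_weight n \<omega>) * e (walk \<omega> n) \<partial>S) =
    of_nat n * low n e - (\<Sum>k=1..n. on_set {..0} k e * low (n - k) e)"
  unfolding down_weight_def low_def
  using weighted_integral[of e stays_nonpos "{..0}" n] assms by (auto simp: stays_nonpos_def)

lemma char_walk: "(\<integral>\<omega>. iexp (v * walk \<omega> n) \<partial>S) = (\<integral>\<omega>. iexp (v * walk \<omega> 1) \<partial>S) ^ n"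
proof (induction n)
  case 0 show ?case by (simp add: P.prob_space)
next
  case (Suc n)
  have "(\<integral>\<omega>. iexp (v * walk \<omega> (Suc n)) \<partial>S) =
      (\<integral>\<omega>. iexp (v * walk \<omega> n) * iexp (v * walk (later_steps n \<omega>) 1) \<partial>S)"
    by (simp add: walk_later_steps exp_add[symmetric] algebra_simps)
  also have "\<dots> = (\<integral>\<omega>. iexp (v * walk \<omega> n) \<partial>S) * (\<integral>\<omega>. iexp (v * walk \<omega> 1) \<partial>S)"
    by (rule integral_split[of _ _ 1 1]) (auto simp: walk_comb_seq)
  finally show ?case unfolding Suc.IH power_Suc2 .
qed

text \<open>
  The uniqueness part of the Wiener-Hopf factorisation, by strong induction on \<open>n\<close>.  For every
  frequency the recursions of lower order hold, hence \<open>wiener_hopf_coefficients\<close> shows that the Fourier transform of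
  the sum of both weighted laws of \<open>walk \<omega> n\<close> vanishes.  So the sum vanishes, and its restrictions to the
  two half-lines are the two summands.
\<close>

lemma weights_annihilate:
  fixes f :: "real \<Rightarrow> complex"
  assumes "f \<in> borel_measurable borel" "\<And>x. norm (f x) \<le> C"
  shows "(\<integral>\<omega>. of_real (up_weight n \<omega>) * f (walk \<omega> n) \<partial>S) = 0 \<and>
    (\<integral>\<omega>. of_real (down_weight n \<omega>) * f (walk \<omega> n) \<partial>S) = 0"
  using assms
proof (induction n arbitrary: f C rule: less_induct)
  case (less n)
  have sum0: "(\<integral>\<omega>. of_real (up_weight n \<omega> + down_weight n \<omega>) * iexp (v * walk \<omega> n) \<partial>S) = 0" for v
  proof -
    define e :: "real \<Rightarrow> complex" where "e x = iexp (v * x)" for x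
    have e[measurable]: "e \<in> borel_measurable borel" unfolding e_def by measurable
    have mult: "e (x + y) = e x * e y" for x y by (simp add: e_def exp_add[symmetric] algebra_simps)
    have eb: "norm (e x) \<le> 1" for x by (simp add: e_def)
    have e0: "e 0 = 1" by (simp add: e_def)
    define z where "z = (\<integral>\<omega>. iexp (v * walk \<omega> 1) \<partial>S)"
    have ie: "integrable S (\<lambda>\<omega>. of_bool (P \<omega>) * e (walk \<omega> k))" if [measurable]: "Measurable.pred S P" for P k
      by (rule P.integrable_const_bound[of _ 1]) (use eb in auto)
    have up: "(\<integral>\<omega>. of_real (up_weight n \<omega>) * e (walk \<omega> n) \<partial>S) =
        of_nat n * asc n e - (\<Sum>k=1..n. on_set {0<..} k e * asc (n - k) e)" for n
      by (rule up_weight_integral[OF e mult eb])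
    have down: "(\<integral>\<omega>. of_real (down_weight n \<omega>) * e (walk \<omega> n) \<partial>S) =
        of_nat n * low n e - (\<Sum>k=1..n. on_set {..0} k e * low (n - k) e)" for n
      by (rule down_weight_integral[OF e mult eb])
    have "(of_nat n * asc n e - (\<Sum>k=1..n. on_set {0<..} k e * asc (n - k) e)) +
        (of_nat n * low n e - (\<Sum>k=1..n. on_set {..0} k e * low (n - k) e)) = 0"
    proof (rule wiener_hopf_coefficients[where z = z])
      fix m
      have "(\<Sum>k\<le>m. asc k e * low (m - k) e) = (\<integral>\<omega>. e (walk \<omega> m) \<partial>S)"
        using argmax_factorization[of "\<lambda>_. e" "\<lambda>_. e" 1 1 m, OF e e eb eb]
        unfolding mult[symmetric] by simp
      then show "(\<Sum>k\<le>m. asc k e * low (m - k) e) = z ^ m"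
        unfolding e_def char_walk[of v m] z_def .
      have "on_set {0<..} m e + on_set {..0} m e =
          (\<integral>\<omega>. of_bool (walk \<omega> m \<in> {0<..}) * e (walk \<omega> m) + of_bool (walk \<omega> m \<in> {..0}) * e (walk \<omega> m) \<partial>S)"
        unfolding on_set_def by (intro Bochner_Integration.integral_add[symmetric] ie) auto
      also have "\<dots> = (\<integral>\<omega>. e (walk \<omega> m) \<partial>S)"
        by (rule Bochner_Integration.integral_cong) auto
      finally show "on_set {0<..} m e + on_set {..0} m e = z ^ m"
        unfolding e_def char_walk[of v m] z_def .
    next
      fix j assume j: "j < n"
      from less.IH[OF j e eb] show "of_nat j * asc j e = (\<Sum>k=1..j. on_set {0<..} k e * asc (j - k) e)"
        "of_nat j * low j e = (\<Sum>k=1..j. on_set {..0} k e * low (j - k) e)"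
        unfolding up down by auto
    qed (simp_all add: e0)
    then have "(\<integral>\<omega>. of_real (up_weight n \<omega>) * e (walk \<omega> n) \<partial>S) + (\<integral>\<omega>. of_real (down_weight n \<omega>) * e (walk \<omega> n) \<partial>S) = 0"
      unfolding up down .
    moreover have "integrable S (\<lambda>\<omega>. of_real (r \<omega>) * e (walk \<omega> n))" if r: "integrable S r" for r
    proof (rule Bochner_Integration.integrable_bound[OF r])
      have [measurable]: "r \<in> borel_measurable S" using r by simp
      show "(\<lambda>\<omega>. of_real (r \<omega>) * e (walk \<omega> n)) \<in> borel_measurable S" by measurable
    qed (simp add: norm_mult e_def)
    ultimately show ?thesis
      using weights_integrable[of n] by (simp add: e_def distrib_right Bochner_Integration.integral_add)
  qed
  have W: "integrable S (\<lambda>\<omega>. up_weight n \<omega> + down_weight n \<omega>)" using weights_integrable[of n] by simp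
  note f[measurable] = less.prems(1)
  have C: "0 \<le> C" using order_trans[OF norm_ge_zero less.prems(2)] .
  have "(\<integral>\<omega>. of_real (up_weight n \<omega> + down_weight n \<omega>) * (if 0 < walk \<omega> n then f (walk \<omega> n) else 0) \<partial>S) = 0"
    by (rule zero_of_fourier_zero[OF P.prob_space_axioms _ W sum0, where f = "\<lambda>x. if 0 < x then f x else 0" and B = C])
       (use less.prems(2) C in auto)
  moreover have "of_real (up_weight n \<omega> + down_weight n \<omega>) * (if 0 < walk \<omega> n then f (walk \<omega> n) else 0)
      = of_real (up_weight n \<omega>) * f (walk \<omega> n)" for \<omega>
    using up_weight_support[of \<omega> n] down_weight_support[of \<omega> n] by auto
  moreover have "(\<integral>\<omega>. of_real (up_weight n \<omega> + down_weight n \<omega>) * (if 0 < walk \<omega> n then 0 else f (walk \<omega> n)) \<partial>S) = 0"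
    by (rule zero_of_fourier_zero[OF P.prob_space_axioms _ W sum0, where f = "\<lambda>x. if 0 < x then 0 else f x" and B = C])
       (use less.prems(2) C in auto)
  moreover have "of_real (up_weight n \<omega> + down_weight n \<omega>) * (if 0 < walk \<omega> n then 0 else f (walk \<omega> n))
      = of_real (down_weight n \<omega>) * f (walk \<omega> n)" for \<omega>
    using up_weight_support[of \<omega> n] down_weight_support[of \<omega> n] by auto
  ultimately show ?case by simp
qed

lemma norm_asc_low_part_le:
  assumes [measurable]: "e \<in> borel_measurable borel"
  shows norm_asc_le: "(\<And>x. 0 \<le> x \<Longrightarrow> norm (e x) \<le> 1) \<Longrightarrow> norm (asc n e) \<le> 1"
    and norm_low_le: "(\<And>x. x \<le> 0 \<Longrightarrow> norm (e x) \<le> 1) \<Longrightarrow> norm (low n e) \<le> 1"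
    and norm_on_set_le: "A \<in> sets borel \<Longrightarrow> (\<And>x. x \<in> A \<Longrightarrow> norm (e x) \<le> 1) \<Longrightarrow> norm (on_set A n e) \<le> 1"
proof -
  have *: "norm (\<integral>\<omega>. g \<omega> \<partial>S) \<le> 1" if "\<And>\<omega>. norm (g \<omega>) \<le> 1" for g :: "_ \<Rightarrow> complex"
  proof (cases "integrable S g")
    case True
    have "norm (\<integral>\<omega>. g \<omega> \<partial>S) \<le> (\<integral>\<omega>. norm (g \<omega>) \<partial>S)" by (rule integral_norm_bound)
    also have "\<dots> \<le> (\<integral>\<omega>. 1 \<partial>S)" using True that by (intro integral_mono) auto
    finally show ?thesis by (simp add: P.prob_space)
  qed (simp add: not_integrable_integral_eq)
  show "norm (asc n e) \<le> 1" if "\<And>x. 0 \<le> x \<Longrightarrow> norm (e x) \<le> 1"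
  proof -
    have "0 \<le> walk \<omega> n" if "strict_ladder n \<omega>" for \<omega>
      using that by (rule strict_ladder_nonneg)
    then show ?thesis unfolding asc_def using that by (intro *) auto
  qed
  show "norm (low n e) \<le> 1" if "\<And>x. x \<le> 0 \<Longrightarrow> norm (e x) \<le> 1"
    unfolding low_def using that by (intro *) (auto simp: stays_nonpos_def)
  show "norm (on_set A n e) \<le> 1" if "\<And>x. x \<in> A \<Longrightarrow> norm (e x) \<le> 1"
    unfolding on_set_def using that by (intro *) auto
qed

text \<open>
  Since \<open>up_weight\<close> annihilates functions of the walk, the sequence \<open>asc n e\<close> obeys the recursion of the
  coefficients of an exponential.
\<close>

lemma spitzer_asc:
  assumes e[measurable]: "e \<in> borel_measurable borel" and mult: "\<And>x y. e (x + y) = e x * e y" and e0: "e 0 = 1"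
    and eb: "\<And>x. 0 \<le> x \<Longrightarrow> norm (e x) \<le> 1" and s: "norm s < 1"
  shows "(\<lambda>n. asc n e * s ^ n) sums exp (\<Sum>k. on_set {0<..} (Suc k) e * s ^ Suc k / of_nat (Suc k))"
proof (rule exp_power_series_of_recursion[OF _ _ _ _ s])
  show "of_nat n * asc n e = (\<Sum>k=1..n. on_set {0<..} k e * asc (n - k) e)" for n
  proof -
    have "(\<integral>\<omega>. of_real (up_weight n \<omega>) * e (walk \<omega> n) \<partial>S) =
        (\<integral>\<omega>. of_real (up_weight n \<omega>) * (if 0 < walk \<omega> n then e (walk \<omega> n) else 0) \<partial>S)"
      by (rule Bochner_Integration.integral_cong) (use up_weight_support in auto)
    also have "\<dots> = 0"
      using weights_annihilate[of "\<lambda>x. if 0 < x then e x else 0" 1 n] eb by (auto simp: less_imp_le)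
    finally show ?thesis using up_weight_integral[OF e mult eb, of n] by simp
  qed
qed (use e0 eb in \<open>auto intro!: norm_asc_le norm_on_set_le\<close>)

lemma spitzer_low:
  assumes e[measurable]: "e \<in> borel_measurable borel" and mult: "\<And>x y. e (x + y) = e x * e y" and e0: "e 0 = 1"
    and eb: "\<And>x. x \<le> 0 \<Longrightarrow> norm (e x) \<le> 1" and s: "norm s < 1"
  shows "(\<lambda>n. low n e * s ^ n) sums exp (\<Sum>k. on_set {..0} (Suc k) e * s ^ Suc k / of_nat (Suc k))"
proof (rule exp_power_series_of_recursion[OF _ _ _ _ s])
  show "of_nat n * low n e = (\<Sum>k=1..n. on_set {..0} k e * low (n - k) e)" for n
  proof -
    have "(\<integral>\<omega>. of_real (down_weight n \<omega>) * e (walk \<omega> n) \<partial>S) =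
        (\<integral>\<omega>. of_real (down_weight n \<omega>) * (if 0 < walk \<omega> n then 0 else e (walk \<omega> n)) \<partial>S)"
      by (rule Bochner_Integration.integral_cong) (use down_weight_support in auto)
    also have "\<dots> = 0"
      using weights_annihilate[of "\<lambda>x. if 0 < x then 0 else e x" 1 n] eb by auto
    finally show ?thesis using down_weight_integral[OF e mult eb, of n] by simp
  qed
qed (use e0 eb in \<open>auto intro!: norm_low_le norm_on_set_le\<close>)

end

section \<open>Levy processes at small times\<close>

lemma norm_integral_le:
  fixes f :: "'a \<Rightarrow> 'b::{banach, second_countable_topology}"
  assumes g: "integrable M g" and le: "\<And>x. x \<in> space M \<Longrightarrow> norm (f x) \<le> g x"
  shows "norm (\<integral>x. f x \<partial>M) \<le> (\<integral>x. g x \<partial>M)"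
proof (cases "integrable M f")
  case True
  have "norm (\<integral>x. f x \<partial>M) \<le> (\<integral>x. norm (f x) \<partial>M)" by (rule integral_norm_bound)
  also have "\<dots> \<le> (\<integral>x. g x \<partial>M)" using True g le by (intro integral_mono) auto
  finally show ?thesis .
next
  case False
  have "0 \<le> (\<integral>x. g x \<partial>M)"
    by (rule Bochner_Integration.integral_nonneg) (use le in \<open>auto intro: order_trans[OF norm_ge_zero]\<close>)
  with False show ?thesis by (simp add: not_integrable_integral_eq)
qed

lemma norm_one_minus_exp_le:
  fixes w :: complex
  assumes "Re w \<le> 0"
  shows "norm (1 - exp w) \<le> min 2 (norm w)"
proof (rule min.boundedI)
  show "norm (1 - exp w) \<le> 2"
  proof -
    have "exp (Re w) \<le> 1" using assms by simp
    then show ?thesis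
      using norm_triangle_ineq4[of 1 "exp w"] unfolding norm_exp_eq_Re norm_one by linarith
  qed
  have "norm (exp w - exp 0) \<le> 1 * norm (w - 0)"
    by (rule field_differentiable_bound[where S = "{z. Re z \<le> 0}" and f' = exp])
       (use assms in \<open>auto intro!: convex_halfspace_Re_le derivative_eq_intros\<close>)
  then show "norm (1 - exp w) \<le> norm w" by (simp add: norm_minus_commute)
qed

text \<open>
  The numerator is split into the change of the rate in time, of size \<open>t\<close>, and the effect of the position,
  of size \<open>min 1 \<bar>x\<bar>\<close> up to a factor.  Both compensate the singularity \<open>1 / t\<close> once expectations are taken.
\<close>

lemma phi_integrand_bound:
  assumes t: "0 < t" and b: "Re b \<le> 0" and c: "c \<le> 1" "c \<le> - Re a"
  shows "norm (phi_integrand a b t x) \<le> exp (- (c * t)) * (norm (1 + a) * t + min 2 (norm b * \<bar>x\<bar>)) / t"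
proof -
  have 1: "norm (exp (- of_real t) - exp (a * of_real t)) \<le> exp (- (c * t)) * (norm (1 + a) * t)"
  proof (cases "Re (1 + a) \<le> 0")
    case True
    have "exp (- of_real t) - exp (a * of_real t) = exp (- of_real t) * (1 - exp ((1 + a) * of_real t))"
      by (simp add: right_diff_distrib exp_add[symmetric] algebra_simps)
    moreover have "norm (1 - exp ((1 + a) * of_real t)) \<le> norm (1 + a) * t"
      using norm_one_minus_exp_le[of "(1 + a) * of_real t"] True t
      by (simp add: norm_mult mult_nonpos_nonneg)
    moreover have "norm (exp (- complex_of_real t)) \<le> exp (- (c * t))"
      using c t by (simp add: mult_le_cancel_right1)
    ultimately show ?thesis by (simp add: norm_mult mult_mono)
  next
    case False
    have "exp (- of_real t) - exp (a * of_real t) = - (exp (a * of_real t) * (1 - exp (- (1 + a) * of_real t)))"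
      by (simp add: right_diff_distrib exp_add[symmetric] algebra_simps)
    moreover have "norm (1 - exp (- (1 + a) * of_real t)) \<le> norm (1 + a) * t"
      using norm_one_minus_exp_le[of "- (1 + a) * of_real t"] False t
      by (simp add: norm_mult mult_nonpos_nonneg norm_minus_commute[of "-1"] norm_minus_cancel[of "1 + a", symmetric] del: norm_minus_cancel)
    moreover have "norm (exp (a * complex_of_real t)) \<le> exp (- (c * t))"
      using mult_right_mono[OF c(2), of t] t by simp
    ultimately show ?thesis by (simp add: norm_mult mult_mono)
  qed
  have "norm (1 - exp (b * of_real \<bar>x\<bar>)) \<le> min 2 (norm b * \<bar>x\<bar>)"
    using norm_one_minus_exp_le[of "b * of_real \<bar>x\<bar>"] b by (simp add: norm_mult mult_nonpos_nonneg)
  moreover have "norm (exp (a * complex_of_real t)) \<le> exp (- (c * t))"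
    using mult_right_mono[OF c(2), of t] t by simp
  ultimately have 2: "norm (exp (a * of_real t) * (1 - exp (b * of_real \<bar>x\<bar>))) \<le> exp (- (c * t)) * min 2 (norm b * \<bar>x\<bar>)"
    by (simp add: norm_mult mult_mono)
  have "phi_integrand a b t x = ((exp (- of_real t) - exp (a * of_real t)) + exp (a * of_real t) * (1 - exp (b * of_real \<bar>x\<bar>))) / of_real t"
    by (simp add: phi_integrand_def right_diff_distrib exp_add)
  also have "norm \<dots> \<le> (exp (- (c * t)) * (norm (1 + a) * t) + exp (- (c * t)) * min 2 (norm b * \<bar>x\<bar>)) / t"
    unfolding norm_divide using t by (intro divide_mono order_trans[OF norm_triangle_ineq] add_mono 1 2) auto
  finally show ?thesis by (simp add: distrib_left)
qed

lemma phi_integrand_bound_const: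
  assumes "0 < t" "Re a \<le> 0" "Re b \<le> 0"
  shows "norm (phi_integrand a b t x) \<le> 2 / t"
proof -
  have "norm (exp (a * of_real t + b * of_real \<bar>x\<bar>)) \<le> 1"
    using assms by (simp add: mult_nonpos_nonneg add_nonpos_nonpos)
  moreover have "norm (exp (- complex_of_real t)) \<le> 1" using assms by simp
  ultimately have "norm (exp (- complex_of_real t) - exp (a * of_real t + b * of_real \<bar>x\<bar>)) \<le> 2"
    using norm_triangle_ineq4[of "exp (- complex_of_real t)" "exp (a * of_real t + b * of_real \<bar>x\<bar>)"] by linarith
  then show ?thesis using assms by (simp add: phi_integrand_def norm_divide divide_right_mono)
qed

lemma phi_integrand_measurable [measurable (raw)]:
  assumes [measurable]: "f \<in> borel_measurable N" "g \<in> borel_measurable N"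
  shows "(\<lambda>x. phi_integrand a b (f x) (g x)) \<in> borel_measurable N"
  unfolding phi_integrand_def by measurable

text \<open>
  On \<open>{0<..2}\<close> the Taylor polynomial of order five gives the constant: \<open>1/6 - 4/120 = 2/15\<close>.  Beyond \<open>2\<close> the
  left-hand side is smaller than \<open>1/2\<close>.
\<close>

lemma one_minus_sinc_lower_bound:
  fixes y :: real
  assumes "y \<noteq> 0"
  shows "2 / 15 * min 1 (y\<^sup>2) \<le> 1 - sin y / y"
proof -
  have pos: "2 / 15 * min 1 (y\<^sup>2) \<le> 1 - sin y / y" if y: "0 < y" for y :: real
  proof (cases "y \<le> 2")
    case True
    have "\<bar>sin y - (\<Sum>m<5. sin_coeff m * y ^ m)\<bar> \<le> inverse (fact 5) * \<bar>y\<bar> ^ 5"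
      by (rule Maclaurin_sin_bound)
    moreover have "(\<Sum>m<5. sin_coeff m * y ^ m) = y - y ^ 3 / 6"
    proof -
      have "sin_coeff 0 = 0" "sin_coeff 1 = 1" "sin_coeff 2 = 0" "sin_coeff 3 = - 1 / 6" "sin_coeff 4 = 0"
        by (simp_all add: sin_coeff_def fact_numeral)
      moreover have "{..<5} = {0, 1, 2, 3, 4 :: nat}" by auto
      ultimately show ?thesis by simp
    qed
    ultimately have "\<bar>sin y - (y - y ^ 3 / 6)\<bar> \<le> y ^ 5 / 120"
      using y by (simp add: fact_numeral)
    then have "sin y \<le> y - y ^ 3 / 6 + y ^ 5 / 120" by linarith
    then have "sin y / y \<le> (y - y ^ 3 / 6 + y ^ 5 / 120) / y" using y by (intro divide_right_mono) auto
    also have "\<dots> = 1 - y\<^sup>2 / 6 + y ^ 4 / 120"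
      using y by (simp add: field_simps eval_nat_numeral)
    also have "y ^ 4 \<le> 4 * y\<^sup>2"
    proof -
      have "y\<^sup>2 \<le> 2\<^sup>2" using True y by (intro power_mono) auto
      then have "y\<^sup>2 * y\<^sup>2 \<le> 4 * y\<^sup>2" by (intro mult_right_mono) auto
      then show ?thesis by (simp add: eval_nat_numeral)
    qed
    finally show ?thesis by linarith
  next
    case False
    then have "sin y * 2 \<le> y" using sin_le_one[of y] by linarith
    then have "sin y / y \<le> 1 / 2" using y by (simp add: field_simps)
    then show ?thesis by linarith
  qed
  show ?thesis using pos[of y] pos[of "- y"] assms by (cases "0 < y") auto
qed

locale levy =
  fixes M :: "'w measure" and X :: "real \<Rightarrow> 'w \<Rightarrow> real"
  assumes levy: "levy_process M X"
begin

sublocale prob_space M using levy by (simp add: levy_process_def)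

lemma X_measurable: "0 \<le> t \<Longrightarrow> X t \<in> borel_measurable M"
  using levy by (simp add: levy_process_def)

lemma X_max_measurable [measurable]: "X (max 0 t) \<in> borel_measurable M"
  by (rule X_measurable) simp

lemma X_grid_measurable [measurable]: "X (grid n k) \<in> borel_measurable M"
  by (rule X_measurable) simp

lemma X_0 [simp]: "\<omega> \<in> space M \<Longrightarrow> X 0 \<omega> = 0"
  using levy by (simp add: levy_process_def)

lemma path_cadlag: "\<omega> \<in> space M \<Longrightarrow> cadlag (\<lambda>t. X t \<omega>)"
  using levy by (simp add: levy_process_def)

lemma stationary:
  assumes "0 \<le> s" "0 \<le> t"
  shows "distr M borel (\<lambda>\<omega>. X (s + t) \<omega> - X s \<omega>) = distr M borel (X t)"
proof -
  have "distr M borel (\<lambda>\<omega>. X (s + t) \<omega> - X s \<omega>) = distr M borel (\<lambda>\<omega>. X t \<omega> - X 0 \<omega>)"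
    using levy assms by (simp add: levy_process_def)
  also have "\<dots> = distr M borel (X t)" by (rule distr_cong) auto
  finally show ?thesis .
qed

lemma indep_increments:
  assumes "0 \<le> t 0" "\<And>i. i < n \<Longrightarrow> t i \<le> t (Suc i)"
  shows "indep_vars (\<lambda>_. borel) (\<lambda>i \<omega>. X (t (Suc i)) \<omega> - X (t i) \<omega>) {..<n}"
  using levy assms unfolding levy_process_def by blast

text \<open>
  Right-continuous paths are limits of their values on grids.  Times are cut off at \<open>0\<close>, because a process is
  constrained only for nonnegative times.
\<close>

lemma X_joint_measurable: "(\<lambda>p. X (max 0 (fst p)) (snd p)) \<in> borel_measurable (borel \<Otimes>\<^sub>M M)"
proof (rule borel_measurable_LIMSEQ_metric)
  fix n
  show "(\<lambda>p. X (grid n (grid_index n (max 0 (fst p)))) (snd p)) \<in> borel_measurable (borel \<Otimes>\<^sub>M M)"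
    unfolding grid_index_def
    by (rule measurable_compose_countable[where f = "\<lambda>k p. X (grid n k) (snd p)"]) measurable
next
  fix p assume "p \<in> space ((borel :: real measure) \<Otimes>\<^sub>M M)"
  then have p: "snd p \<in> space M" by (auto simp: space_pair_measure)
  have t: "0 \<le> max 0 (fst p)" by simp
  show "(\<lambda>n. X (grid n (grid_index n (max 0 (fst p)))) (snd p)) \<longlonglongrightarrow> X (max 0 (fst p)) (snd p)"
    by (rule cadlag_tendsto_right[OF path_cadlag[OF p] t _ grid_index_tendsto[OF t]])
       (use grid_index_bounds(1)[OF t] in \<open>auto intro: less_imp_le\<close>)
qed

lemma X_joint_measurable' [measurable (raw)]:
  assumes "f \<in> borel_measurable N" "g \<in> measurable N M"
  shows "(\<lambda>x. X (max 0 (f x)) (g x)) \<in> borel_measurable N"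
  using measurable_compose[OF measurable_Pair[OF assms] X_joint_measurable] by simp

definition charf :: "real \<Rightarrow> real \<Rightarrow> complex" where
  "charf t v = (\<integral>\<omega>. iexp (v * X (max 0 t) \<omega>) \<partial>M)"

lemma integrable_iexp: "Y \<in> borel_measurable M \<Longrightarrow> integrable M (\<lambda>\<omega>. iexp (v * Y \<omega>))"
  by (rule integrable_const_bound[of _ 1]) auto

lemma norm_charf_le: "norm (charf t v) \<le> 1"
proof -
  have "norm (charf t v) \<le> (\<integral>\<omega>. norm (iexp (v * X (max 0 t) \<omega>)) \<partial>M)"
    unfolding charf_def by (rule integral_norm_bound)
  then show ?thesis by (simp add: prob_space)
qed

lemma charf_measurable [measurable]: "(\<lambda>t. charf t v) \<in> borel_measurable borel"
  unfolding charf_def by measurable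

lemma charf_increment:
  assumes "0 \<le> s" "0 \<le> t"
  shows "(\<integral>\<omega>. iexp (v * (X (s + t) \<omega> - X s \<omega>)) \<partial>M) = charf t v"
proof -
  have [measurable]: "X (s + t) \<in> borel_measurable M" "X s \<in> borel_measurable M" "X t \<in> borel_measurable M"
    using assms by (auto intro: X_measurable)
  have "(\<integral>\<omega>. iexp (v * (X (s + t) \<omega> - X s \<omega>)) \<partial>M) =
      (\<integral>x. iexp (v * x) \<partial>distr M borel (\<lambda>\<omega>. X (s + t) \<omega> - X s \<omega>))"
    by (subst integral_distr) auto
  also have "\<dots> = charf t v"
    unfolding stationary[OF assms] charf_def by (subst integral_distr) (use assms in \<open>auto simp: max_def\<close>)
  finally show ?thesis .
qed

lemma charf_add:
  assumes st: "0 \<le> s" "0 \<le> t"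
  shows "charf (s + t) v = charf s v * charf t v"
proof -
  define u :: "nat \<Rightarrow> real" where "u i = (if i = 0 then 0 else if i = 1 then s else s + t)" for i
  have "indep_vars (\<lambda>_. borel) (\<lambda>i \<omega>. X (u (Suc i)) \<omega> - X (u i) \<omega>) {..<2}"
    by (rule indep_increments) (use st in \<open>auto simp: u_def\<close>)
  then have ind: "indep_vars (\<lambda>_. borel) (\<lambda>i \<omega>. iexp (v * (X (u (Suc i)) \<omega> - X (u i) \<omega>))) {..<2}"
    by (rule indep_vars_compose2) measurable
  have [measurable]: "X (u i) \<in> borel_measurable M" for i using st by (intro X_measurable) (auto simp: u_def)
  have "(\<integral>\<omega>. (\<Prod>i<2. iexp (v * (X (u (Suc i)) \<omega> - X (u i) \<omega>))) \<partial>M) =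
      (\<Prod>i<2. \<integral>\<omega>. iexp (v * (X (u (Suc i)) \<omega> - X (u i) \<omega>)) \<partial>M)"
    by (rule indep_vars_lebesgue_integral[OF _ ind]) (simp, rule integrable_iexp, measurable)
  also have "\<dots> = charf s v * charf t v"
    using charf_increment[of 0 s v] charf_increment[of s t v] st
    by (simp add: numeral_2_eq_2 u_def)
  also have "(\<integral>\<omega>. (\<Prod>i<2. iexp (v * (X (u (Suc i)) \<omega> - X (u i) \<omega>))) \<partial>M) = charf (s + t) v"
    unfolding charf_def using st
    by (intro Bochner_Integration.integral_cong)
       (simp_all add: numeral_2_eq_2 u_def exp_add[symmetric] algebra_simps)
  finally show ?thesis .
qed

lemma charf_0 [simp]: "charf 0 v = 1"
proof -
  have "charf 0 v = (\<integral>\<omega>. 1 \<partial>M)" unfolding charf_def by (intro Bochner_Integration.integral_cong) auto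
  then show ?thesis by (simp add: prob_space)
qed

lemma charf_tendsto:
  assumes "u \<longlonglongrightarrow> v" shows "(\<lambda>n. charf t (u n)) \<longlonglongrightarrow> charf t v"
  unfolding charf_def
  by (rule integral_dominated_convergence[where w = "\<lambda>_. 1"]) (auto intro!: tendsto_intros assms)

text \<open>
  Let \<open>H v\<close> be the average of \<open>charf t v\<close> over \<open>t \<in> {0..1}\<close>.  By multiplicativity \<open>charf h v * H v\<close> is the average over the
  shifted interval, so that \<open>(1 - charf h v) * H v\<close> consists of two boundary terms of size \<open>h\<close>.  Moreover
  \<open>H v\<close> is near \<open>1\<close> for small \<open>v\<close> by dominated convergence.
\<close>

lemma charf_near_1:
  obtains \<delta> where "0 < \<delta>" "\<delta> \<le> 1" "\<And>v h. \<bar>v\<bar> \<le> \<delta> \<Longrightarrow> 0 \<le> h \<Longrightarrow> norm (1 - charf h v) \<le> 4 * h"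
proof -
  define H where "H v = (\<integral>t. indicator {0..1} t *\<^sub>R charf t v \<partial>lborel)" for v
  have ii: "integrable lborel (indicat_real {a..b})" for a b :: real
    by (rule integrable_real_indicator) (auto simp: emeasure_lborel_Icc_eq)
  have int: "integrable lborel (\<lambda>t. indicator {a..b} t *\<^sub>R charf t v)" for a b v
    by (rule Bochner_Integration.integrable_bound[OF ii[of a b]])
       (use norm_charf_le in \<open>auto simp: indicator_def\<close>)
  have step: "norm (1 - charf h v) * norm (H v) \<le> 2 * h" if h: "0 \<le> h" for h v
  proof -
    have "charf h v * H v = (\<integral>t. indicator {0..1} t *\<^sub>R charf (h + 1 * t) v \<partial>lborel)"
      unfolding H_def integral_mult_right_zero[symmetric]
      by (rule Bochner_Integration.integral_cong) (use h in \<open>auto simp: charf_add indicator_def\<close>)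
    also have "\<dots> = (\<integral>t. indicator {h..1 + h} (h + 1 * t) *\<^sub>R charf (h + 1 * t) v \<partial>lborel)"
      by (rule Bochner_Integration.integral_cong) (auto simp: indicator_def)
    also have "\<dots> = (\<integral>t. indicator {h..1 + h} t *\<^sub>R charf t v \<partial>lborel)"
      using lborel_integral_real_affine[of 1 "\<lambda>t. indicator {h..1 + h} t *\<^sub>R charf t v" h] by simp
    finally have "(1 - charf h v) * H v = (\<integral>t. indicator {0..1} t *\<^sub>R charf t v - indicator {h..1 + h} t *\<^sub>R charf t v \<partial>lborel)"
      unfolding left_diff_distrib using int by (simp add: H_def Bochner_Integration.integral_diff)
    also have "norm \<dots> \<le> (\<integral>t. indicator {0..h} t + indicator {1..1 + h} t \<partial>lborel)"
    proof (rule norm_integral_le)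
      fix t :: real
      have "norm (charf t v) \<le> 1" by (rule norm_charf_le)
      then show "norm (indicator {0..1} t *\<^sub>R charf t v - indicator {h..1 + h} t *\<^sub>R charf t v)
          \<le> indicator {0..h} t + indicator {1..1 + h} t"
        using h by (auto simp: indicator_def)
    qed (use ii in auto)
    also have "\<dots> = 2 * h" using h by simp
    finally show ?thesis by (simp add: norm_mult)
  qed
  have "\<exists>\<delta>>0. \<forall>v. \<bar>v\<bar> \<le> \<delta> \<longrightarrow> 1 / 2 \<le> norm (H v)"
  proof (rule ccontr)
    assume "\<not> ?thesis"
    then have "\<exists>v. \<bar>v\<bar> \<le> 1 / real (Suc n) \<and> norm (H v) < 1 / 2" for n
      by (meson not_le of_nat_0_less_iff zero_less_Suc zero_less_divide_1_iff)
    then obtain u where u: "\<And>n. \<bar>u n\<bar> \<le> 1 / real (Suc n)" "\<And>n. norm (H (u n)) < 1 / 2" by metis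
    have "u \<longlonglongrightarrow> 0"
      by (rule Lim_null_comparison[where g = "\<lambda>n. 1 / real (Suc n)"])
         (use u(1) LIMSEQ_inverse_real_of_nat in \<open>auto simp: divide_inverse\<close>)
    then have "(\<lambda>n. H (u n)) \<longlonglongrightarrow> H 0"
      unfolding H_def
      by (intro integral_dominated_convergence[where w = "indicat_real {0..1}"])
         (use norm_charf_le ii in \<open>auto intro!: tendsto_intros charf_tendsto simp: mult_left_le\<close>)
    then have "(\<lambda>n. norm (H (u n))) \<longlonglongrightarrow> norm (H 0)" by (rule tendsto_norm)
    then have "norm (H 0) \<le> 1 / 2" by (rule LIMSEQ_le_const2) (use u(2) in \<open>auto intro: less_imp_le\<close>)
    moreover have "H 0 = (\<integral>t. complex_of_real (indicator {0..1::real} t) \<partial>lborel)"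
      unfolding H_def by (simp add: charf_def prob_space scaleR_conv_of_real content_real)
    ultimately show False by simp
  qed
  then obtain \<delta> where \<delta>: "0 < \<delta>" "\<And>v. \<bar>v\<bar> \<le> \<delta> \<Longrightarrow> 1 / 2 \<le> norm (H v)" by blast
  show ?thesis
  proof (rule that[of "min 1 \<delta>"])
    fix v h :: real assume v: "\<bar>v\<bar> \<le> min 1 \<delta>" and h: "0 \<le> h"
    have "norm (1 - charf h v) * (1 / 2) \<le> norm (1 - charf h v) * norm (H v)"
      using \<delta>(2)[of v] v by (intro mult_left_mono) auto
    then show "norm (1 - charf h v) \<le> 4 * h" using step[OF h, of v] by simp
  qed (use \<delta>(1) in auto)
qed

lemma integral_one_minus_cos:
  fixes d x :: real
  assumes "0 \<le> d" "x \<noteq> 0"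
  shows "(\<integral>v. indicator {0..d} v *\<^sub>R (1 - cos (v * x)) \<partial>lborel) = d - sin (d * x) / x"
proof -
  have "(\<integral>v. indicator {0..d} v *\<^sub>R (1 - cos (v * x)) \<partial>lborel) = (d - sin (d * x) / x) - (0 - sin (0 * x) / x)"
  proof (rule integral_FTC_atLeastAtMost[OF assms(1)])
    fix v assume "0 \<le> v" "v \<le> d"
    show "((\<lambda>v. v - sin (v * x) / x) has_vector_derivative 1 - cos (v * x)) (at v within {0..d})"
      unfolding has_real_derivative_iff_has_vector_derivative[symmetric]
      by (rule derivative_eq_intros refl)+ (use assms in \<open>auto simp: field_simps\<close>)
  qed (auto intro!: continuous_intros)
  then show ?thesis by simp
qed

text \<open>
  Averaging \<open>1 - cos (v * X t)\<close> over small frequencies gives \<open>1 - sin y / y\<close> with \<open>y = \<delta> * X t\<close>, which dominates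
  \<open>min 1 (y^2)\<close>; by \<open>charf_near_1\<close> the expectation is of order \<open>t\<close>.  The square root arises when the first moment is
  estimated by the second.
\<close>

lemma small_time_bound:
  obtains C where "0 \<le> C" "\<And>t. 0 \<le> t \<Longrightarrow> (\<integral>\<omega>. min 1 \<bar>X (max 0 t) \<omega>\<bar> \<partial>M) \<le> C * sqrt t"
proof -
  obtain \<delta> where \<delta>: "0 < \<delta>" "\<delta> \<le> 1" "\<And>v h. \<bar>v\<bar> \<le> \<delta> \<Longrightarrow> 0 \<le> h \<Longrightarrow> norm (1 - charf h v) \<le> 4 * h"
    using charf_near_1 by blast
  interpret P: pair_sigma_finite lborel M ..
  have "(\<integral>\<omega>. min 1 \<bar>X (max 0 t) \<omega>\<bar> \<partial>M) \<le> (sqrt 30 / \<delta>) * sqrt t" if t: "0 \<le> t" for t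
  proof -
    define Y where "Y = X (max 0 t)"
    have [measurable]: "Y \<in> borel_measurable M" by (simp add: Y_def)
    have bnd: "\<bar>1 - cos y\<bar> \<le> 2" for y :: real
      unfolding abs_le_iff using cos_le_one[of y] cos_ge_minus_one[of y] by linarith
    define f where "f p = indicator {0..\<delta>} (fst p) *\<^sub>R (1 - cos (fst p * Y (snd p)))" for p
    have [measurable]: "f \<in> borel_measurable (lborel \<Otimes>\<^sub>M M)" unfolding f_def[abs_def] by measurable
    have i1: "integrable lborel (indicat_real {0..\<delta>})"
      by (rule integrable_real_indicator) (auto simp: emeasure_lborel_Icc_eq)
    then have i2: "integrable lborel (\<lambda>v. indicat_real {0..\<delta>} v * 2)" by simp
    have iM: "integrable M (\<lambda>\<omega>. norm (f (v, \<omega>)))" "integrable M (\<lambda>\<omega>. f (v, \<omega>))" for v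
      by (rule integrable_const_bound[of _ 2]; use bnd in \<open>auto simp: f_def indicator_def\<close>)+
    have f: "integrable (lborel \<Otimes>\<^sub>M M) f"
    proof (rule P.Fubini_integrable)
      show "integrable lborel (\<lambda>v. \<integral>\<omega>. norm (f (v, \<omega>)) \<partial>M)"
      proof (rule Bochner_Integration.integrable_bound[OF i2])
        have "norm (\<integral>\<omega>. norm (f (v, \<omega>)) \<partial>M) \<le> norm (indicat_real {0..\<delta>} v * 2)" for v
        proof -
          have "(\<integral>\<omega>. norm (f (v, \<omega>)) \<partial>M) \<le> (\<integral>\<omega>. indicat_real {0..\<delta>} v * 2 \<partial>M)"
            by (rule integral_mono) (use iM bnd in \<open>auto simp: f_def indicator_def\<close>)
          then show ?thesis by (simp add: prob_space)
        qed
        then show "AE v in lborel. norm (\<integral>\<omega>. norm (f (v, \<omega>)) \<partial>M) \<le> norm (indicat_real {0..\<delta>} v * 2)" by simp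
      qed measurable
    qed (use iM in auto)
    have "(\<integral>\<omega>. (\<integral>v. f (v, \<omega>) \<partial>lborel) \<partial>M) = (\<integral>v. (\<integral>\<omega>. f (v, \<omega>) \<partial>M) \<partial>lborel)"
      using P.Fubini_integral[of "\<lambda>v \<omega>. f (v, \<omega>)"] f by (simp add: split_def)
    also have "\<dots> \<le> (\<integral>v. indicat_real {0..\<delta>} v * (4 * t) \<partial>lborel)"
    proof (rule integral_mono)
      show "integrable lborel (\<lambda>v. \<integral>\<omega>. f (v, \<omega>) \<partial>M)" using P.integrable_fst'[OF f] .
      fix v
      have "(\<integral>\<omega>. cos (v * Y \<omega>) \<partial>M) = Re (charf t v)"
        unfolding charf_def Y_def[symmetric]
        using integral_Re[OF integrable_iexp[of Y v]] by (simp add: Re_exp)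
      then have "(\<integral>\<omega>. f (v, \<omega>) \<partial>M) = indicator {0..\<delta>} v * (1 - Re (charf t v))"
        unfolding f_def
        by (simp, subst Bochner_Integration.integral_diff)
           (auto simp: prob_space intro!: integrable_const_bound[of _ 1])
      moreover have "1 - Re (charf t v) \<le> 4 * t" if "v \<in> {0..\<delta>}"
        using \<delta>(3)[of v t] that t complex_Re_le_cmod[of "1 - charf t v"] by auto
      ultimately show "(\<integral>\<omega>. f (v, \<omega>) \<partial>M) \<le> indicat_real {0..\<delta>} v * (4 * t)"
        by (auto simp: indicator_def)
    qed (use i1 in simp)
    also have "\<dots> = 4 * t * \<delta>" using \<delta> by simp
    finally have F: "(\<integral>\<omega>. (\<integral>v. f (v, \<omega>) \<partial>lborel) \<partial>M) \<le> 4 * t * \<delta>" .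
    \<comment> \<open>The quantity whose square is controlled by the average of \<open>1 - cos\<close>.\<close>
    define Z where "Z \<omega> = min 1 (\<delta> * \<bar>Y \<omega>\<bar>)" for \<omega>
    have [measurable]: "Z \<in> borel_measurable M" unfolding Z_def[abs_def] by measurable
    have Z01: "0 \<le> Z \<omega>" "Z \<omega> \<le> 1" for \<omega> using \<delta> by (auto simp: Z_def)
    have iZ: "integrable M Z" by (rule integrable_const_bound[of _ 1]) (use Z01 in auto)
    have iZ2: "integrable M (\<lambda>\<omega>. (Z \<omega>)\<^sup>2)"
      by (rule integrable_const_bound[of _ 1]) (use Z01 in \<open>auto simp: abs_square_le_1\<close>)
    have "2 / 15 * \<delta> * (\<integral>\<omega>. (Z \<omega>)\<^sup>2 \<partial>M) = (\<integral>\<omega>. 2 / 15 * \<delta> * (Z \<omega>)\<^sup>2 \<partial>M)" by simp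
    also have "\<dots> \<le> (\<integral>\<omega>. (\<integral>v. f (v, \<omega>) \<partial>lborel) \<partial>M)"
    proof (rule integral_mono)
      show "integrable M (\<lambda>\<omega>. \<integral>v. f (v, \<omega>) \<partial>lborel)" using P.integrable_snd[of "\<lambda>v \<omega>. f (v, \<omega>)"] f by (simp add: split_def)
      fix \<omega>
      have Z2: "(Z \<omega>)\<^sup>2 = min 1 ((\<delta> * Y \<omega>)\<^sup>2)"
      proof (cases "\<delta> * \<bar>Y \<omega>\<bar> \<le> 1")
        case True
        then have "(\<delta> * \<bar>Y \<omega>\<bar>)\<^sup>2 \<le> 1\<^sup>2" using \<delta> by (intro power_mono) auto
        with True show ?thesis by (simp add: Z_def power_mult_distrib)
      next
        case False
        then have "1\<^sup>2 \<le> (\<delta> * \<bar>Y \<omega>\<bar>)\<^sup>2" by (intro power_mono) auto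
        with False show ?thesis by (simp add: Z_def power_mult_distrib)
      qed
      show "2 / 15 * \<delta> * (Z \<omega>)\<^sup>2 \<le> (\<integral>v. f (v, \<omega>) \<partial>lborel)"
      proof (cases "Y \<omega> = 0")
        case True then show ?thesis by (simp add: Z2 f_def)
      next
        case False
        have "(\<integral>v. f (v, \<omega>) \<partial>lborel) = \<delta> - sin (\<delta> * Y \<omega>) / Y \<omega>"
          using integral_one_minus_cos[of \<delta> "Y \<omega>"] False \<delta> by (simp add: f_def)
        also have "\<dots> = \<delta> * (1 - sin (\<delta> * Y \<omega>) / (\<delta> * Y \<omega>))"
          using \<delta> False by (simp add: field_simps)
        finally show ?thesis
          using mult_left_mono[OF one_minus_sinc_lower_bound[of "\<delta> * Y \<omega>"], of \<delta>] \<delta> False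
          by (simp add: Z2 mult_ac)
      qed
    qed (use iZ2 in simp)
    also note F
    finally have "(\<integral>\<omega>. (Z \<omega>)\<^sup>2 \<partial>M) \<le> 30 * t" using \<delta>(1) by (simp add: field_simps)
    moreover have "(\<integral>\<omega>. Z \<omega> \<partial>M)\<^sup>2 \<le> (\<integral>\<omega>. (Z \<omega>)\<^sup>2 \<partial>M)"
      using variance_positive[of Z] variance_eq[OF iZ iZ2] by simp
    ultimately have "(\<integral>\<omega>. Z \<omega> \<partial>M)\<^sup>2 \<le> 30 * t" by simp
    then have EZ: "(\<integral>\<omega>. Z \<omega> \<partial>M) \<le> sqrt 30 * sqrt t"
      using real_le_rsqrt by (simp add: real_sqrt_mult[symmetric])
    have "(\<integral>\<omega>. min 1 \<bar>Y \<omega>\<bar> \<partial>M) \<le> (\<integral>\<omega>. Z \<omega> / \<delta> \<partial>M)"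
    proof (rule integral_mono)
      show "integrable M (\<lambda>\<omega>. min 1 \<bar>Y \<omega>\<bar>)" by (rule integrable_const_bound[of _ 1]) auto
      show "min 1 \<bar>Y \<omega>\<bar> \<le> Z \<omega> / \<delta>" for \<omega>
        using \<delta> mult_left_le_one_le[of "\<bar>Y \<omega>\<bar>" \<delta>] by (auto simp: Z_def min_def field_simps)
    qed (use iZ in simp)
    also have "\<dots> \<le> sqrt 30 * sqrt t / \<delta>" using EZ \<delta> by (simp add: divide_right_mono)
    finally show ?thesis by (simp add: Y_def)
  qed
  then show ?thesis using that[of "sqrt 30 / \<delta>"] \<delta> by simp
qed

end

section \<open>The exponents of the functions \<open>\<phi>\<close>\<close>

lemma integral_sums_over_index:
  fixes F :: "'a \<Rightarrow> 'b::{banach, second_countable_topology}" and N :: "'a \<Rightarrow> nat"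
  assumes F: "integrable M F" and N[measurable]: "N \<in> measurable M (count_space UNIV)"
  shows "(\<lambda>j::nat. \<integral>x. indicator {x. N x = j} x *\<^sub>R F x \<partial>M) sums (\<integral>x. F x \<partial>M)"
proof -
  have [measurable]: "F \<in> borel_measurable M" using F by simp
  define f where "f j x = indicator {x. N x = j} x *\<^sub>R F x" for j x
  have [measurable]: "(\<lambda>x. f j x) \<in> borel_measurable M" for j unfolding f_def by measurable
  have int: "integrable M (f j)" for j
    by (rule Bochner_Integration.integrable_bound[OF F]) (auto simp: f_def indicator_def)
  have fin: "finite {j. f j x \<noteq> 0}" for x
    by (rule finite_subset[of _ "{N x}"]) (auto simp: f_def indicator_def)
  have sum: "(\<Sum>j. f j x) = F x" for x
    using suminf_finite[of "{N x}" "\<lambda>j. f j x"] by (auto simp: f_def indicator_def)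
  have part: "(\<Sum>j<n. norm (f j x)) \<le> norm (F x)" for n x
  proof -
    have "(\<Sum>j<n. norm (f j x)) = (\<Sum>j<n. if j = N x then norm (F x) else 0)"
      by (rule sum.cong) (auto simp: f_def indicator_def)
    then show ?thesis by simp
  qed
  have "(\<lambda>j. \<integral>x. f j x \<partial>M) sums (\<integral>x. (\<Sum>j. f j x) \<partial>M)"
  proof (rule sums_integral)
    show "AE x in M. summable (\<lambda>j. norm (f j x))"
      by (intro always_eventually allI summable_finite[of "{N x}" for x]) (auto simp: f_def indicator_def)
    show "summable (\<lambda>j. \<integral>x. norm (f j x) \<partial>M)"
    proof (rule bounded_imp_summable)
      fix n
      have "(\<Sum>j\<le>n. \<integral>x. norm (f j x) \<partial>M) = (\<integral>x. (\<Sum>j\<le>n. norm (f j x)) \<partial>M)"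
        using int by (intro Bochner_Integration.integral_sum[symmetric]) auto
      also have "\<dots> \<le> (\<integral>x. norm (F x) \<partial>M)"
        using int F part[of _ "Suc n"] by (intro integral_mono) (auto simp: lessThan_Suc_atMost)
      finally show "(\<Sum>j\<le>n. \<integral>x. norm (f j x) \<partial>M) \<le> (\<integral>x. norm (F x) \<partial>M)" .
    qed simp
  qed (rule int)
  then show ?thesis unfolding sum by (simp add: f_def)
qed

text \<open>
  An integrable majorant on \<open>{0<..}\<close> for \<open>c > 0\<close>.  It decreases in \<open>t\<close>, so that it also bounds the integrand at grid
  points to the right of \<open>t\<close>.
\<close>

definition dom_fun :: "real \<Rightarrow> real \<Rightarrow> real" where
  "dom_fun c t = exp (- (c * t)) * (1 + 1 / sqrt t)"

lemma dom_fun_measurable [measurable]: "dom_fun c \<in> borel_measurable borel"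
  unfolding dom_fun_def[abs_def] by measurable

lemma dom_fun_nonneg: "0 < t \<Longrightarrow> 0 \<le> dom_fun c t" by (simp add: dom_fun_def)

lemma dom_fun_antimono: "0 \<le> c \<Longrightarrow> 0 < s \<Longrightarrow> s \<le> t \<Longrightarrow> dom_fun c t \<le> dom_fun c s"
  unfolding dom_fun_def
  by (intro mult_mono add_mono divide_left_mono) (auto simp: mult_left_mono)

lemma dom_fun_integrable:
  assumes c: "0 < c" shows "set_integrable lborel {0<..} (dom_fun c)"
proof -
  have "set_integrable lborel {0..1} (\<lambda>t. t powr (1/2 - 1) * (1 - t) powr (1 - 1 :: real))"
    by (rule integrable_Beta) auto
  moreover have "set_integrable lborel {0<..} (\<lambda>t. exp (- (t * c)))"
    by (rule integrable_I0i_exp_mscale[OF c])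
  ultimately have int: "integrable lborel (\<lambda>t. indicator {0..1} t *\<^sub>R (t powr (1/2 - 1) * (1 - t) powr (1 - 1 :: real))
      + 2 * (indicator {0<..} t *\<^sub>R exp (- (t * c))))"
    unfolding set_integrable_def by (intro Bochner_Integration.integrable_add integrable_mult_right) auto
  show ?thesis unfolding set_integrable_def
  proof (rule Bochner_Integration.integrable_bound[OF int])
    have le: "norm (indicator {0<..} t *\<^sub>R dom_fun c t) \<le> indicator {0..1} t *\<^sub>R (t powr (1/2 - 1) * (1 - t) powr (1 - 1))
      + 2 * (indicator {0<..} t *\<^sub>R exp (- (t * c)))" for t :: real
    proof (cases "0 < t")
      case True
      have lhs: "norm (indicator {0<..} t *\<^sub>R dom_fun c t) = exp (- (t * c)) + exp (- (t * c)) * (1 / sqrt t)"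
        using True dom_fun_nonneg[OF True, of c] by (simp add: dom_fun_def distrib_left mult.commute)
      have ee: "0 < exp (- (t * c))" "exp (- (t * c)) \<le> 1" using c True by auto
      show ?thesis
      proof (cases "t < 1")
        case t: True
        have "t powr (1/2 - 1) = 1 / sqrt t"
          using True by (simp add: powr_minus_divide powr_half_sqrt[symmetric] powr_minus[symmetric])
        moreover have "exp (- (t * c)) * (1 / sqrt t) \<le> 1 / sqrt t"
          using ee True by (intro mult_left_le_one_le) auto
        moreover have "indicator {0..1} t *\<^sub>R (t powr (1/2 - 1) * (1 - t) powr (1 - 1))
            + 2 * (indicator {0<..} t *\<^sub>R exp (- (t * c))) = t powr (1/2 - 1) + 2 * exp (- (t * c))"
          using True t by simp
        ultimately show ?thesis using ee lhs by linarith
      next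
        case False
        then have "1 \<le> sqrt t" by simp
        then have "1 / sqrt t \<le> 1" by (simp add: field_simps)
        then have "exp (- (t * c)) * (1 / sqrt t) \<le> exp (- (t * c))" using ee by (intro mult_left_le) auto
        moreover have "2 * exp (- (t * c)) \<le> indicator {0..1} t *\<^sub>R (t powr (1/2 - 1) * (1 - t) powr (1 - 1))
            + 2 * (indicator {0<..} t *\<^sub>R exp (- (t * c)))"
          using True by (simp add: indicator_def)
        ultimately show ?thesis using lhs by linarith
      qed
    qed simp
    show "AE t in lborel. norm (indicator {0<..} t *\<^sub>R dom_fun c t) \<le> norm (indicator {0..1} t *\<^sub>R (t powr (1/2 - 1) * (1 - t) powr (1 - 1))
      + 2 * (indicator {0<..} t *\<^sub>R exp (- (t * c))))"
      by (rule always_eventually, rule allI, rule order_trans[OF le])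
         (simp only: real_norm_def abs_ge_self)
  qed measurable
qed

context levy
begin

text \<open>
  The integral over the space variable in the exponent of \<open>\<phi>\<close>, for the process tilted by the slope \<open>e\<close>.
\<close>

definition marginal :: "real set \<Rightarrow> complex \<Rightarrow> complex \<Rightarrow> real \<Rightarrow> real \<Rightarrow> complex" where
  "marginal A a b e t = (\<integral>\<omega>. indicator A (X (max 0 t) \<omega> - e * t) *\<^sub>R
     phi_integrand a b t (X (max 0 t) \<omega> - e * t) \<partial>M)"

lemma marginal_measurable [measurable]:
  assumes [measurable]: "A \<in> sets borel"
  shows "marginal A a b e \<in> borel_measurable borel"
  unfolding marginal_def[abs_def] by measurable

text \<open>
  The bound is uniform in the slope, since the tilt changes positions by at most \<open>t\<close>; this makes one majorant
  serve both limits.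
\<close>

lemma marginal_bound:
  assumes a: "Re a < 0" and b: "Re b \<le> 0"
  obtains B where "0 \<le> B" "\<And>t e. 0 < t \<Longrightarrow> 0 \<le> e \<Longrightarrow> e \<le> 1 \<Longrightarrow>
    (\<integral>\<omega>. norm (phi_integrand a b t (X (max 0 t) \<omega> - e * t)) \<partial>M) \<le> B * dom_fun (min 1 (- Re a)) t"
proof -
  obtain C where C: "0 \<le> C" "\<And>t. 0 \<le> t \<Longrightarrow> (\<integral>\<omega>. min 1 \<bar>X (max 0 t) \<omega>\<bar> \<partial>M) \<le> C * sqrt t"
    using small_time_bound by blast
  define c where "c = min 1 (- Re a)"
  define B where "B = norm (1 + a) + (2 + norm b) * (C + 1)"
  have c: "0 < c" "c \<le> 1" "c \<le> - Re a" using a by (auto simp: c_def)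
  have "(\<integral>\<omega>. norm (phi_integrand a b t (X (max 0 t) \<omega> - e * t)) \<partial>M) \<le> B * dom_fun c t"
    if t: "0 < t" and e: "0 \<le> e" "e \<le> 1" for t e
  proof -
    let ?E = "exp (- (c * t))"
    have min: "min 2 (norm b * \<bar>x - e * t\<bar>) \<le> (2 + norm b) * (min 1 \<bar>x\<bar> + t)" for x
    proof -
      have "min 2 (norm b * \<bar>x - e * t\<bar>) \<le> (2 + norm b) * min 1 \<bar>x - e * t\<bar>"
      proof (cases "\<bar>x - e * t\<bar> \<le> 1")
        case True
        have "min 2 (norm b * \<bar>x - e * t\<bar>) \<le> norm b * \<bar>x - e * t\<bar>" by simp
        also have "\<dots> \<le> (2 + norm b) * \<bar>x - e * t\<bar>" by (intro mult_right_mono) auto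
        finally show ?thesis using True by simp
      next
        case False
        have "min 2 (norm b * \<bar>x - e * t\<bar>) \<le> 2" by simp
        also have "\<dots> \<le> 2 + norm b" by simp
        finally show ?thesis using False by simp
      qed
      also have "min 1 \<bar>x - e * t\<bar> \<le> min 1 \<bar>x\<bar> + t"
      proof -
        have "\<bar>x - e * t\<bar> \<le> \<bar>x\<bar> + e * t" using abs_triangle_ineq4[of x "e * t"] e t by simp
        moreover have "e * t \<le> t" using e t by (simp add: mult_left_le_one_le)
        ultimately have "\<bar>x - e * t\<bar> \<le> \<bar>x\<bar> + t" by linarith
        then show ?thesis using t by (simp add: min_def)
      qed
      finally show ?thesis by (simp add: mult_left_mono)
    qed
    have iX: "integrable M (\<lambda>\<omega>. min 1 \<bar>X (max 0 t) \<omega>\<bar>)"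
      by (rule integrable_const_bound[of _ 1]) auto
    have "norm (phi_integrand a b t (X (max 0 t) \<omega> - e * t)) \<le>
        ?E * (norm (1 + a) * t + (2 + norm b) * (min 1 \<bar>X (max 0 t) \<omega>\<bar> + t)) / t" for \<omega>
      by (rule order_trans[OF phi_integrand_bound[OF t b c(2,3)]])
         (use min t in \<open>auto intro!: divide_right_mono mult_left_mono add_mono\<close>)
    moreover have "integrable M (\<lambda>\<omega>. norm (phi_integrand a b t (X (max 0 t) \<omega> - e * t)))"
    proof (rule integrable_const_bound[of _ "2 / t"])
      show "AE \<omega> in M. norm (norm (phi_integrand a b t (X (max 0 t) \<omega> - e * t))) \<le> 2 / t"
        using phi_integrand_bound_const[OF t] a b by simp
    qed measurable
    ultimately have "(\<integral>\<omega>. norm (phi_integrand a b t (X (max 0 t) \<omega> - e * t)) \<partial>M) \<le>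
        (\<integral>\<omega>. ?E * (norm (1 + a) * t + (2 + norm b) * (min 1 \<bar>X (max 0 t) \<omega>\<bar> + t)) / t \<partial>M)"
      using iX by (intro integral_mono) auto
    also have "\<dots> = ?E * (norm (1 + a) * t + (2 + norm b) * ((\<integral>\<omega>. min 1 \<bar>X (max 0 t) \<omega>\<bar> \<partial>M) + t)) / t"
      using iX by (simp add: prob_space)
    also have "\<dots> \<le> ?E * (norm (1 + a) * t + (2 + norm b) * (C * sqrt t + t)) / t"
      using C(2)[of t] t by (intro divide_right_mono mult_left_mono add_mono) auto
    also have "\<dots> = ?E * (norm (1 + a) + (2 + norm b) * (C * (1 / sqrt t) + 1))"
    proof -
      have d1: "sqrt t / t = 1 / sqrt t" using t by (simp add: field_simps)
      have d2: "?E * (norm (1 + a) * t + (2 + norm b) * (C * s + t)) / t =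
          ?E * (norm (1 + a) + (2 + norm b) * (C * (s / t) + 1))" for s
        using t by (simp add: field_simps)
      show ?thesis unfolding d2 d1 ..
    qed
    also have "\<dots> \<le> ?E * (B * (1 + 1 / sqrt t))"
    proof (intro mult_left_mono)
      have "0 \<le> norm (1 + a) * (1 / sqrt t)" "0 \<le> (2 + norm b) * C" "0 \<le> (2 + norm b) * (1 / sqrt t)"
        using t C by auto
      then show "norm (1 + a) + (2 + norm b) * (C * (1 / sqrt t) + 1) \<le> B * (1 + 1 / sqrt t)"
        unfolding B_def by (simp add: algebra_simps)
    qed simp
    finally show ?thesis by (simp add: dom_fun_def mult_ac)
  qed
  moreover have "0 \<le> B" using C by (simp add: B_def)
  ultimately show ?thesis using that by (simp add: c_def)
qed

lemma norm_marginal_le: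
  assumes [measurable]: "A \<in> sets borel" and t: "0 < t" and ab: "Re a \<le> 0" "Re b \<le> 0"
  shows "norm (marginal A a b e t) \<le> (\<integral>\<omega>. norm (phi_integrand a b t (X (max 0 t) \<omega> - e * t)) \<partial>M)"
  unfolding marginal_def
proof (rule norm_integral_le)
  show "integrable M (\<lambda>\<omega>. norm (phi_integrand a b t (X (max 0 t) \<omega> - e * t)))"
  proof (rule integrable_const_bound[of _ "2 / t"])
    show "AE \<omega> in M. norm (norm (phi_integrand a b t (X (max 0 t) \<omega> - e * t))) \<le> 2 / t"
      using phi_integrand_bound_const[OF t] ab by simp
  qed measurable
qed (auto simp: indicator_def)

lemma phi_exponent_conv_marginal:
  assumes [measurable]: "A \<in> sets borel" and "0 < t"
  shows "(LINT x:A|distr M borel (X t). phi_integrand a b t x) = marginal A a b 0 t"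
    and "(LINT x:A|distr M borel (X t). norm (phi_integrand a b t x)) =
      (\<integral>\<omega>. indicator A (X (max 0 t) \<omega>) *\<^sub>R norm (phi_integrand a b t (X (max 0 t) \<omega>)) \<partial>M)"
proof -
  have [measurable]: "X t \<in> borel_measurable M" using assms by (intro X_measurable) simp
  show "(LINT x:A|distr M borel (X t). phi_integrand a b t x) = marginal A a b 0 t"
    unfolding marginal_def set_lebesgue_integral_def using assms by (subst integral_distr) (auto simp: max_def)
  show "(LINT x:A|distr M borel (X t). norm (phi_integrand a b t x)) =
      (\<integral>\<omega>. indicator A (X (max 0 t) \<omega>) *\<^sub>R norm (phi_integrand a b t (X (max 0 t) \<omega>)) \<partial>M)"
    unfolding set_lebesgue_integral_def using assms by (subst integral_distr) (auto simp: max_def)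
qed

lemma phi_integral_exists:
  assumes A[measurable]: "A \<in> sets borel" and ab: "Re a < 0" "Re b \<le> 0"
  shows "phi_integral_exists M X A a b"
proof -
  obtain B where B: "0 \<le> B" "\<And>t e. 0 < t \<Longrightarrow> 0 \<le> e \<Longrightarrow> e \<le> 1 \<Longrightarrow>
      (\<integral>\<omega>. norm (phi_integrand a b t (X (max 0 t) \<omega> - e * t)) \<partial>M) \<le> B * dom_fun (min 1 (- Re a)) t"
    using marginal_bound[OF ab] by blast
  have dom: "integrable lborel (\<lambda>t. B * (indicator {0<..} t *\<^sub>R dom_fun (min 1 (- Re a)) t))"
    using dom_fun_integrable[of "min 1 (- Re a)"] ab by (auto simp: set_integrable_def)
  have 1: "set_integrable (distr M borel (X t)) A (phi_integrand a b t)" if t: "0 < t" for t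
  proof -
    have [measurable]: "X t \<in> borel_measurable M" using t by (intro X_measurable) simp
    interpret D: prob_space "distr M borel (X t)" by (rule prob_space_distr) simp
    show ?thesis unfolding set_integrable_def
      by (rule D.integrable_const_bound[of _ "2 / t"])
         (use phi_integrand_bound_const[OF t, of a b] ab t in \<open>auto simp: indicator_def\<close>)
  qed
  have le: "(\<integral>\<omega>. indicator A (X (max 0 t) \<omega>) *\<^sub>R norm (phi_integrand a b t (X (max 0 t) \<omega>)) \<partial>M)
      \<le> B * dom_fun (min 1 (- Re a)) t" if t: "0 < t" for t
  proof -
    have "(\<integral>\<omega>. indicator A (X (max 0 t) \<omega>) *\<^sub>R norm (phi_integrand a b t (X (max 0 t) \<omega>)) \<partial>M) \<le>
      (\<integral>\<omega>. norm (phi_integrand a b t (X (max 0 t) \<omega>)) \<partial>M)"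
    proof (rule integral_mono)
    have [measurable]: "X t \<in> borel_measurable M" using t by (intro X_measurable) simp
    show "integrable M (\<lambda>\<omega>. indicator A (X (max 0 t) \<omega>) *\<^sub>R norm (phi_integrand a b t (X (max 0 t) \<omega>)))"
      by (rule integrable_const_bound[of _ "2 / t"])
         (use phi_integrand_bound_const[OF t, of a b] ab t in \<open>auto simp: indicator_def\<close>)
    show "integrable M (\<lambda>\<omega>. norm (phi_integrand a b t (X (max 0 t) \<omega>)))"
      by (rule integrable_const_bound[of _ "2 / t"])
         (use phi_integrand_bound_const[OF t, of a b] ab t in auto)
    qed (use t in \<open>auto simp: indicator_def\<close>)
    also have "\<dots> \<le> B * dom_fun (min 1 (- Re a)) t" using B(2)[of t 0] t by simp
    finally show ?thesis .
  qed
  have 2: "integrable lborel (\<lambda>t. indicator {0<..} t *\<^sub>R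
      (\<integral>\<omega>. indicator A (X (max 0 t) \<omega>) *\<^sub>R norm (phi_integrand a b t (X (max 0 t) \<omega>)) \<partial>M))"
  proof (rule Bochner_Integration.integrable_bound[OF dom])
    show "AE t in lborel. norm (indicator {0<..} t *\<^sub>R
      (\<integral>\<omega>. indicator A (X (max 0 t) \<omega>) *\<^sub>R norm (phi_integrand a b t (X (max 0 t) \<omega>)) \<partial>M)) \<le>
      norm (B * (indicator {0<..} t *\<^sub>R dom_fun (min 1 (- Re a)) t))"
      using le by (intro always_eventually allI)
        (auto simp: indicator_def abs_mult dom_fun_nonneg B(1) intro!: abs_leI order_trans[OF _ le])
  qed measurable
  have 3: "integrable lborel (\<lambda>t. indicator {0<..} t *\<^sub>R marginal A a b 0 t)"
  proof (rule Bochner_Integration.integrable_bound[OF dom])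
    have "norm (marginal A a b 0 t) \<le> B * dom_fun (min 1 (- Re a)) t" if "0 < t" for t
      using norm_marginal_le[OF A that, of a b 0] B(2)[OF that, of 0] ab by simp
    then show "AE t in lborel. norm (indicator {0<..} t *\<^sub>R marginal A a b 0 t) \<le>
      norm (B * (indicator {0<..} t *\<^sub>R dom_fun (min 1 (- Re a)) t))"
      by (intro always_eventually allI) (auto simp: indicator_def abs_mult dom_fun_nonneg B(1))
  qed measurable
  show ?thesis
    unfolding phi_integral_exists_def
  proof (intro conjI allI impI 1)
    show "set_integrable lborel {0<..} (\<lambda>t. LINT x:A|distr M borel (X t). norm (phi_integrand a b t x))"
      unfolding set_integrable_def
      by (rule Bochner_Integration.integrable_cong[THEN iffD1, OF refl _ 2])
         (auto simp: indicator_def phi_exponent_conv_marginal)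
    show "set_integrable lborel {0<..} (\<lambda>t. LINT x:A|distr M borel (X t). phi_integrand a b t x)"
      unfolding set_integrable_def
      by (rule Bochner_Integration.integrable_cong[THEN iffD1, OF refl _ 3])
         (auto simp: indicator_def phi_exponent_conv_marginal)
  qed
qed

definition exponent :: "real set \<Rightarrow> complex \<Rightarrow> complex \<Rightarrow> real \<Rightarrow> complex" where
  "exponent A a b e = (\<integral>t. indicator {0<..} t *\<^sub>R marginal A a b e t \<partial>lborel)"

lemma phi_eq_exp_exponent:
  assumes "A \<in> sets borel" shows "phi M X A a b = exp (exponent A a b 0)"
proof -
  have "(LINT t:{0<..}|lborel. LINT x:A|distr M borel (X t). phi_integrand a b t x) = exponent A a b 0"
    unfolding exponent_def
    by (subst set_lebesgue_integral_def, rule Bochner_Integration.integral_cong)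
       (auto split: split_indicator simp: phi_exponent_conv_marginal(1)[OF assms])
  then show ?thesis by (simp add: phi_def)
qed

text \<open>
  The indicator of a half-line is discontinuous, so that its convergence is a separate hypothesis; it comes from
  positive slopes or from the absence of atoms.
\<close>

lemma marginal_converges:
  assumes A: "A = {0<..} \<or> A = {..0}" and ab: "Re a < 0" "Re b \<le> 0" and t: "0 < t"
    and s: "\<And>n. 0 < s n" "s \<longlonglongrightarrow> t"
    and conv: "AE \<omega> in M. (\<lambda>n. X (s n) \<omega> - e n * s n) \<longlonglongrightarrow> X t \<omega> - e' * t"
    and ind: "AE \<omega> in M. (\<lambda>n. indicator A (X (s n) \<omega> - e n * s n) :: real) \<longlonglongrightarrow> indicator A (X t \<omega> - e' * t)"
  shows "(\<lambda>n. marginal A a b (e n) (s n)) \<longlonglongrightarrow> marginal A a b e' t"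
proof -
  have [measurable]: "A \<in> sets borel" using A by auto
  have "\<forall>\<^sub>F n in sequentially. t / 2 < s n" using order_tendstoD(1)[OF s(2), of "t / 2"] t by simp
  then obtain m where m: "\<And>n. m \<le> n \<Longrightarrow> t / 2 < s n" by (auto simp: eventually_sequentially)
  have "(\<lambda>n. marginal A a b (e (n + m)) (s (n + m))) \<longlonglongrightarrow> marginal A a b e' t"
    unfolding marginal_def
  proof (rule integral_dominated_convergence[where w = "\<lambda>_. 4 / t"])
    show "AE \<omega> in M. (\<lambda>n. indicator A (X (max 0 (s (n + m))) \<omega> - e (n + m) * s (n + m)) *\<^sub>R
          phi_integrand a b (s (n + m)) (X (max 0 (s (n + m))) \<omega> - e (n + m) * s (n + m)))
        \<longlonglongrightarrow> indicator A (X (max 0 t) \<omega> - e' * t) *\<^sub>R phi_integrand a b t (X (max 0 t) \<omega> - e' * t)"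
      using conv ind
    proof eventually_elim
      case (elim \<omega>)
      have "(\<lambda>n. indicator A (X (s n) \<omega> - e n * s n) *\<^sub>R phi_integrand a b (s n) (X (s n) \<omega> - e n * s n))
          \<longlonglongrightarrow> indicator A (X t \<omega> - e' * t) *\<^sub>R phi_integrand a b t (X t \<omega> - e' * t)"
        unfolding phi_integrand_def using t by (intro tendsto_intros elim s) auto
      from LIMSEQ_ignore_initial_segment[OF this, of m] show ?case
        using s(1) t by (simp add: max_def not_le[symmetric] less_imp_le)
    qed
    have "norm (phi_integrand a b (s (n + m)) x) \<le> 4 / t" for n x
    proof -
      have "norm (phi_integrand a b (s (n + m)) x) \<le> 2 / s (n + m)"
        using s(1) ab by (intro phi_integrand_bound_const) auto
      also have "\<dots> \<le> 2 / (t / 2)" using m[of "n + m"] s(1)[of "n + m"] t by (intro divide_left_mono) auto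
      finally show ?thesis by simp
    qed
    then show "AE \<omega> in M. norm (indicator A (X (max 0 (s (n + m))) \<omega> - e (n + m) * s (n + m)) *\<^sub>R
          phi_integrand a b (s (n + m)) (X (max 0 (s (n + m))) \<omega> - e (n + m) * s (n + m))) \<le> 4 / t" for n
      using t by (auto simp: indicator_def)
  qed auto
  then show ?thesis by (rule LIMSEQ_offset)
qed

lemma exponent_limit:
  assumes A: "A \<in> sets borel" and ab: "Re a < 0" "Re b \<le> 0"
    and s: "\<And>n t. 0 < t \<Longrightarrow> t \<le> s n t" and [measurable]: "\<And>n. s n \<in> borel_measurable borel"
    and e: "\<And>n. 0 \<le> e n" "\<And>n. e n \<le> 1"
    and conv: "AE t in lborel. 0 < t \<longrightarrow> (\<lambda>n. marginal A a b (e n) (s n t)) \<longlonglongrightarrow> marginal A a b e' t"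
  shows "(\<lambda>n. \<integral>t. indicator {0<..} t *\<^sub>R marginal A a b (e n) (s n t) \<partial>lborel) \<longlonglongrightarrow> exponent A a b e'"
    and "integrable lborel (\<lambda>t. indicator {0<..} t *\<^sub>R marginal A a b (e n) (s n t))"
proof -
  note A[measurable]
  obtain B where B: "0 \<le> B" "\<And>t e. 0 < t \<Longrightarrow> 0 \<le> e \<Longrightarrow> e \<le> 1 \<Longrightarrow>
      (\<integral>\<omega>. norm (phi_integrand a b t (X (max 0 t) \<omega> - e * t)) \<partial>M) \<le> B * dom_fun (min 1 (- Re a)) t"
    using marginal_bound[OF ab] by blast
  have dom: "integrable lborel (\<lambda>t. B * (indicator {0<..} t *\<^sub>R dom_fun (min 1 (- Re a)) t))"
    using dom_fun_integrable[of "min 1 (- Re a)"] ab by (auto simp: set_integrable_def)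
  have le: "norm (indicator {0<..} t *\<^sub>R marginal A a b (e n) (s n t)) \<le> B * (indicator {0<..} t *\<^sub>R dom_fun (min 1 (- Re a)) t)" for n t
  proof (cases "0 < t")
    case True
    then have st: "0 < s n t" "t \<le> s n t" using s[OF True, of n] by auto
    have "norm (marginal A a b (e n) (s n t)) \<le> B * dom_fun (min 1 (- Re a)) (s n t)"
      by (rule order_trans[OF norm_marginal_le B(2)]) (use st ab e in auto)
    also have "\<dots> \<le> B * dom_fun (min 1 (- Re a)) t"
      using st True ab B(1) by (intro mult_left_mono dom_fun_antimono) auto
    finally show ?thesis using True by simp
  qed simp
  show "(\<lambda>n. \<integral>t. indicator {0<..} t *\<^sub>R marginal A a b (e n) (s n t) \<partial>lborel) \<longlonglongrightarrow> exponent A a b e'"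
    unfolding exponent_def
  proof (rule integral_dominated_convergence[OF _ _ dom])
    show "AE t in lborel. (\<lambda>n. indicator {0<..} t *\<^sub>R marginal A a b (e n) (s n t)) \<longlonglongrightarrow> indicator {0<..} t *\<^sub>R marginal A a b e' t"
      using conv by eventually_elim (auto simp: indicator_def)
  qed (use le in auto)
  show "integrable lborel (\<lambda>t. indicator {0<..} t *\<^sub>R marginal A a b (e n) (s n t))"
    by (rule Bochner_Integration.integrable_bound[OF dom])
       (use order_trans[OF le abs_ge_self] in auto)
qed

text \<open>
  Atoms at \<open>0\<close> do no harm: a positive slope moves paths with \<open>X t = 0\<close> to the negative side, and the limit
  counts them with \<open>{..0}\<close> too.
\<close>

lemma exponent_slope_limit:
  assumes A: "A = {0<..} \<or> A = {..0}" and ab: "Re a < 0" "Re b \<le> 0"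
    and e: "\<And>n. 0 < e n" "\<And>n. e n \<le> 1" "e \<longlonglongrightarrow> 0"
  shows "(\<lambda>n. exponent A a b (e n)) \<longlonglongrightarrow> exponent A a b 0"
  unfolding exponent_def[of A a b "e _"]
proof (rule exponent_limit(1)[where s = "\<lambda>_ t. t", OF _ ab])
  show "A \<in> sets borel" using A by auto
  show "AE t in lborel. 0 < t \<longrightarrow> (\<lambda>n. marginal A a b (e n) t) \<longlonglongrightarrow> marginal A a b 0 t"
  proof (intro always_eventually allI impI)
    fix t :: real assume t: "0 < t"
    have lim: "(\<lambda>n. x - e n * t) \<longlonglongrightarrow> x - 0 * t" for x by (intro tendsto_intros e)
    show "(\<lambda>n. marginal A a b (e n) t) \<longlonglongrightarrow> marginal A a b 0 t"
    proof (rule marginal_converges[OF A ab t])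
      show "AE \<omega> in M. (\<lambda>n. indicator A (X t \<omega> - e n * t) :: real) \<longlonglongrightarrow> indicator A (X t \<omega> - 0 * t)"
      proof (rule always_eventually, rule allI, rule tendsto_eventually)
        fix \<omega>
        show "\<forall>\<^sub>F n in sequentially. indicator A (X t \<omega> - e n * t) = (indicator A (X t \<omega> - 0 * t) :: real)"
        proof (cases "0 < X t \<omega>")
          case True
          then have "\<forall>\<^sub>F n in sequentially. 0 < X t \<omega> - e n * t"
            using order_tendstoD(1)[OF lim[of "X t \<omega>"], of 0] by simp
          then show ?thesis by eventually_elim (use A True in \<open>auto simp: indicator_def\<close>)
        next
          case False
          have "indicator A (X t \<omega> - e n * t) = (indicator A (X t \<omega> - 0 * t) :: real)" for n
          proof -
            have "0 < e n * t" using e(1)[of n] t by simp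
            then show ?thesis using A False by (auto simp: indicator_def)
          qed
          then show ?thesis by simp
        qed
      qed
    qed (use t lim in auto)
  qed
qed (use e in \<open>auto intro: less_imp_le\<close>)

text \<open>
  The sum is the integral of the step function that takes its value at the right end of each cell.  The right ends
  converge to \<open>t\<close> from the right, and the indicator converges almost surely, because \<open>X t - e * t\<close> avoids \<open>0\<close>.
\<close>

lemma exponent_grid_limit:
  assumes A: "A = {0<..} \<or> A = {..0}" and ab: "Re a < 0" "Re b \<le> 0" and e: "0 \<le> e" "e \<le> 1"
    and no_atom: "AE t in lborel. 0 < t \<longrightarrow> (AE \<omega> in M. X t \<omega> \<noteq> e * t)"
  shows "(\<lambda>n. \<Sum>j. marginal A a b e (grid n (Suc j)) / real (Suc n)) \<longlonglongrightarrow> exponent A a b e"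
proof -
  have Am: "A \<in> sets borel" using A by auto
  define s where "s n t = grid n (grid_index n t)" for n t
  have s: "t \<le> s n t" if "0 < t" for n t
    using grid_index_bounds(1)[of t n] that by (simp add: s_def)
  have [measurable]: "s n \<in> borel_measurable borel" for n
    unfolding s_def[abs_def] grid_def grid_index_def by measurable
  have lim: "AE t in lborel. 0 < t \<longrightarrow> (\<lambda>n. marginal A a b e (s n t)) \<longlonglongrightarrow> marginal A a b e t"
    using no_atom
  proof eventually_elim
    case (elim t)
    show ?case
    proof
      assume t: "0 < t"
      have st: "(\<lambda>n. s n t) \<longlonglongrightarrow> t" unfolding s_def using t by (intro grid_index_tendsto) simp
      have conv: "(\<lambda>n. X (s n t) \<omega> - e * s n t) \<longlonglongrightarrow> X t \<omega> - e * t" if "\<omega> \<in> space M" for \<omega>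
        by (intro tendsto_intros st cadlag_tendsto_right[OF path_cadlag[OF that]] s) (use t in auto)
      have ne: "AE \<omega> in M. X t \<omega> \<noteq> e * t" using elim t by simp
      show "(\<lambda>n. marginal A a b e (s n t)) \<longlonglongrightarrow> marginal A a b e t"
      proof (rule marginal_converges[OF A ab t _ st])
        show "0 < s n t" for n using s[OF t, of n] t by simp
        show "AE \<omega> in M. (\<lambda>n. X (s n t) \<omega> - e * s n t) \<longlonglongrightarrow> X t \<omega> - e * t"
          using conv by (intro AE_I2)
        show "AE \<omega> in M. (\<lambda>n. indicator A (X (s n t) \<omega> - e * s n t) :: real) \<longlonglongrightarrow> indicator A (X t \<omega> - e * t)"
          using ne AE_space
        proof eventually_elim
          case (elim \<omega>)
          show ?case
          proof (rule tendsto_eventually, cases "0 < X t \<omega> - e * t")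
            case True
            from order_tendstoD(1)[OF conv[OF elim(2)] True]
            show "\<forall>\<^sub>F n in sequentially. indicator A (X (s n t) \<omega> - e * s n t) = (indicator A (X t \<omega> - e * t) :: real)"
              by eventually_elim (use A True in \<open>auto simp: indicator_def\<close>)
          next
            case False
            then have "X t \<omega> - e * t < 0" using elim(1) by auto
            from order_tendstoD(2)[OF conv[OF elim(2)] this]
            show "\<forall>\<^sub>F n in sequentially. indicator A (X (s n t) \<omega> - e * s n t) = (indicator A (X t \<omega> - e * t) :: real)"
              by eventually_elim (use A False in \<open>auto simp: indicator_def\<close>)
          qed
        qed
      qed
    qed
  qed
  have L1: "(\<lambda>n. \<integral>t. indicator {0<..} t *\<^sub>R marginal A a b e (s n t) \<partial>lborel) \<longlonglongrightarrow> exponent A a b e"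
  proof (rule exponent_limit(1)[where s = s and e = "\<lambda>_. e" and e' = e, OF Am ab])
    show "t \<le> s n t" if "0 < t" for n t by (rule s[OF that])
    show "s n \<in> borel_measurable borel" for n by measurable
  qed (rule e lim)+
  have L2: "integrable lborel (\<lambda>t. indicator {0<..} t *\<^sub>R marginal A a b e (s n t))" for n
  proof (rule exponent_limit(2)[where s = s and e = "\<lambda>_. e" and e' = e, OF Am ab])
    show "t \<le> s n t" if "0 < t" for n t by (rule s[OF that])
    show "s n \<in> borel_measurable borel" for n by measurable
  qed (rule e lim)+
  have "(\<Sum>j. marginal A a b e (grid n (Suc j)) / real (Suc n)) =
      (\<integral>t. indicator {0<..} t *\<^sub>R marginal A a b e (s n t) \<partial>lborel)" for n
  proof -
    have m: "(\<lambda>t::real. nat \<lfloor>t * real (Suc n)\<rfloor>) \<in> measurable lborel (count_space UNIV)" by measurable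
    have "integrable lborel (\<lambda>t. indicator {0<..} t *\<^sub>R marginal A a b e (s n t))"
      by (rule L2)
    from integral_sums_over_index[OF this m]
    have "(\<lambda>j. \<integral>t. indicator {t. nat \<lfloor>t * real (Suc n)\<rfloor> = j} t *\<^sub>R (indicator {0<..} t *\<^sub>R marginal A a b e (s n t)) \<partial>lborel)
        sums (\<integral>t. indicator {0<..} t *\<^sub>R marginal A a b e (s n t) \<partial>lborel)" .
    moreover have "(\<integral>t. indicator {t. nat \<lfloor>t * real (Suc n)\<rfloor> = j} t *\<^sub>R (indicator {0<..} t *\<^sub>R marginal A a b e (s n t)) \<partial>lborel)
        = marginal A a b e (grid n (Suc j)) / real (Suc n)" for j
    proof -
      have iff: "nat \<lfloor>t * real (Suc n)\<rfloor> = j \<longleftrightarrow> grid n j \<le> t \<and> t < grid n (Suc j)" if "0 < t" for t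
      proof -
        have "nat \<lfloor>t * real (Suc n)\<rfloor> = j \<longleftrightarrow> \<lfloor>t * real (Suc n)\<rfloor> = int j"
          using that by (auto simp: nat_eq_iff)
        also have "\<dots> \<longleftrightarrow> real j \<le> t * real (Suc n) \<and> t * real (Suc n) < real j + 1"
          by (simp add: floor_eq_iff)
        also have "\<dots> \<longleftrightarrow> grid n j \<le> t \<and> t < grid n (Suc j)"
          unfolding grid_def by (simp add: pos_divide_le_eq pos_less_divide_eq add.commute del: of_nat_Suc) (simp add: add.commute)
        finally show ?thesis .
      qed
      have "(\<integral>t. indicator {t. nat \<lfloor>t * real (Suc n)\<rfloor> = j} t *\<^sub>R (indicator {0<..} t *\<^sub>R marginal A a b e (s n t)) \<partial>lborel)
          = (\<integral>t. indicator {grid n j..<grid n (Suc j)} t *\<^sub>R marginal A a b e (grid n (Suc j)) \<partial>lborel)"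
      proof (rule integral_cong_AE)
        have "AE t in lborel. t \<noteq> (0::real)" by (rule AE_lborel_singleton)
        then show "AE t in lborel. indicator {t. nat \<lfloor>t * real (Suc n)\<rfloor> = j} t *\<^sub>R (indicator {0<..} t *\<^sub>R marginal A a b e (s n t))
          = indicator {grid n j..<grid n (Suc j)} t *\<^sub>R marginal A a b e (grid n (Suc j))"
        proof eventually_elim
          case (elim t)
          show ?case
          proof (cases "0 < t")
            case True
            then show ?thesis using iff[OF True] by (auto simp: indicator_def s_def grid_index_def)
          next
            case False
            then have "\<not> grid n j \<le> t" using elim grid_nonneg[of n j] by linarith
            then show ?thesis using False by simp
          qed
        qed
      qed (use Am in measurable)
      also have "\<dots> = (grid n (Suc j) - grid n j) *\<^sub>R marginal A a b e (grid n (Suc j))"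
        using grid_mono[of j "Suc j" n] by simp
      also have "\<dots> = marginal A a b e (grid n (Suc j)) / real (Suc n)"
        by (simp add: grid_def scaleR_conv_of_real diff_divide_distrib[symmetric])
      finally show ?thesis .
    qed
    ultimately show ?thesis by (simp add: sums_iff)
  qed
  moreover have "(\<lambda>n. \<integral>t. indicator {0<..} t *\<^sub>R marginal A a b e (s n t) \<partial>lborel) \<longlonglongrightarrow> exponent A a b e"
    by (rule L1)
  ultimately show ?thesis by simp
qed

text \<open>
  For fixed \<open>t > 0\<close> and \<open>\<omega>\<close> the equation \<open>X t \<omega> = e * t\<close> excludes a single slope.  By Fubini almost every
  slope is admissible, in particular arbitrarily small ones.
\<close>

lemma slopes_without_atoms:
  obtains e where "\<And>k::nat. 0 < e k" "\<And>k. e k \<le> 1" "e \<longlonglongrightarrow> 0"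
    "\<And>k. AE t in lborel. 0 < t \<longrightarrow> (AE \<omega> in M. X t \<omega> \<noteq> e k * t)"
proof -
  interpret LM: pair_sigma_finite lborel M ..
  interpret LP: pair_sigma_finite lborel "lborel \<Otimes>\<^sub>M M"
    by (intro pair_sigma_finite.intro lborel.sigma_finite_measure_axioms LM.sigma_finite_measure_axioms)
  define Q where "Q e p \<longleftrightarrow> (0 < fst p \<longrightarrow> X (max 0 (fst p)) (snd p) \<noteq> e * fst p)" for e and p :: "real \<times> 'w"
  have [measurable]: "{x \<in> space (lborel \<Otimes>\<^sub>M (lborel \<Otimes>\<^sub>M M)). Q (fst x) (snd x)} \<in> sets (lborel \<Otimes>\<^sub>M (lborel \<Otimes>\<^sub>M M))"
    unfolding Q_def by measurable
  have "AE e in lborel. AE p in lborel \<Otimes>\<^sub>M M. Q e p"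
  proof (subst LP.AE_commute)
    show "AE p in lborel \<Otimes>\<^sub>M M. AE e in lborel. Q e p"
    proof (rule always_eventually, rule allI)
      fix p :: "real \<times> 'w"
      show "AE e in lborel. Q e p"
      proof (cases "0 < fst p")
        case True
        have "AE e in lborel. e \<noteq> X (max 0 (fst p)) (snd p) / fst p" by (rule AE_lborel_singleton)
        then show ?thesis by eventually_elim (use True in \<open>auto simp: Q_def field_simps\<close>)
      qed (simp add: Q_def)
    qed
  qed measurable
  moreover have "(AE t in lborel. 0 < t \<longrightarrow> (AE \<omega> in M. X t \<omega> \<noteq> e * t))" if "AE p in lborel \<Otimes>\<^sub>M M. Q e p" for e
  proof -
    from LM.AE_pair[OF that] have "AE t in lborel. AE \<omega> in M. Q e (t, \<omega>)" .
    then show ?thesis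
      by eventually_elim (auto simp: Q_def max_def)
  qed
  ultimately have ae: "AE e in lborel. AE t in lborel. 0 < t \<longrightarrow> (AE \<omega> in M. X t \<omega> \<noteq> e * t)"
    by (rule eventually_mono)
  have ex: "\<exists>e. 0 < e \<and> e \<le> 1 / real (Suc k) \<and> (AE t in lborel. 0 < t \<longrightarrow> (AE \<omega> in M. X t \<omega> \<noteq> e * t))" for k
  proof (rule ccontr)
    assume no: "\<not> ?thesis"
    have "AE e in lborel. e \<notin> {0<..<1 / real (Suc k)}"
      using ae by eventually_elim (use no in auto)
    moreover have "(AE e in lborel. e \<notin> {0<..<1 / real (Suc k)}) \<longleftrightarrow> emeasure lborel {0<..<1 / real (Suc k)} = 0"
      by (rule AE_iff_measurable) auto
    ultimately have "emeasure lborel {0<..<1 / real (Suc k)} = 0" by simp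
    then have "measure lborel {0<..<1 / real (Suc k)} = 0" by (simp only: measure_def enn2real_0)
    moreover have "measure lborel {0<..<1 / real (Suc k)} = 1 / real (Suc k) - 0"
      by (rule measure_lborel_Ioo) simp
    ultimately show False by simp
  qed
  from choice[OF allI[OF ex]] obtain e where "\<forall>k. 0 < e k \<and> e k \<le> 1 / real (Suc k) \<and>
    (AE t in lborel. 0 < t \<longrightarrow> (AE \<omega> in M. X t \<omega> \<noteq> e k * t))" ..
  then have e: "\<And>k. 0 < e k" "\<And>k. e k \<le> 1 / real (Suc k)"
    "\<And>k. AE t in lborel. 0 < t \<longrightarrow> (AE \<omega> in M. X t \<omega> \<noteq> e k * t)" by auto
  show ?thesis
  proof (rule that[OF e(1) _ _ e(3)])
    show "e k \<le> 1" for k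
      by (rule order_trans[OF e(2)]) (simp add: divide_le_eq)
    show "e \<longlonglongrightarrow> 0"
      by (rule squeeze_right) (use e(1,2) in \<open>auto intro: less_imp_le\<close>)
  qed
qed

end

section \<open>Factorisation at the first maximum up to an exponential time\<close>

context random_walk
begin

lemma norm_asc_le_const:
  assumes "\<And>x. norm (f x) \<le> B" shows "norm (asc n f) \<le> B"
proof -
  have "0 \<le> B" using order_trans[OF norm_ge_zero assms] .
  then have "norm (asc n f) \<le> (\<integral>\<omega>. B \<partial>S)"
    unfolding asc_def using assms by (intro norm_integral_le) auto
  then show ?thesis by (simp add: P.prob_space)
qed

lemma norm_low_le_const:
  assumes "\<And>x. norm (f x) \<le> B" shows "norm (low n f) \<le> B"
proof -
  have "0 \<le> B" using order_trans[OF norm_ge_zero assms] .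
  then have "norm (low n f) \<le> (\<integral>\<omega>. B \<partial>S)"
    unfolding low_def using assms by (intro norm_integral_le) auto
  then show ?thesis by (simp add: P.prob_space)
qed

text \<open>
  The test function may depend on the index, which records the time.
\<close>

definition asc_gen :: "real \<Rightarrow> (nat \<Rightarrow> real \<Rightarrow> complex) \<Rightarrow> complex" where
  "asc_gen p F = (\<Sum>k. asc k (F k) * of_real p ^ k)"

definition low_gen :: "real \<Rightarrow> (nat \<Rightarrow> real \<Rightarrow> complex) \<Rightarrow> complex" where
  "low_gen p F = (\<Sum>k. low k (F k) * of_real p ^ k)"

lemma first_argmax_measurable [measurable]:
  "(\<lambda>\<omega>. first_argmax (walk \<omega>) m) \<in> measurable S (count_space UNIV)"
proof (subst measurable_count_space_eq2_countable, safe)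
  fix k
  have "(\<lambda>\<omega>. first_argmax (walk \<omega>) m) -` {k} \<inter> space S =
      {\<omega> \<in> space S. k \<le> m \<and> strict_ladder k \<omega> \<and> stays_nonpos (m - k) (later_steps k \<omega>)}"
    using first_argmax_walk_eq_iff[of _ m k] by blast
  also have "\<dots> \<in> sets S" by measurable
  finally show "(\<lambda>\<omega>. first_argmax (walk \<omega>) m) -` {k} \<inter> space S \<in> sets S" .
qed auto

lemma argmax_measurable [measurable]:
  fixes F G :: "nat \<Rightarrow> real \<Rightarrow> complex"
  assumes [measurable]: "\<And>k. F k \<in> borel_measurable borel" "\<And>k. G k \<in> borel_measurable borel"
  shows "(\<lambda>\<omega>. F (first_argmax (walk \<omega>) m) (walk \<omega> (first_argmax (walk \<omega>) m)) *
      G (m - first_argmax (walk \<omega>) m) (walk \<omega> m - walk \<omega> (first_argmax (walk \<omega>) m))) \<in> borel_measurable S"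
  by (rule measurable_compose_countable[where f = "\<lambda>k \<omega>. F k (walk \<omega> k) * G (m - k) (walk \<omega> m - walk \<omega> k)"]) measurable

text \<open>
  Weighting by powers of \<open>p\<close> turns the convolution of \<open>argmax_factorization\<close> into a Cauchy product.  The geometric
  variable takes values in \<open>{1..}\<close>, so that the term of index \<open>0\<close> is subtracted.
\<close>

lemma geometric_factorization:
  fixes F G :: "nat \<Rightarrow> real \<Rightarrow> complex"
  assumes [measurable]: "\<And>k. F k \<in> borel_measurable borel" "\<And>k. G k \<in> borel_measurable borel"
    and F: "\<And>k x. norm (F k x) \<le> B" and G: "\<And>k x. norm (G k x) \<le> C" and p: "0 < p" "p < 1"
  shows "(\<lambda>j. of_real ((1 - p) * p ^ j) * (\<integral>\<omega>. F (first_argmax (walk \<omega>) (Suc j)) (walk \<omega> (first_argmax (walk \<omega>) (Suc j))) *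
      G (Suc j - first_argmax (walk \<omega>) (Suc j)) (walk \<omega> (Suc j) - walk \<omega> (first_argmax (walk \<omega>) (Suc j))) \<partial>S))
    sums (of_real ((1 - p) / p) * (asc_gen p F * low_gen p G - F 0 0 * G 0 0))"
proof -
  have sF: "summable (\<lambda>k. norm (asc k (F k) * of_real p ^ k))"
    by (rule summable_comparison_test'[of "\<lambda>k. B * p ^ k" 0])
       (use p norm_asc_le_const[OF F] in \<open>auto intro!: summable_mult simp: norm_mult norm_power mult_right_mono\<close>)
  have sG: "summable (\<lambda>k. norm (low k (G k) * of_real p ^ k))"
    by (rule summable_comparison_test'[of "\<lambda>k. C * p ^ k" 0])
       (use p norm_low_le_const[OF G] in \<open>auto intro!: summable_mult simp: norm_mult norm_power mult_right_mono\<close>)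
  define I where "I n = (\<integral>\<omega>. F (first_argmax (walk \<omega>) n) (walk \<omega> (first_argmax (walk \<omega>) n)) *
      G (n - first_argmax (walk \<omega>) n) (walk \<omega> n - walk \<omega> (first_argmax (walk \<omega>) n)) \<partial>S)" for n
  have I: "I n = (\<Sum>k\<le>n. asc k (F k) * low (n - k) (G (n - k)))" for n
    unfolding I_def by (rule argmax_factorization[OF _ _ F G]) auto
  have "(\<lambda>n. \<Sum>k\<le>n. (asc k (F k) * of_real p ^ k) * (low (n - k) (G (n - k)) * of_real p ^ (n - k)))
      sums (asc_gen p F * low_gen p G)"
    unfolding asc_gen_def low_gen_def by (rule Cauchy_product_sums[OF sF sG])
  moreover have "(\<Sum>k\<le>n. (asc k (F k) * of_real p ^ k) * (low (n - k) (G (n - k)) * of_real p ^ (n - k))) = I n * of_real p ^ n" for n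
    unfolding I sum_distrib_right
  proof (rule sum.cong[OF refl])
    fix k assume "k \<in> {..n}"
    then have "of_real p ^ n = (of_real p ^ k * of_real p ^ (n - k) :: complex)"
      by (simp add: power_add[symmetric])
    then show "(asc k (F k) * of_real p ^ k) * (low (n - k) (G (n - k)) * of_real p ^ (n - k)) =
        asc k (F k) * low (n - k) (G (n - k)) * of_real p ^ n" by simp
  qed
  ultimately have "(\<lambda>n. I n * of_real p ^ n) sums (asc_gen p F * low_gen p G)" by simp
  then have "(\<lambda>n. I (Suc n) * of_real p ^ Suc n) sums (asc_gen p F * low_gen p G - I 0)"
    using sums_Suc_iff[of "\<lambda>n. I n * of_real p ^ n" "asc_gen p F * low_gen p G - I 0"] by simp
  moreover have "I 0 = F 0 0 * G 0 0" using I[of 0] by simp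
  ultimately have "(\<lambda>n. of_real ((1 - p) / p) * (I (Suc n) * of_real p ^ Suc n)) sums
      (of_real ((1 - p) / p) * (asc_gen p F * low_gen p G - F 0 0 * G 0 0))"
    by (intro sums_mult) simp
  moreover have "of_real ((1 - p) / p) * (I (Suc n) * of_real p ^ Suc n) = of_real ((1 - p) * p ^ n) * I (Suc n)" for n
    using p by simp
  ultimately show ?thesis by (simp add: I_def)
qed

text \<open>
  The case of constant functions, in which the left-hand side of the factorisation is a total probability.
\<close>

lemma gen_one:
  assumes p: "0 < p" "p < 1"
  shows "asc_gen p (\<lambda>_ _. 1) * low_gen p (\<lambda>_ _. 1) = of_real (1 / (1 - p))"
proof -
  have "(\<lambda>j. complex_of_real ((1 - p) * p ^ j) * 1)
    sums (of_real ((1 - p) / p) * (asc_gen p (\<lambda>_ _. 1) * low_gen p (\<lambda>_ _. 1) - 1))"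
    using geometric_factorization[of "\<lambda>_ _. 1" "\<lambda>_ _. 1" 1 1 p] p by (simp add: P.prob_space)
  moreover have "(\<lambda>j. complex_of_real ((1 - p) * p ^ j)) sums of_real ((1 - p) * (1 / (1 - p)))"
    unfolding sums_of_real_iff by (intro sums_mult geometric_sums) (use p in auto)
  ultimately have "of_real ((1 - p) / p) * (asc_gen p (\<lambda>_ _. 1) * low_gen p (\<lambda>_ _. 1) - 1) = (1 :: complex)"
    using sums_unique2 p by fastforce
  then have "asc_gen p (\<lambda>_ _. 1) * low_gen p (\<lambda>_ _. 1) = 1 + of_real p / of_real (1 - p)"
    using p by (simp add: field_simps)
  also have "\<dots> = of_real (1 / (1 - p))" using p by (simp add: field_simps)
  finally show ?thesis .
qed

end

lemma grid_0 [simp]: "grid n 0 = 0" by (simp add: grid_def)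

lemma grid_Suc: "grid n (Suc k) = grid n k + grid n 1"
  by (simp add: grid_def add_divide_distrib)

context levy
begin

definition steps :: "nat \<Rightarrow> real \<Rightarrow> 'w \<Rightarrow> nat \<Rightarrow> real" where
  "steps n e \<omega> i = X (grid n (Suc i)) \<omega> - X (grid n i) \<omega> - e * grid n 1"

text \<open>
  The tilt is absorbed into the steps, so that the tilted path on the grid is again a random walk.
\<close>

definition step_law :: "nat \<Rightarrow> real \<Rightarrow> real measure" where
  "step_law n e = distr M borel (\<lambda>\<omega>. X (grid n 1) \<omega> - e * grid n 1)"

lemma walk_steps:
  assumes "\<omega> \<in> space M" shows "walk (steps n e \<omega>) = tilted (\<lambda>t. X t \<omega>) e n"
proof
  fix k show "walk (steps n e \<omega>) k = tilted (\<lambda>t. X t \<omega>) e n k"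
  proof (induction k)
    case 0 show ?case using assms by (simp add: tilted_def)
  next
    case (Suc k)
    have "walk (steps n e \<omega>) (Suc k) = walk (steps n e \<omega>) k + steps n e \<omega> k" by (simp add: walk_def)
    then show ?case
      unfolding Suc.IH using steps_def[of n e \<omega> k] grid_Suc[of n k] by (simp add: tilted_def algebra_simps)
  qed
qed

sublocale W: random_walk "step_law n e" for n e
proof (rule random_walk.intro)
  show "prob_space (step_law n e)" unfolding step_law_def by (rule prob_space_distr) measurable
qed (simp add: step_law_def)

lemma steps_measurable [measurable]: "(\<lambda>\<omega>. steps n e \<omega> i) \<in> borel_measurable M"
  unfolding steps_def by measurable

lemma indep_steps: "indep_vars (\<lambda>_. borel) (\<lambda>i \<omega>. steps n e \<omega> i) UNIV"
proof -
  have "indep_sets (\<lambda>i. {(\<lambda>\<omega>. steps n e \<omega> i) -` A \<inter> space M | A. A \<in> sets borel}) J"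
    if J: "finite J" for J
  proof -
    obtain m where m: "J \<subseteq> {..<m}" using J finite_nat_bounded by blast
    have "indep_vars (\<lambda>_. borel) (\<lambda>i \<omega>. X (grid n (Suc i)) \<omega> - X (grid n i) \<omega>) {..<m}"
      by (rule indep_increments) (auto intro: grid_mono)
    then have "indep_vars (\<lambda>_. borel) (\<lambda>i \<omega>. (\<lambda>x. x - e * grid n 1) (X (grid n (Suc i)) \<omega> - X (grid n i) \<omega>)) {..<m}"
      by (rule indep_vars_compose2) measurable
    then have "indep_sets (\<lambda>i. {(\<lambda>\<omega>. steps n e \<omega> i) -` A \<inter> space M | A. A \<in> sets borel}) {..<m}"
      unfolding indep_vars_def2 steps_def by simp
    then show ?thesis using m by (rule indep_sets_mono_index[rotated])
  qed
  then show ?thesis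
    unfolding indep_vars_def2 by (subst indep_sets_finite_index_sets) auto
qed

lemma distr_steps: "distr M (\<Pi>\<^sub>M i\<in>UNIV. borel) (steps n e) = (\<Pi>\<^sub>M i\<in>UNIV. step_law n e)"
proof -
  have "distr M (\<Pi>\<^sub>M i\<in>UNIV. borel) (\<lambda>\<omega>. \<lambda>i\<in>UNIV. steps n e \<omega> i) =
      (\<Pi>\<^sub>M i\<in>UNIV. distr M borel (\<lambda>\<omega>. steps n e \<omega> i))"
    using indep_steps by (subst indep_vars_iff_distr_eq_PiM[symmetric]) auto
  moreover have "distr M borel (\<lambda>\<omega>. steps n e \<omega> i) = step_law n e" for i
  proof -
    have "distr M borel (\<lambda>\<omega>. steps n e \<omega> i) =
        distr (distr M borel (\<lambda>\<omega>. X (grid n (Suc i)) \<omega> - X (grid n i) \<omega>)) borel (\<lambda>x. x - e * grid n 1)"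
      by (subst distr_distr) (auto simp: steps_def[abs_def] o_def)
    also have "distr M borel (\<lambda>\<omega>. X (grid n (Suc i)) \<omega> - X (grid n i) \<omega>) = distr M borel (X (grid n 1))"
      using stationary[OF grid_nonneg[of n i] grid_nonneg[of n 1]] unfolding grid_Suc[symmetric] .
    also have "distr (distr M borel (X (grid n 1))) borel (\<lambda>x. x - e * grid n 1) = step_law n e"
      unfolding step_law_def by (subst distr_distr) (auto simp: o_def)
    finally show ?thesis .
  qed
  ultimately show ?thesis by (simp add: restrict_UNIV)
qed

lemma steps_seq_measurable: "steps n e \<in> measurable M (\<Pi>\<^sub>M i\<in>UNIV. borel)"
  by (rule measurable_PiM_single') auto

lemma integral_steps:
  fixes G :: "_ \<Rightarrow> complex"
  assumes "G \<in> borel_measurable (\<Pi>\<^sub>M i\<in>UNIV. borel)"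
  shows "(\<integral>\<omega>. G (steps n e \<omega>) \<partial>M) = (\<integral>w. G w \<partial>(\<Pi>\<^sub>M i\<in>UNIV. step_law n e))"
  unfolding distr_steps[symmetric] by (rule integral_distr[OF steps_seq_measurable assms, symmetric])

lemma sets_step_space: "sets (\<Pi>\<^sub>M i\<in>UNIV. step_law n e) = sets (\<Pi>\<^sub>M i\<in>(UNIV :: nat set). borel)"
  by (rule sets_PiM_cong) (simp_all add: step_law_def)

lemma measurable_step_space: "measurable (\<Pi>\<^sub>M i\<in>UNIV. step_law n e) N = measurable (\<Pi>\<^sub>M i\<in>(UNIV :: nat set). borel) N"
  by (rule measurable_cong_sets[OF sets_step_space refl])

lemma on_set_conv:
  assumes [measurable]: "A \<in> sets borel" "f \<in> borel_measurable borel"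
  shows "W.on_set n e A k f = (\<integral>\<omega>. of_bool (X (grid n k) \<omega> - e * grid n k \<in> A) * f (X (grid n k) \<omega> - e * grid n k) \<partial>M)"
proof -
  have "W.on_set n e A k f = (\<integral>\<omega>. of_bool (walk (steps n e \<omega>) k \<in> A) * f (walk (steps n e \<omega>) k) \<partial>M)"
    unfolding W.on_set_def
    by (rule integral_steps[symmetric, where G = "\<lambda>w. of_bool (walk w k \<in> A) * f (walk w k)"])
       (unfold walk_def, measurable)
  also have "\<dots> = (\<integral>\<omega>. of_bool (X (grid n k) \<omega> - e * grid n k \<in> A) * f (X (grid n k) \<omega> - e * grid n k) \<partial>M)"
    by (rule Bochner_Integration.integral_cong) (auto simp: walk_steps tilted_def)
  finally show ?thesis .
qed

end

locale levy_exp_time = levy M X for M :: "'w measure" and X +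
  fixes T :: "'w \<Rightarrow> real" and \<theta> :: real
  assumes theta: "0 < \<theta>"
    and exp_time: "distributed M lborel T (exponential_density \<theta>)"
    and time_nonneg: "\<And>\<omega>. \<omega> \<in> space M \<Longrightarrow> 0 \<le> T \<omega>"
    and indep_time: "indep_of_process M T X"
begin

lemma T_measurable [measurable]: "T \<in> borel_measurable M"
  using distributed_measurable[OF exp_time] by simp

lemma prob_T_ge:
  assumes "0 \<le> a" shows "prob {\<omega> \<in> space M. a \<le> T \<omega>} = exp (- a * \<theta>)"
proof -
  have "emeasure M (T -` {a} \<inter> space M) = (\<integral>\<^sup>+x. ennreal (exponential_density \<theta> x) * indicator {a} x \<partial>lborel)"
    by (rule distributed_emeasure[OF exp_time]) simp
  also have "\<dots> = (\<integral>\<^sup>+x. 0 \<partial>(lborel :: real measure))"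
  proof (rule nn_integral_cong_AE)
    have "AE x in lborel. x \<noteq> a" by (rule AE_lborel_singleton)
    then show "AE x in lborel. ennreal (exponential_density \<theta> x) * indicator {a} x = 0"
      by eventually_elim simp
  qed
  finally have "AE \<omega> in M. T \<omega> \<noteq> a"
    by (intro AE_I[of _ _ "T -` {a} \<inter> space M"]) auto
  then have "prob {\<omega> \<in> space M. a \<le> T \<omega>} = prob {\<omega> \<in> space M. a < T \<omega>}"
    by (intro finite_measure_eq_AE) (auto elim!: eventually_mono)
  also have "\<dots> = exp (- a * \<theta>)" by (rule exponential_distributedD_gt[OF exp_time assms theta])
  finally show ?thesis .
qed

definition survival :: "nat \<Rightarrow> real" where "survival n = exp (- \<theta> / real (Suc n))"

lemma survival: "0 < survival n" "survival n < 1"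
  using theta by (simp_all add: survival_def field_simps)

lemma grid_index_T_measurable [measurable]:
  "(\<lambda>\<omega>. grid_index n (T \<omega>)) \<in> measurable M (count_space UNIV)"
  unfolding grid_index_def by measurable

lemma grid_index_T_eq:
  assumes "\<omega> \<in> space M"
  shows "grid_index n (T \<omega>) = Suc j \<longleftrightarrow> T \<omega> \<in> {grid n j..<grid n (Suc j)}"
proof -
  have "grid_index n (T \<omega>) = Suc j \<longleftrightarrow> \<lfloor>T \<omega> * real (Suc n)\<rfloor> = int j"
    using time_nonneg[OF assms] by (auto simp: grid_index_def nat_eq_iff)
  also have "\<dots> \<longleftrightarrow> real j \<le> T \<omega> * real (Suc n) \<and> T \<omega> * real (Suc n) < real j + 1"
    by (simp add: floor_eq_iff)
  also have "\<dots> \<longleftrightarrow> T \<omega> \<in> {grid n j..<grid n (Suc j)}"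
    unfolding grid_def by (simp add: pos_divide_le_eq pos_less_divide_eq add.commute del: of_nat_Suc) (simp add: add.commute)
  finally show ?thesis .
qed

lemma prob_grid_cell:
  "prob {\<omega> \<in> space M. T \<omega> \<in> {grid n j..<grid n (Suc j)}} = (1 - survival n) * survival n ^ j"
proof -
  have s: "exp (- grid n k * \<theta>) = survival n ^ k" for k
    unfolding survival_def exp_of_nat_mult[symmetric] by (simp add: grid_def mult_ac)
  have "{\<omega> \<in> space M. T \<omega> \<in> {grid n j..<grid n (Suc j)}} =
      {\<omega> \<in> space M. grid n j \<le> T \<omega>} - {\<omega> \<in> space M. grid n (Suc j) \<le> T \<omega>}" by auto
  also have "prob \<dots> = prob {\<omega> \<in> space M. grid n j \<le> T \<omega>} - prob {\<omega> \<in> space M. grid n (Suc j) \<le> T \<omega>}"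
    using grid_mono[of j "Suc j" n] by (intro finite_measure_Diff) auto
  also have "\<dots> = exp (- grid n j * \<theta>) - exp (- grid n (Suc j) * \<theta>)"
    by (simp only: prob_T_ge grid_nonneg)
  finally show ?thesis unfolding s by (simp add: algebra_simps)
qed

text \<open>
  Independence from the process is stated by \<open>\<sigma>\<close>-algebras, since the process takes values in another type
  than the time.
\<close>

definition process_algebra :: "'w measure" where
  "process_algebra = sigma (space M) {X t -` B \<inter> space M | t B. 0 \<le> t \<and> B \<in> sets borel}"

lemma sets_process_algebra:
  "sets process_algebra = sigma_sets (space M) {X t -` B \<inter> space M | t B. 0 \<le> t \<and> B \<in> sets borel}"
  unfolding process_algebra_def by (rule sets_measure_of) auto

lemma space_process_algebra [simp]: "space process_algebra = space M"
  unfolding process_algebra_def by (rule space_measure_of) auto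

lemma X_process_algebra: "0 \<le> t \<Longrightarrow> X t \<in> borel_measurable process_algebra"
  by (rule measurableI) (auto simp: sets_process_algebra intro!: sigma_sets.Basic)

lemma steps_process_algebra: "steps n e \<in> measurable process_algebra (\<Pi>\<^sub>M i\<in>UNIV. borel)"
proof (rule measurable_PiM_single')
  have [measurable]: "X (grid n k) \<in> borel_measurable process_algebra" for k
    by (rule X_process_algebra) simp
  show "(\<lambda>\<omega>. steps n e \<omega> i) \<in> borel_measurable process_algebra" for i
    unfolding steps_def by measurable
qed auto

text \<open>
  Only events of the exponential time occur, as the cell number is discrete.
\<close>

lemma expectation_indep:
  fixes G :: "'w \<Rightarrow> complex"
  assumes B: "B \<in> sets borel" and G: "G \<in> borel_measurable process_algebra" and bdd: "\<And>\<omega>. \<omega> \<in> space M \<Longrightarrow> norm (G \<omega>) \<le> C"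
  shows "(\<integral>\<omega>. of_bool (T \<omega> \<in> B) * G \<omega> \<partial>M) = of_real (prob {\<omega> \<in> space M. T \<omega> \<in> B}) * (\<integral>\<omega>. G \<omega> \<partial>M)"
proof -
  have ind: "indep_set (sigma_sets (space M) {T -` B \<inter> space M | B. B \<in> sets borel}) (sets process_algebra)"
    using indep_time unfolding indep_of_process_def sets_process_algebra .
  have G_vim: "G -` D \<inter> space M \<in> sets process_algebra" if "D \<in> sets borel" for D
    using measurable_sets[OF G that] by simp
  have sub: "sets process_algebra \<subseteq> sets M" using ind by (simp add: indep_sets2_eq)
  have Gm: "G \<in> borel_measurable M"
    by (rule measurableI) (use G_vim sub in auto)
  define h where "h \<omega> = (of_bool (T \<omega> \<in> B) :: complex)" for \<omega>
  have hm: "h \<in> borel_measurable M" unfolding h_def[abs_def] using B by measurable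
  have h_vim: "h -` D \<inter> space M \<in> sigma_sets (space M) {T -` B \<inter> space M | B. B \<in> sets borel}" for D
  proof -
    have "h -` D \<inter> space M = T -` ((if 1 \<in> D then B else {}) \<union> (if 0 \<in> D then - B else {})) \<inter> space M"
      by (auto simp: h_def of_bool_def split: if_splits)
    moreover have "(if 1 \<in> D then B else {}) \<union> (if 0 \<in> D then - B else {}) \<in> sets borel" using B by auto
    ultimately have "\<exists>E. h -` D \<inter> space M = T -` E \<inter> space M \<and> E \<in> sets borel"
      by (intro exI conjI)
    then show ?thesis by (intro sigma_sets.Basic) (simp only: mem_Collect_eq)
  qed
  have "indep_var borel h borel G"
    unfolding indep_var_eq
  proof (intro conjI hm Gm)
    show "indep_set (sigma_sets (space M) {h -` A \<inter> space M |A. A \<in> sets borel})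
        (sigma_sets (space M) {G -` A \<inter> space M |A. A \<in> sets borel})"
      unfolding indep_sets2_eq
    proof (intro conjI ballI)
      have 1: "sigma_sets (space M) {h -` A \<inter> space M |A. A \<in> sets borel} \<subseteq>
          sigma_sets (space M) {T -` B \<inter> space M | B. B \<in> sets borel}"
        by (rule sigma_sets_mono) (use h_vim in auto)
      have 2: "sigma_sets (space M) {G -` A \<inter> space M |A. A \<in> sets borel} \<subseteq> sets process_algebra"
        unfolding sets_process_algebra
        by (rule sigma_sets_mono) (use G_vim in \<open>auto simp: sets_process_algebra\<close>)
      note ind' = ind[unfolded indep_sets2_eq]
      show "sigma_sets (space M) {h -` A \<inter> space M |A. A \<in> sets borel} \<subseteq> events"
        "sigma_sets (space M) {G -` A \<inter> space M |A. A \<in> sets borel} \<subseteq> events"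
        using 1 2 ind' by blast+
      fix a b assume "a \<in> sigma_sets (space M) {h -` A \<inter> space M |A. A \<in> sets borel}"
        "b \<in> sigma_sets (space M) {G -` A \<inter> space M |A. A \<in> sets borel}"
      then show "prob (a \<inter> b) = prob a * prob b" using 1 2 ind' by blast
    qed
  qed
  then have "(\<integral>\<omega>. h \<omega> * G \<omega> \<partial>M) = (\<integral>\<omega>. h \<omega> \<partial>M) * (\<integral>\<omega>. G \<omega> \<partial>M)"
  proof (rule indep_var_lebesgue_integral)
    show "integrable M h" by (rule integrable_const_bound[of _ 1]) (use hm in \<open>auto simp: h_def\<close>)
    show "integrable M G" by (rule integrable_const_bound[of _ C]) (use Gm bdd in auto)
  qed
  moreover have "(\<integral>\<omega>. h \<omega> \<partial>M) = of_real (prob {\<omega> \<in> space M. T \<omega> \<in> B})"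
  proof -
    have "(\<integral>\<omega>. h \<omega> \<partial>M) = (\<integral>\<omega>. complex_of_real (indicator {\<omega> \<in> space M. T \<omega> \<in> B} \<omega>) \<partial>M)"
      by (rule Bochner_Integration.integral_cong) (auto simp: h_def)
    also have "\<dots> = of_real (prob {\<omega> \<in> space M. T \<omega> \<in> B})"
      using B by simp
    finally show ?thesis .
  qed
  ultimately show ?thesis by (simp add: h_def)
qed

text \<open>
  The number of the cell that contains the exponential time is geometric and independent of the process.
\<close>

lemma grid_expectation:
  fixes G :: "nat \<Rightarrow> (nat \<Rightarrow> real) \<Rightarrow> complex"
  assumes G: "\<And>m. G m \<in> borel_measurable (\<Pi>\<^sub>M i\<in>UNIV. borel)" and bdd: "\<And>m w. norm (G m w) \<le> C"
  shows "(\<lambda>j. of_real ((1 - survival n) * survival n ^ j) * (\<integral>w. G (Suc j) w \<partial>(\<Pi>\<^sub>M i\<in>UNIV. step_law n e)))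
    sums (\<integral>\<omega>. G (grid_index n (T \<omega>)) (steps n e \<omega>) \<partial>M)"
proof -
  define F where "F \<omega> = G (grid_index n (T \<omega>)) (steps n e \<omega>)" for \<omega>
  have "F \<in> borel_measurable M" unfolding F_def
    by (rule measurable_compose_countable[where f = "\<lambda>m \<omega>. G m (steps n e \<omega>)"])
       (use measurable_compose[OF steps_seq_measurable G] in auto)
  then have F: "integrable M F"
    by (rule integrable_const_bound[of _ C, rotated]) (use bdd in \<open>auto simp: F_def\<close>)
  \<comment> \<open>The cells are numbered from \<open>0\<close>, their right end points from \<open>1\<close>.\<close>
  have N: "(\<lambda>\<omega>. grid_index n (T \<omega>) - 1) \<in> measurable M (count_space UNIV)" by measurable
  from integral_sums_over_index[OF F N]
  have "(\<lambda>j. \<integral>\<omega>. indicator {\<omega>. grid_index n (T \<omega>) - 1 = j} \<omega> *\<^sub>R F \<omega> \<partial>M) sums (\<integral>\<omega>. F \<omega> \<partial>M)" .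
  moreover have "(\<integral>\<omega>. indicator {\<omega>. grid_index n (T \<omega>) - 1 = j} \<omega> *\<^sub>R F \<omega> \<partial>M) =
      of_real ((1 - survival n) * survival n ^ j) * (\<integral>w. G (Suc j) w \<partial>(\<Pi>\<^sub>M i\<in>UNIV. step_law n e))" for j
  proof -
    have "(\<integral>\<omega>. indicator {\<omega>. grid_index n (T \<omega>) - 1 = j} \<omega> *\<^sub>R F \<omega> \<partial>M) =
        (\<integral>\<omega>. of_bool (T \<omega> \<in> {grid n j..<grid n (Suc j)}) * G (Suc j) (steps n e \<omega>) \<partial>M)"
    proof (rule Bochner_Integration.integral_cong[OF refl])
      fix \<omega> assume \<omega>: "\<omega> \<in> space M"
      have "grid_index n (T \<omega>) - 1 = j \<longleftrightarrow> grid_index n (T \<omega>) = Suc j" by (simp add: grid_index_def)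
      then show "indicator {\<omega>. grid_index n (T \<omega>) - 1 = j} \<omega> *\<^sub>R F \<omega> =
          of_bool (T \<omega> \<in> {grid n j..<grid n (Suc j)}) * G (Suc j) (steps n e \<omega>)"
        using grid_index_T_eq[OF \<omega>, of n j] by (auto simp: F_def indicator_def)
    qed
    also have "\<dots> = of_real (prob {\<omega> \<in> space M. T \<omega> \<in> {grid n j..<grid n (Suc j)}}) * (\<integral>\<omega>. G (Suc j) (steps n e \<omega>) \<partial>M)"
      by (rule expectation_indep[where C = C])
         (use bdd measurable_compose[OF steps_process_algebra G] in auto)
    also have "\<dots> = of_real ((1 - survival n) * survival n ^ j) * (\<integral>w. G (Suc j) w \<partial>(\<Pi>\<^sub>M i\<in>UNIV. step_law n e))"
      unfolding prob_grid_cell integral_steps[OF G] ..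
    finally show ?thesis .
  qed
  ultimately show ?thesis by (simp add: F_def)
qed

definition grid_argmax :: "nat \<Rightarrow> real \<Rightarrow> 'w \<Rightarrow> nat" where
  "grid_argmax n e \<omega> = first_argmax (tilted (\<lambda>t. X t \<omega>) e n) (grid_index n (T \<omega>))"

text \<open>
  The independence of the two parts of the path, on the grid: the right-hand side is a product up to the term of
  index \<open>0\<close>.
\<close>

lemma discrete_factorization:
  fixes F G :: "nat \<Rightarrow> real \<Rightarrow> complex"
  assumes [measurable]: "\<And>k. F k \<in> borel_measurable borel" "\<And>k. G k \<in> borel_measurable borel"
    and F: "\<And>k x. norm (F k x) \<le> B" and G: "\<And>k x. norm (G k x) \<le> C"
  shows "(\<integral>\<omega>. F (grid_argmax n e \<omega>) (tilted (\<lambda>t. X t \<omega>) e n (grid_argmax n e \<omega>)) *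
      G (grid_index n (T \<omega>) - grid_argmax n e \<omega>)
        (tilted (\<lambda>t. X t \<omega>) e n (grid_index n (T \<omega>)) - tilted (\<lambda>t. X t \<omega>) e n (grid_argmax n e \<omega>)) \<partial>M)
    = of_real ((1 - survival n) / survival n) *
      (W.asc_gen n e (survival n) F * W.low_gen n e (survival n) G - F 0 0 * G 0 0)"
proof -
  define H where "H m w = F (first_argmax (walk w) m) (walk w (first_argmax (walk w) m)) *
      G (m - first_argmax (walk w) m) (walk w m - walk w (first_argmax (walk w) m))" for m w
  have H: "H m \<in> borel_measurable (\<Pi>\<^sub>M i\<in>UNIV. borel)" for m
    unfolding H_def[abs_def] measurable_step_space[symmetric, of _ n e] by (rule W.argmax_measurable) auto
  have "norm (H m w) \<le> B * C" for m w
    unfolding H_def norm_mult using order_trans[OF norm_ge_zero F] by (intro mult_mono F G) auto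
  from grid_expectation[OF H this, of n e]
    W.geometric_factorization[OF assms(1,2) F G survival(1,2)[of n], of n e]
  have "(\<integral>\<omega>. H (grid_index n (T \<omega>)) (steps n e \<omega>) \<partial>M) = of_real ((1 - survival n) / survival n) *
      (W.asc_gen n e (survival n) F * W.low_gen n e (survival n) G - F 0 0 * G 0 0)"
    unfolding H_def by (rule sums_unique2)
  moreover have "(\<integral>\<omega>. H (grid_index n (T \<omega>)) (steps n e \<omega>) \<partial>M) =
    (\<integral>\<omega>. F (grid_argmax n e \<omega>) (tilted (\<lambda>t. X t \<omega>) e n (grid_argmax n e \<omega>)) *
      G (grid_index n (T \<omega>) - grid_argmax n e \<omega>)
        (tilted (\<lambda>t. X t \<omega>) e n (grid_index n (T \<omega>)) - tilted (\<lambda>t. X t \<omega>) e n (grid_argmax n e \<omega>)) \<partial>M)"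
    by (rule Bochner_Integration.integral_cong) (auto simp: H_def walk_steps grid_argmax_def)
  ultimately show ?thesis by simp
qed

end

section \<open>Dominated convergence and continuous test functions\<close>

text \<open>
  Dominated convergence concerns sequences, hence the two limits are taken in turn.  For fixed \<open>k\<close> the upper
  limit over \<open>n\<close> passes through the integral by the reverse lemma of Fatou; the resulting functions tend to \<open>0\<close> in
  \<open>k\<close> and are dominated.
\<close>

lemma iterated_dominated_convergence:
  fixes F :: "nat \<Rightarrow> nat \<Rightarrow> 'a \<Rightarrow> complex"
  assumes M: "finite_measure M"
    and F[measurable]: "\<And>k n. F k n \<in> borel_measurable M" and f[measurable]: "f \<in> borel_measurable M"
    and bdd: "\<And>k n \<omega>. \<omega> \<in> space M \<Longrightarrow> norm (F k n \<omega>) \<le> B"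
    and lim: "\<And>\<omega>. \<omega> \<in> space M \<Longrightarrow> ((\<lambda>(k, n). F k n \<omega>) \<longlongrightarrow> f \<omega>) iterated"
  shows "((\<lambda>(k, n). \<integral>\<omega>. F k n \<omega> \<partial>M) \<longlongrightarrow> (\<integral>\<omega>. f \<omega> \<partial>M)) iterated"
proof -
  interpret finite_measure M by (rule M)
  define d where "d k n \<omega> = ennreal (norm (F k n \<omega> - f \<omega>))" for k n \<omega>
  \<comment> \<open>The distance to the limit that remains after the inner limit.\<close>
  define H where "H k \<omega> = limsup (\<lambda>n. d k n \<omega>)" for k \<omega>
  have [measurable]: "d k n \<in> borel_measurable M" for k n unfolding d_def[abs_def] by measurable
  have [measurable]: "H k \<in> borel_measurable M" for k unfolding H_def[abs_def] by measurable
  have fb: "norm (f \<omega>) \<le> B" if "\<omega> \<in> space M" for \<omega>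
    by (rule tendsto_upperbound[OF tendsto_norm[OF lim[OF that]]])
       (use bdd[OF that] in \<open>auto intro!: always_eventually\<close>)
  have db: "d k n \<omega> \<le> ennreal (2 * B)" if "\<omega> \<in> space M" for k n \<omega>
  proof -
    have "norm (F k n \<omega> - f \<omega>) \<le> norm (F k n \<omega>) + norm (f \<omega>)" by (rule norm_triangle_ineq4)
    also have "\<dots> \<le> 2 * B" using bdd[OF that, of k n] fb[OF that] by simp
    finally show ?thesis unfolding d_def by (rule ennreal_leI)
  qed
  have Hb: "H k \<omega> \<le> ennreal (2 * B)" if "\<omega> \<in> space M" for k \<omega>
    unfolding H_def by (rule Limsup_bounded) (use db[OF that] in auto)
  have w: "(\<integral>\<^sup>+\<omega>. ennreal (2 * B) \<partial>M) < \<infinity>"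
  proof -
    have "emeasure M (space M) < \<infinity>" by (simp add: less_top[symmetric])
    then show ?thesis by (simp add: ennreal_mult_less_top)
  qed
  have iF: "integrable M (F k n)" for k n
    by (rule integrable_const_bound[of _ B]) (use bdd in auto)
  have intf: "integrable M f" by (rule integrable_const_bound[of _ B]) (use fb in auto)
  have H0: "(\<lambda>k. H k \<omega>) \<longlonglongrightarrow> 0" if \<omega>: "\<omega> \<in> space M" for \<omega>
  proof (rule order_tendstoI)
    fix a :: ennreal assume a: "0 < a"
    obtain r where r: "0 < r" "ennreal r < a"
    proof -
      obtain b where b: "0 < b" "b < a" using dense[OF a] by blast
      then have "b = ennreal (enn2real b)" "0 < enn2real b"
        by (auto simp: enn2real_positive_iff less_top[symmetric] ennreal_enn2real_if)
      with b that show ?thesis by metis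
    qed
    have "\<forall>\<^sub>F p in iterated. dist (case p of (k, n) \<Rightarrow> F k n \<omega>) (f \<omega>) < r"
      using tendstoD[OF lim[OF \<omega>] r(1)] .
    then show "\<forall>\<^sub>F k in sequentially. H k \<omega> < a"
      unfolding eventually_iterated
    proof eventually_elim
      case (elim k)
      have "H k \<omega> \<le> ennreal r"
        unfolding H_def
        by (rule Limsup_bounded) (use elim in \<open>auto elim!: eventually_mono simp: d_def dist_norm intro!: ennreal_leI\<close>)
      with r show ?case by simp
    qed
  qed auto
  have "(\<lambda>k. \<integral>\<^sup>+\<omega>. H k \<omega> \<partial>M) \<longlonglongrightarrow> (\<integral>\<^sup>+\<omega>. 0 \<partial>M)"
    by (rule nn_integral_dominated_convergence[where w = "\<lambda>_. ennreal (2 * B)"]) (use Hb H0 w in auto)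
  then have IH: "(\<lambda>k. \<integral>\<^sup>+\<omega>. H k \<omega> \<partial>M) \<longlonglongrightarrow> 0" by simp
  show ?thesis
  proof (rule tendstoI)
    fix r :: real assume r: "0 < r"
    have "\<forall>\<^sub>F k in sequentially. (\<integral>\<^sup>+\<omega>. H k \<omega> \<partial>M) < ennreal r"
      using order_tendstoD(2)[OF IH] r by simp
    then show "\<forall>\<^sub>F p in iterated. dist (case p of (k, n) \<Rightarrow> \<integral>\<omega>. F k n \<omega> \<partial>M) (\<integral>\<omega>. f \<omega> \<partial>M) < r"
      unfolding eventually_iterated
    proof eventually_elim
      case (elim k)
      have "limsup (\<lambda>n. \<integral>\<^sup>+\<omega>. d k n \<omega> \<partial>M) \<le> (\<integral>\<^sup>+\<omega>. H k \<omega> \<partial>M)"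
        unfolding H_def by (rule nn_integral_limsup[where w = "\<lambda>_. ennreal (2 * B)"]) (use db w in auto)
      also note elim
      finally have "\<forall>\<^sub>F n in sequentially. (\<integral>\<^sup>+\<omega>. d k n \<omega> \<partial>M) < ennreal r" by (rule Limsup_lessD)
      then show ?case
      proof eventually_elim
        case (elim n)
        have "norm ((\<integral>\<omega>. F k n \<omega> \<partial>M) - (\<integral>\<omega>. f \<omega> \<partial>M)) = norm (\<integral>\<omega>. F k n \<omega> - f \<omega> \<partial>M)"
          using iF intf by simp
        also have "\<dots> \<le> (\<integral>\<omega>. norm (F k n \<omega> - f \<omega>) \<partial>M)" by (rule integral_norm_bound)
        finally have "ennreal (norm ((\<integral>\<omega>. F k n \<omega> \<partial>M) - (\<integral>\<omega>. f \<omega> \<partial>M))) \<le> ennreal (\<integral>\<omega>. norm (F k n \<omega> - f \<omega>) \<partial>M)"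
          by (rule ennreal_leI)
        also have "\<dots> = (\<integral>\<^sup>+\<omega>. d k n \<omega> \<partial>M)"
          unfolding d_def by (rule nn_integral_eq_integral[symmetric]) (use iF intf in auto)
        also note elim
        finally show ?case using r by (simp add: dist_norm ennreal_less_iff)
      qed
    qed
  qed
qed

lemma closed_indicator_approximation:
  fixes C :: "'b::metric_space set"
  assumes "closed C"
  obtains h :: "nat \<Rightarrow> 'b \<Rightarrow> real" where "\<And>n. continuous_on UNIV (h n)" "\<And>n x. 0 \<le> h n x" "\<And>n x. h n x \<le> 1"
    "\<And>x. (\<lambda>n. h n x) \<longlonglongrightarrow> indicator C x"
proof (cases "C = {}")
  case True
  show ?thesis by (rule that[of "\<lambda>_ _. 0"]) (simp_all add: True)
next
  case False
  show ?thesis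
  proof (rule that[of "\<lambda>n x. max 0 (1 - real n * infdist x C)"])
    show "continuous_on UNIV (\<lambda>x. max 0 (1 - real n * infdist x C))" for n
      by (intro continuous_intros continuous_on_infdist)
    show "(\<lambda>n. max 0 (1 - real n * infdist x C)) \<longlonglongrightarrow> indicator C x" for x
    proof (cases "x \<in> C")
      case False
      then have "infdist x C \<noteq> 0" using in_closed_iff_infdist_zero[OF assms \<open>C \<noteq> {}\<close>] by simp
      then have pos: "0 < infdist x C" using infdist_nonneg[of x C] by linarith
      have "\<forall>\<^sub>F n in sequentially. max 0 (1 - real n * infdist x C) = 0"
      proof -
        obtain N where N: "1 < real N * infdist x C" using reals_Archimedean3[OF pos, THEN spec[of _ 1]] by auto
        have "1 < real n * infdist x C" if "N \<le> n" for n
          using N mult_right_mono[of "real N" "real n" "infdist x C"] that pos by linarith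
        then show ?thesis by (auto simp: eventually_sequentially intro!: exI[of _ N] less_imp_le)
      qed
      then show ?thesis using False by (auto intro: tendsto_eventually)
    qed simp
  qed (auto simp: infdist_nonneg)
qed

text \<open>
  Closed sets generate the Borel sets and are stable under intersections, and their indicators are limits of
  continuous functions.
\<close>

lemma measure_eqI_continuous:
  fixes \<mu> \<nu> :: "'b::metric_space measure"
  assumes \<mu>: "prob_space \<mu>" "sets \<mu> = sets borel" and \<nu>: "prob_space \<nu>" "sets \<nu> = sets borel"
    and eq: "\<And>f :: 'b \<Rightarrow> real. continuous_on UNIV f \<Longrightarrow> (\<And>x. 0 \<le> f x) \<Longrightarrow> (\<And>x. f x \<le> 1) \<Longrightarrow>
      (\<integral>x. f x \<partial>\<mu>) = (\<integral>x. f x \<partial>\<nu>)"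
  shows "\<mu> = \<nu>"
proof -
  interpret \<mu>: prob_space \<mu> by fact
  interpret \<nu>: prob_space \<nu> by fact
  have closed: "measure \<mu> C = measure \<nu> C" if C: "closed C" for C
  proof -
    obtain h :: "nat \<Rightarrow> 'b \<Rightarrow> real" where h: "\<And>n. continuous_on UNIV (h n)" "\<And>n x. 0 \<le> h n x" "\<And>n x. h n x \<le> 1"
      "\<And>x. (\<lambda>n. h n x) \<longlonglongrightarrow> indicator C x"
      using closed_indicator_approximation[OF C] by metis
    have [measurable]: "h n \<in> borel_measurable borel" for n by (rule borel_measurable_continuous_onI[OF h(1)])
    have lim: "(\<lambda>n. \<integral>x. h n x \<partial>\<rho>) \<longlonglongrightarrow> measure \<rho> C" if \<rho>: "prob_space \<rho>" and [measurable_cong]: "sets \<rho> = sets borel" for \<rho>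
    proof -
      interpret \<rho>: prob_space \<rho> by fact
      have [measurable]: "C \<in> sets \<rho>" using C that by simp
      have "(\<lambda>n. \<integral>x. h n x \<partial>\<rho>) \<longlonglongrightarrow> (\<integral>x. indicator C x \<partial>\<rho>)"
        by (rule integral_dominated_convergence[where w = "\<lambda>_. 1"]) (use h in auto)
      then show ?thesis by simp
    qed
    show ?thesis
      by (rule LIMSEQ_unique[OF lim[OF \<mu>]]) (use lim[OF \<nu>] eq[OF h(1-3)] in simp)
  qed
  show ?thesis
  proof (rule measure_eqI_generator_eq[where E = "Collect closed" and \<Omega> = UNIV and A = "\<lambda>_. UNIV"])
    show "Int_stable (Collect closed)" by (auto simp: Int_stable_def)
    show "sets \<mu> = sigma_sets UNIV (Collect closed)" "sets \<nu> = sigma_sets UNIV (Collect closed)"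
      using \<mu> \<nu> by (simp_all add: borel_eq_closed)
    fix C :: "'b set" assume "C \<in> Collect closed"
    then show "emeasure \<mu> C = emeasure \<nu> C"
      using closed by (simp add: \<mu>.emeasure_eq_measure \<nu>.emeasure_eq_measure)
  qed auto
qed

text \<open>
  Closed sets suffice for the reason given for \<open>measure_eqI_continuous\<close>.
\<close>

lemma (in prob_space) indep_varI_continuous:
  fixes Y :: "'a \<Rightarrow> 'b::metric_space" and Z :: "'a \<Rightarrow> 'b"
  assumes Y[measurable]: "Y \<in> borel_measurable M" and Z[measurable]: "Z \<in> borel_measurable M"
    and eq: "\<And>(f :: 'b \<Rightarrow> real) (g :: 'b \<Rightarrow> real). continuous_on UNIV f \<Longrightarrow> continuous_on UNIV g \<Longrightarrow>
      (\<And>x. 0 \<le> f x) \<Longrightarrow> (\<And>x. f x \<le> 1) \<Longrightarrow> (\<And>x. 0 \<le> g x) \<Longrightarrow> (\<And>x. g x \<le> 1) \<Longrightarrow>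
      (\<integral>\<omega>. f (Y \<omega>) * g (Z \<omega>) \<partial>M) = (\<integral>\<omega>. f (Y \<omega>) \<partial>M) * (\<integral>\<omega>. g (Z \<omega>) \<partial>M)"
  shows "indep_var borel Y borel Z"
proof -
  have prod: "prob ((Y -` C \<inter> space M) \<inter> (Z -` D \<inter> space M)) = prob (Y -` C \<inter> space M) * prob (Z -` D \<inter> space M)"
    if C: "closed C" and D: "closed D" for C D
  proof -
    obtain f :: "nat \<Rightarrow> 'b \<Rightarrow> real" where f: "\<And>n. continuous_on UNIV (f n)" "\<And>n x. 0 \<le> f n x" "\<And>n x. f n x \<le> 1"
      "\<And>x. (\<lambda>n. f n x) \<longlonglongrightarrow> indicator C x"
      using closed_indicator_approximation[OF C] by metis
    obtain g :: "nat \<Rightarrow> 'b \<Rightarrow> real" where g: "\<And>n. continuous_on UNIV (g n)" "\<And>n x. 0 \<le> g n x" "\<And>n x. g n x \<le> 1"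
      "\<And>x. (\<lambda>n. g n x) \<longlonglongrightarrow> indicator D x"
      using closed_indicator_approximation[OF D] by metis
    have [measurable]: "f n \<in> borel_measurable borel" "g n \<in> borel_measurable borel" for n
      by (rule borel_measurable_continuous_onI, fact)+
    have [measurable]: "C \<in> sets borel" "D \<in> sets borel" using C D by auto
    have 1: "(\<lambda>n. \<integral>\<omega>. f n (Y \<omega>) * g n (Z \<omega>) \<partial>M) \<longlonglongrightarrow> (\<integral>\<omega>. indicator C (Y \<omega>) * indicator D (Z \<omega>) \<partial>M)"
      by (rule integral_dominated_convergence[where w = "\<lambda>_. 1"])
         (use f g in \<open>auto intro!: tendsto_mult mult_le_one\<close>)
    have 2: "(\<lambda>n. \<integral>\<omega>. f n (Y \<omega>) \<partial>M) \<longlonglongrightarrow> (\<integral>\<omega>. indicator C (Y \<omega>) \<partial>M)"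
      by (rule integral_dominated_convergence[where w = "\<lambda>_. 1"]) (use f in auto)
    have 3: "(\<lambda>n. \<integral>\<omega>. g n (Z \<omega>) \<partial>M) \<longlonglongrightarrow> (\<integral>\<omega>. indicator D (Z \<omega>) \<partial>M)"
      by (rule integral_dominated_convergence[where w = "\<lambda>_. 1"]) (use g in auto)
    have "(\<lambda>n. \<integral>\<omega>. f n (Y \<omega>) * g n (Z \<omega>) \<partial>M) \<longlonglongrightarrow>
        (\<integral>\<omega>. indicator C (Y \<omega>) \<partial>M) * (\<integral>\<omega>. indicator D (Z \<omega>) \<partial>M)"
      using tendsto_mult[OF 2 3] eq[OF f(1) g(1) f(2,3) g(2,3)] by simp
    from LIMSEQ_unique[OF 1 this]
    have "(\<integral>\<omega>. indicator C (Y \<omega>) * indicator D (Z \<omega>) \<partial>M) =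
        (\<integral>\<omega>. indicator C (Y \<omega>) \<partial>M) * (\<integral>\<omega>. indicator D (Z \<omega>) \<partial>M :: real)" .
    moreover have "(\<integral>\<omega>. indicator C (Y \<omega>) * indicator D (Z \<omega>) \<partial>M) = prob ((Y -` C \<inter> space M) \<inter> (Z -` D \<inter> space M))"
    proof -
      have "(\<integral>\<omega>. indicator C (Y \<omega>) * indicator D (Z \<omega>) \<partial>M) =
          (\<integral>\<omega>. indicat_real ((Y -` C \<inter> space M) \<inter> (Z -` D \<inter> space M)) \<omega> \<partial>M)"
        by (rule Bochner_Integration.integral_cong) (auto simp: indicator_def)
      then show ?thesis by simp
    qed
    moreover have "(\<integral>\<omega>. indicator C (Y \<omega>) \<partial>M) = prob (Y -` C \<inter> space M)"
    proof -
      have "(\<integral>\<omega>. indicator C (Y \<omega>) \<partial>M) = (\<integral>\<omega>. indicat_real (Y -` C \<inter> space M) \<omega> \<partial>M)"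
        by (rule Bochner_Integration.integral_cong) (auto simp: indicator_def)
      then show ?thesis by simp
    qed
    moreover have "(\<integral>\<omega>. indicator D (Z \<omega>) \<partial>M) = prob (Z -` D \<inter> space M)"
    proof -
      have "(\<integral>\<omega>. indicator D (Z \<omega>) \<partial>M) = (\<integral>\<omega>. indicat_real (Z -` D \<inter> space M) \<omega> \<partial>M)"
        by (rule Bochner_Integration.integral_cong) (auto simp: indicator_def)
      then show ?thesis by simp
    qed
    ultimately show ?thesis by simp
  qed
  have gen: "sigma_sets (space M) {V -` A \<inter> space M |A. A \<in> sets borel} =
      sigma_sets (space M) {V -` A \<inter> space M |A. A \<in> Collect closed}" for V :: "'a \<Rightarrow> 'd::topological_space"
  proof -
    have "{V -` A \<inter> space M |A. A \<in> sets borel} = sigma_sets (space M) {V -` A \<inter> space M |A. A \<in> Collect closed}"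
      unfolding borel_eq_closed using sigma_sets_vimage_commute[of V "space M" UNIV "Collect closed"] by simp
    then show ?thesis by (simp only:) (subst sigma_sets_sigma_sets_eq, auto)
  qed
  have stable: "Int_stable {V -` A \<inter> space M |A. A \<in> Collect closed}" for V :: "'a \<Rightarrow> 'd::topological_space"
  proof (rule Int_stableI, clarsimp)
    fix A B :: "'d set" assume "closed A" "closed B"
    then show "\<exists>D. V -` A \<inter> space M \<inter> (V -` B \<inter> space M) = V -` D \<inter> space M \<and> closed D"
      by (intro exI[of _ "A \<inter> B"]) auto
  qed
  show ?thesis
    unfolding indep_var_eq gen
  proof (intro conjI Y Z indep_set_sigma_sets stable)
    show "indep_set {Y -` A \<inter> space M |A. A \<in> Collect closed} {Z -` A \<inter> space M |A. A \<in> Collect closed}"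
      unfolding indep_sets2_eq using prod by (auto intro!: measurable_sets[OF Y] measurable_sets[OF Z])
  qed
qed

section \<open>The identity of Spitzer on the grid\<close>

context levy
begin

text \<open>
  At a grid point, \<open>phi_integrand\<close> is the difference of two coefficients of series in the identity of Spitzer, the first
  of them with the argument \<open>exp (- 1 / (n+1))\<close> for all \<open>a\<close> and \<open>b\<close>.
\<close>

lemma marginal_grid:
  assumes A[measurable]: "A \<in> sets borel" and f[measurable]: "f \<in> borel_measurable borel"
    and f_eq: "\<And>x. x \<in> A \<Longrightarrow> f x = exp (b * of_real \<bar>x\<bar>)" and b: "Re b \<le> 0"
  shows "marginal A a b e (grid n (Suc k)) / of_real (real (Suc n)) =
    (W.on_set n e A (Suc k) (\<lambda>_. 1) * exp (- 1 / of_nat (Suc n)) ^ Suc k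
     - W.on_set n e A (Suc k) f * exp (a / of_nat (Suc n)) ^ Suc k) / of_nat (Suc k)"
proof -
  let ?t = "grid n (Suc k)"
  have t: "0 < ?t" by (simp add: grid_def)
  have fb: "norm (f x) \<le> 1" if "x \<in> A" for x using b that by (simp add: f_eq mult_nonpos_nonneg)
  define u where "u \<omega> = (of_bool (X ?t \<omega> - e * ?t \<in> A) :: complex)" for \<omega>
  define w where "w \<omega> = of_bool (X ?t \<omega> - e * ?t \<in> A) * f (X ?t \<omega> - e * ?t)" for \<omega>
  have iu: "integrable M u" by (rule integrable_const_bound[of _ 1]) (auto simp: u_def[abs_def])
  have iw: "integrable M w"
    by (rule integrable_const_bound[of _ 1]) (use fb in \<open>auto simp: w_def[abs_def]\<close>)
  have exp_grid: "exp (z / of_nat (Suc n)) ^ Suc k = exp (z * of_real ?t)" for z :: complex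
    unfolding exp_of_nat_mult[symmetric] by (simp add: grid_def mult.commute)
  have "marginal A a b e ?t = (\<integral>\<omega>. (u \<omega> * exp (- of_real ?t) - w \<omega> * exp (a * of_real ?t)) / of_real ?t \<partial>M)"
    unfolding marginal_def
    by (rule Bochner_Integration.integral_cong)
       (use t in \<open>auto simp: u_def w_def phi_integrand_def f_eq exp_add indicator_def max_def mult.commute\<close>)
  also have "\<dots> = ((\<integral>\<omega>. u \<omega> \<partial>M) * exp (- of_real ?t) - (\<integral>\<omega>. w \<omega> \<partial>M) * exp (a * of_real ?t)) / of_real ?t"
    using iu iw by simp
  also have "(\<integral>\<omega>. u \<omega> \<partial>M) = W.on_set n e A (Suc k) (\<lambda>_. 1)"
    by (subst on_set_conv) (auto simp: u_def[abs_def])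
  also have "(\<integral>\<omega>. w \<omega> \<partial>M) = W.on_set n e A (Suc k) f"
    by (subst on_set_conv) (auto simp: w_def[abs_def])
  also have "exp (- complex_of_real ?t) = exp (- 1 / of_nat (Suc n)) ^ Suc k" unfolding exp_grid by simp
  also have "exp (a * complex_of_real ?t) = exp (a / of_nat (Suc n)) ^ Suc k" unfolding exp_grid ..
  finally show ?thesis by (simp add: grid_def field_simps del: of_nat_Suc power_Suc)
qed

text \<open>
  The exponent in the identity of Spitzer is a Riemann sum up to a term independent of \<open>a\<close> and \<open>b\<close>, which cancels
  in quotients.
\<close>

lemma spitzer_exponent:
  assumes A: "A \<in> sets borel" and f: "f \<in> borel_measurable borel"
    and f_eq: "\<And>x. x \<in> A \<Longrightarrow> f x = exp (b * of_real \<bar>x\<bar>)" and a: "Re a < 0" and b: "Re b \<le> 0"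
  shows "(\<Sum>k. W.on_set n e A (Suc k) f * exp (a / of_nat (Suc n)) ^ Suc k / of_nat (Suc k)) =
    (\<Sum>k. W.on_set n e A (Suc k) (\<lambda>_. 1) * exp (- 1 / of_nat (Suc n)) ^ Suc k / of_nat (Suc k))
     - (\<Sum>k. marginal A a b e (grid n (Suc k)) / of_real (real (Suc n)))"
proof -
  have fb: "norm (f x) \<le> 1" if "x \<in> A" for x using b that by (simp add: f_eq mult_nonpos_nonneg)
  have sm: "summable (\<lambda>k. c (Suc k) * exp (z / of_nat (Suc n)) ^ Suc k / of_nat (Suc k))"
    if c: "\<And>k. norm (c k) \<le> 1" and z: "Re z < 0" for c :: "nat \<Rightarrow> complex" and z :: complex
  proof (rule summable_comparison_test'[of "\<lambda>k. norm (exp (z / of_nat (Suc n))) ^ Suc k" 0])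
    have "Re (z / of_nat (Suc n)) < 0"
      using z by (simp add: Re_divide_of_nat divide_neg_pos del: of_nat_Suc)
    then show "summable (\<lambda>k. norm (exp (z / of_nat (Suc n))) ^ Suc k)"
      by (subst summable_Suc_iff) (simp add: summable_geometric)
    fix k
    let ?r = "norm (exp (z / of_nat (Suc n))) ^ Suc k"
    have "norm (c (Suc k) * exp (z / of_nat (Suc n)) ^ Suc k / of_nat (Suc k)) = norm (c (Suc k)) * ?r / real (Suc k)"
      by (simp add: norm_mult norm_divide norm_power del: of_nat_Suc power_Suc norm_exp_eq_Re)
    also have "\<dots> \<le> norm (c (Suc k)) * ?r / 1"
      by (intro divide_left_mono mult_nonneg_nonneg) auto
    also have "\<dots> \<le> 1 * ?r / 1"
      using c[of "Suc k"] by (intro divide_right_mono mult_right_mono) auto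
    finally show "norm (c (Suc k) * exp (z / of_nat (Suc n)) ^ Suc k / of_nat (Suc k)) \<le> ?r" by simp
  qed
  have s1: "summable (\<lambda>k. W.on_set n e A (Suc k) f * exp (a / of_nat (Suc n)) ^ Suc k / of_nat (Suc k))"
    by (rule sm[OF W.norm_on_set_le[OF f A fb] a])
  have s2: "summable (\<lambda>k. W.on_set n e A (Suc k) (\<lambda>_. 1) * exp (- 1 / of_nat (Suc n)) ^ Suc k / of_nat (Suc k))"
    by (rule sm[OF W.norm_on_set_le[OF _ A]]) auto
  have "(\<Sum>k. marginal A a b e (grid n (Suc k)) / of_real (real (Suc n))) =
      (\<Sum>k. W.on_set n e A (Suc k) (\<lambda>_. 1) * exp (- 1 / of_nat (Suc n)) ^ Suc k / of_nat (Suc k)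
        - W.on_set n e A (Suc k) f * exp (a / of_nat (Suc n)) ^ Suc k / of_nat (Suc k))"
    by (rule arg_cong[where f = suminf], rule ext, subst marginal_grid[OF A f f_eq b])
       (simp_all only: diff_divide_distrib)
  then have "(\<Sum>k. marginal A a b e (grid n (Suc k)) / of_real (real (Suc n))) =
      (\<Sum>k. W.on_set n e A (Suc k) (\<lambda>_. 1) * exp (- 1 / of_nat (Suc n)) ^ Suc k / of_nat (Suc k))
      - (\<Sum>k. W.on_set n e A (Suc k) f * exp (a / of_nat (Suc n)) ^ Suc k / of_nat (Suc k))"
    unfolding suminf_diff[OF s2 s1] .
  then show ?thesis by (simp only: algebra_simps)
qed

end

context levy_exp_time
begin

lemma survival_conv_exp: "of_real (survival n) = exp (- of_real \<theta> / of_nat (Suc n) :: complex)"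
  by (simp add: survival_def exp_of_real[symmetric] del: of_nat_Suc)

lemma survival_tendsto: "survival \<longlonglongrightarrow> 1"
proof -
  have "(\<lambda>n. exp (- (\<theta> * inverse (real (Suc n))))) \<longlonglongrightarrow> exp (- (\<theta> * 0))"
    by (intro tendsto_intros LIMSEQ_inverse_real_of_nat)
  then show ?thesis by (simp add: survival_def[abs_def] divide_inverse)
qed

text \<open>
  Time enters the argument of the generating function: weighting with \<open>exp (u * t)\<close> amounts to replacing the rate
  \<open>\<theta>\<close> by \<open>\<theta> - u\<close>.
\<close>

lemma exp_shift:
  fixes u :: complex
  shows "exp (u * of_real (grid n k)) * of_real (survival n) ^ k = exp ((u - of_real \<theta>) / of_nat (Suc n)) ^ k"
proof -
  have "exp (u * of_real (grid n k)) = exp (u / of_nat (Suc n)) ^ k"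
    unfolding exp_of_nat_mult[symmetric] by (simp add: grid_def mult.commute)
  then show ?thesis
    by (simp add: survival_conv_exp power_mult_distrib[symmetric] exp_add[symmetric] diff_divide_distrib del: of_nat_Suc)
qed

text \<open>
  The truncations by \<open>max 0\<close> keep the test function bounded on the whole plane; they are invisible at ladder epochs, where the
  walk is nonnegative.
\<close>

lemma asc_gen_exp:
  assumes u: "Re u \<le> 0" and v: "Re v \<le> 0"
  shows "W.asc_gen n e (survival n) (\<lambda>k x. exp (u * of_real (max 0 (grid n k)) + v * of_real (max 0 x))) =
    exp (\<Sum>k. W.on_set n e {0<..} (Suc k) (\<lambda>x. exp (v * of_real x)) *
      exp ((u - of_real \<theta>) / of_nat (Suc n)) ^ Suc k / of_nat (Suc k))"
proof -
  let ?s = "exp ((u - of_real \<theta>) / of_nat (Suc n))"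
  have "W.asc n e k (\<lambda>x. exp (u * of_real (max 0 (grid n k)) + v * of_real (max 0 x))) * of_real (survival n) ^ k
      = W.asc n e k (\<lambda>x. exp (v * of_real x)) * ?s ^ k" for k
  proof -
    have nn: "0 \<le> walk \<omega> k" if "strict_ladder k \<omega>" for \<omega>
      using that by (rule strict_ladder_nonneg)
    have "W.asc n e k (\<lambda>x. exp (u * of_real (max 0 (grid n k)) + v * of_real (max 0 x))) =
        (\<integral>\<omega>. exp (u * of_real (grid n k)) * (of_bool (strict_ladder k \<omega>) * exp (v * of_real (walk \<omega> k))) \<partial>(\<Pi>\<^sub>M i\<in>UNIV. step_law n e))"
      unfolding W.asc_def
      by (rule Bochner_Integration.integral_cong) (auto simp: exp_add max_absorb2 dest: nn)
    also have "\<dots> = exp (u * of_real (grid n k)) * W.asc n e k (\<lambda>x. exp (v * of_real x))"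
      unfolding W.asc_def by simp
    finally have eq: "W.asc n e k (\<lambda>x. exp (u * of_real (max 0 (grid n k)) + v * of_real (max 0 x))) =
        exp (u * of_real (grid n k)) * W.asc n e k (\<lambda>x. exp (v * of_real x))" .
    show ?thesis unfolding eq exp_shift[symmetric] by (simp only: mult_ac)
  qed
  then have "W.asc_gen n e (survival n) (\<lambda>k x. exp (u * of_real (max 0 (grid n k)) + v * of_real (max 0 x))) =
      (\<Sum>k. W.asc n e k (\<lambda>x. exp (v * of_real x)) * ?s ^ k)"
    by (simp add: W.asc_gen_def)
  also have "\<dots> = exp (\<Sum>k. W.on_set n e {0<..} (Suc k) (\<lambda>x. exp (v * of_real x)) * ?s ^ Suc k / of_nat (Suc k))"
  proof (rule sums_unique[symmetric], rule W.spitzer_asc)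
    show "norm ?s < 1"
      using u theta by (simp add: divide_neg_pos del: of_nat_Suc)
    show "norm (exp (v * complex_of_real x)) \<le> 1" if "0 \<le> x" for x
      using v that by (simp add: mult_nonpos_nonneg)
  qed (auto simp: exp_add[symmetric] distrib_left)
  finally show ?thesis .
qed

lemma low_gen_exp:
  assumes u: "Re u \<le> 0" and v: "Re v \<le> 0"
  shows "W.low_gen n e (survival n) (\<lambda>k x. exp (u * of_real (max 0 (grid n k)) - v * of_real (min 0 x))) =
    exp (\<Sum>k. W.on_set n e {..0} (Suc k) (\<lambda>x. exp (- v * of_real x)) *
      exp ((u - of_real \<theta>) / of_nat (Suc n)) ^ Suc k / of_nat (Suc k))"
proof -
  let ?s = "exp ((u - of_real \<theta>) / of_nat (Suc n))"
  have "W.low n e k (\<lambda>x. exp (u * of_real (max 0 (grid n k)) - v * of_real (min 0 x))) * of_real (survival n) ^ k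
      = W.low n e k (\<lambda>x. exp (- v * of_real x)) * ?s ^ k" for k
  proof -
    have nn: "walk \<omega> k \<le> 0" if "stays_nonpos k \<omega>" for \<omega>
      using that by (simp add: stays_nonpos_def)
    have "W.low n e k (\<lambda>x. exp (u * of_real (max 0 (grid n k)) - v * of_real (min 0 x))) =
        (\<integral>\<omega>. exp (u * of_real (grid n k)) * (of_bool (stays_nonpos k \<omega>) * exp (- v * of_real (walk \<omega> k))) \<partial>(\<Pi>\<^sub>M i\<in>UNIV. step_law n e))"
      unfolding W.low_def
      by (rule Bochner_Integration.integral_cong) (auto simp: exp_diff exp_minus divide_inverse max_absorb2 dest: nn)
    also have "\<dots> = exp (u * of_real (grid n k)) * W.low n e k (\<lambda>x. exp (- v * of_real x))"
      unfolding W.low_def by simp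
    finally have eq: "W.low n e k (\<lambda>x. exp (u * of_real (max 0 (grid n k)) - v * of_real (min 0 x))) =
        exp (u * of_real (grid n k)) * W.low n e k (\<lambda>x. exp (- v * of_real x))" .
    show ?thesis unfolding eq exp_shift[symmetric] by (simp only: mult_ac)
  qed
  then have "W.low_gen n e (survival n) (\<lambda>k x. exp (u * of_real (max 0 (grid n k)) - v * of_real (min 0 x))) =
      (\<Sum>k. W.low n e k (\<lambda>x. exp (- v * of_real x)) * ?s ^ k)"
    by (simp add: W.low_gen_def)
  also have "\<dots> = exp (\<Sum>k. W.on_set n e {..0} (Suc k) (\<lambda>x. exp (- v * of_real x)) * ?s ^ Suc k / of_nat (Suc k))"
  proof (rule sums_unique[symmetric], rule W.spitzer_low)
    show "norm ?s < 1"
      using u theta by (simp add: divide_neg_pos del: of_nat_Suc)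
    show "norm (exp (- v * complex_of_real x)) \<le> 1" if "x \<le> 0" for x
      using v that by (simp add: mult_nonpos_nonpos)
  qed (auto simp: exp_add[symmetric] distrib_left algebra_simps)
  finally show ?thesis .
qed

text \<open>
  The normalised exponentials of the discrete problem.  For fixed slope the Riemann sums converge, since the
  slopes avoid atoms; then the slope tends to \<open>0\<close>.
\<close>

lemma ratio_tendsto:
  assumes A: "A = {0<..} \<or> A = {..0}" and f: "f \<in> borel_measurable borel"
    and f_eq: "\<And>x. x \<in> A \<Longrightarrow> f x = exp (v * of_real \<bar>x\<bar>)" and u: "Re u \<le> 0" and v: "Re v \<le> 0"
    and e: "\<And>k::nat. 0 < e k" "\<And>k. e k \<le> 1" "e \<longlonglongrightarrow> 0"
      "\<And>k. AE t in lborel. 0 < t \<longrightarrow> (AE \<omega> in M. X t \<omega> \<noteq> e k * t)"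
  shows "((\<lambda>(k, n).
      exp (\<Sum>j. W.on_set n (e k) A (Suc j) f * exp ((u - of_real \<theta>) / of_nat (Suc n)) ^ Suc j / of_nat (Suc j)) /
      exp (\<Sum>j. W.on_set n (e k) A (Suc j) (\<lambda>_. 1) * exp (- of_real \<theta> / of_nat (Suc n)) ^ Suc j / of_nat (Suc j)))
    \<longlongrightarrow> phi M X A (- of_real \<theta>) 0 / phi M X A (u - of_real \<theta>) v) iterated"
proof -
  have Am: "A \<in> sets borel" using A by auto
  define R where "R a b k n = (\<Sum>j. marginal A a b (e k) (grid n (Suc j)) / of_real (real (Suc n)))" for a b k n
  have R: "((\<lambda>(k, n). R a b k n) \<longlongrightarrow> exponent A a b 0) iterated" if "Re a < 0" "Re b \<le> 0" for a b
  proof (rule tendsto_iteratedI)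
    show "(\<lambda>n. R a b k n) \<longlonglongrightarrow> exponent A a b (e k)" for k
      unfolding R_def by (rule exponent_grid_limit[OF A that _ e(2,4)]) (use e(1) in \<open>auto intro: less_imp_le\<close>)
    show "(\<lambda>k. exponent A a b (e k)) \<longlonglongrightarrow> exponent A a b 0"
      by (rule exponent_slope_limit[OF A that e(1-3)])
  qed
  have eq: "exp (\<Sum>j. W.on_set n (e k) A (Suc j) f * exp ((u - of_real \<theta>) / of_nat (Suc n)) ^ Suc j / of_nat (Suc j)) /
      exp (\<Sum>j. W.on_set n (e k) A (Suc j) (\<lambda>_. 1) * exp (- of_real \<theta> / of_nat (Suc n)) ^ Suc j / of_nat (Suc j))
      = exp (R (- of_real \<theta>) 0 k n - R (u - of_real \<theta>) v k n)" for k n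
  proof -
    have 1: "(\<Sum>j. W.on_set n (e k) A (Suc j) f * exp ((u - of_real \<theta>) / of_nat (Suc n)) ^ Suc j / of_nat (Suc j)) =
        (\<Sum>j. W.on_set n (e k) A (Suc j) (\<lambda>_. 1) * exp (- 1 / of_nat (Suc n)) ^ Suc j / of_nat (Suc j)) - R (u - of_real \<theta>) v k n"
      unfolding R_def by (rule spitzer_exponent[OF Am f f_eq _ v]) (use u theta in auto)
    have 2: "(\<Sum>j. W.on_set n (e k) A (Suc j) (\<lambda>_. 1) * exp (- of_real \<theta> / of_nat (Suc n)) ^ Suc j / of_nat (Suc j)) =
        (\<Sum>j. W.on_set n (e k) A (Suc j) (\<lambda>_. 1) * exp (- 1 / of_nat (Suc n)) ^ Suc j / of_nat (Suc j)) - R (- of_real \<theta>) 0 k n"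
      unfolding R_def by (rule spitzer_exponent[OF Am]) (use theta in auto)
    show ?thesis unfolding 1 2 exp_diff[symmetric] by simp
  qed
  have "((\<lambda>p. exp ((case p of (k, n) \<Rightarrow> R (- of_real \<theta>) 0 k n) - (case p of (k, n) \<Rightarrow> R (u - of_real \<theta>) v k n)))
      \<longlongrightarrow> exp (exponent A (- of_real \<theta>) 0 0 - exponent A (u - of_real \<theta>) v 0)) iterated"
    by (intro tendsto_intros R) (use u v theta in auto)
  then show ?thesis
    unfolding eq phi_eq_exp_exponent[OF Am] exp_diff by (simp add: case_prod_unfold)
qed

section \<open>Passage to the limit\<close>

lemma survival_odds_tendsto: "((\<lambda>(k, n). complex_of_real ((1 - survival n) / survival n)) \<longlongrightarrow> 0) iterated"
proof -
  have "(\<lambda>n. complex_of_real ((1 - survival n) / survival n)) \<longlonglongrightarrow> of_real ((1 - 1) / 1)"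
    by (intro tendsto_intros survival_tendsto) simp
  then show ?thesis
    by (intro tendsto_iterated_inner) simp
qed

lemma first_argmax_tilted_measurable:
  assumes N: "N \<in> measurable M (count_space UNIV)"
  shows "(\<lambda>\<omega>. first_argmax (tilted (\<lambda>t. X t \<omega>) e n) (N \<omega>)) \<in> measurable M (count_space UNIV)"
proof -
  have "(\<lambda>\<omega>. first_argmax (walk (steps n e \<omega>)) m) \<in> measurable M (count_space UNIV)" for m
    using measurable_compose[OF steps_seq_measurable W.first_argmax_measurable[where n = n and e = e and m = m, unfolded measurable_step_space]] .
  then have "(\<lambda>\<omega>. first_argmax (walk (steps n e \<omega>)) (N \<omega>)) \<in> measurable M (count_space UNIV)"
    by (rule measurable_compose_countable[OF _ N])
  then show ?thesis
    by (rule measurable_cong[THEN iffD1, rotated]) (simp add: walk_steps)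
qed

lemma tilted_at_measurable:
  assumes "N \<in> measurable M (count_space UNIV)"
  shows "(\<lambda>\<omega>. tilted (\<lambda>t. X t \<omega>) e n (N \<omega>)) \<in> borel_measurable M"
  by (rule measurable_compose_countable[OF _ assms]) (simp add: tilted_def)

text \<open>
  The supremum at a random time is the limit of maxima on grids with slope \<open>0\<close>.
\<close>

lemma running_sup_at_measurable:
  assumes R[measurable]: "R \<in> borel_measurable M" and R0: "\<And>\<omega>. \<omega> \<in> space M \<Longrightarrow> 0 \<le> R \<omega>"
  shows "(\<lambda>\<omega>. running_sup (\<lambda>t. X t \<omega>) (R \<omega>)) \<in> borel_measurable M"
proof (rule borel_measurable_LIMSEQ_metric)
  fix n
  show "(\<lambda>\<omega>. tilted (\<lambda>t. X t \<omega>) 0 n (first_argmax (tilted (\<lambda>t. X t \<omega>) 0 n) (grid_index n (R \<omega>)))) \<in> borel_measurable M"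
    by (intro tilted_at_measurable first_argmax_tilted_measurable) (unfold grid_index_def, measurable)
next
  fix \<omega> assume \<omega>: "\<omega> \<in> space M"
  show "(\<lambda>n. tilted (\<lambda>t. X t \<omega>) 0 n (first_argmax (tilted (\<lambda>t. X t \<omega>) 0 n) (grid_index n (R \<omega>))))
      \<longlonglongrightarrow> running_sup (\<lambda>t. X t \<omega>) (R \<omega>)"
    by (rule grid_max_tendsto[OF path_cadlag[OF \<omega>] R0[OF \<omega>]])
qed

lemma X_T_measurable: "(\<lambda>\<omega>. X (T \<omega>) \<omega>) \<in> borel_measurable M"
proof -
  have "(\<lambda>\<omega>. X (max 0 (T \<omega>)) \<omega>) \<in> borel_measurable M" by measurable
  then show ?thesis
    by (rule measurable_cong[THEN iffD1, rotated]) (simp add: time_nonneg max_absorb2)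
qed

lemma sup_time_measurable: "(\<lambda>\<omega>. sup_time (\<lambda>t. X t \<omega>) (T \<omega>)) \<in> borel_measurable M"
proof (rule borel_measurableI_le)
  fix s :: real
  show "{\<omega> \<in> space M. sup_time (\<lambda>t. X t \<omega>) (T \<omega>) \<le> s} \<in> sets M"
  proof (cases "0 \<le> s")
    case True
    have "{\<omega> \<in> space M. sup_time (\<lambda>t. X t \<omega>) (T \<omega>) \<le> s} =
        {\<omega> \<in> space M. running_sup (\<lambda>t. X t \<omega>) (min s (T \<omega>)) = running_sup (\<lambda>t. X t \<omega>) (T \<omega>)}"
      using sup_time_le_iff[OF path_cadlag time_nonneg True] by auto
    also have "\<dots> \<in> sets M"
      using running_sup_at_measurable[of "\<lambda>\<omega>. min s (T \<omega>)"] running_sup_at_measurable[of T] True time_nonneg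
      by (intro borel_measurable_eq) auto
    finally show ?thesis .
  next
    case False
    then have empty: "{\<omega> \<in> space M. sup_time (\<lambda>t. X t \<omega>) (T \<omega>) \<le> s} = {}"
      using sup_time_nonneg[OF path_cadlag time_nonneg] by fastforce
    show ?thesis unfolding empty by (rule sets.empty_sets)
  qed
qed

definition pre_sup :: "'w \<Rightarrow> real \<times> real" where
  "pre_sup \<omega> = (sup_time (\<lambda>t. X t \<omega>) (T \<omega>), running_sup (\<lambda>t. X t \<omega>) (T \<omega>))"

definition post_sup :: "'w \<Rightarrow> real \<times> real" where
  "post_sup \<omega> = (T \<omega> - sup_time (\<lambda>t. X t \<omega>) (T \<omega>), X (T \<omega>) \<omega> - running_sup (\<lambda>t. X t \<omega>) (T \<omega>))"

lemma pre_sup_measurable [measurable]: "pre_sup \<in> borel_measurable M"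
  unfolding pre_sup_def[abs_def]
  using sup_time_measurable running_sup_at_measurable[of T] time_nonneg by auto

lemma post_sup_measurable [measurable]: "post_sup \<in> borel_measurable M"
proof -
  note [measurable] = sup_time_measurable running_sup_at_measurable[of T, OF T_measurable time_nonneg] X_T_measurable
  show ?thesis unfolding post_sup_def[abs_def] by measurable
qed

lemma sup_signs:
  assumes "\<omega> \<in> space M"
  shows "0 \<le> fst (pre_sup \<omega>)" "0 \<le> snd (pre_sup \<omega>)" "0 \<le> fst (post_sup \<omega>)" "snd (post_sup \<omega>) \<le> 0"
proof -
  note x = path_cadlag[OF assms] and t = time_nonneg[OF assms]
  show "0 \<le> fst (pre_sup \<omega>)" using sup_time_nonneg[OF x t] by (simp add: pre_sup_def)
  show "0 \<le> snd (pre_sup \<omega>)" using running_sup_upper[OF x order_refl t] assms by (simp add: pre_sup_def)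
  show "0 \<le> fst (post_sup \<omega>)" using sup_time_le[OF x t] by (simp add: post_sup_def)
  show "snd (post_sup \<omega>) \<le> 0" using running_sup_upper[OF x t order_refl] by (simp add: post_sup_def)
qed

context
  fixes e :: "nat \<Rightarrow> real"
  assumes e: "\<And>k. 0 < e k" "\<And>k. e k \<le> 1" "e \<longlonglongrightarrow> 0"
      "\<And>k. AE t in lborel. 0 < t \<longrightarrow> (AE \<omega> in M. X t \<omega> \<noteq> e k * t)"
begin

text \<open>
  The factors of \<open>discrete_factorization\<close>, normalised to have value \<open>1\<close> at the constant function \<open>1\<close>.
\<close>

definition asc_mean :: "(real \<Rightarrow> real \<Rightarrow> complex) \<Rightarrow> nat \<Rightarrow> nat \<Rightarrow> complex" where
  "asc_mean f k n = W.asc_gen n (e k) (survival n) (\<lambda>j. f (grid n j)) / W.asc_gen n (e k) (survival n) (\<lambda>_ _. 1)"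

definition low_mean :: "(real \<Rightarrow> real \<Rightarrow> complex) \<Rightarrow> nat \<Rightarrow> nat \<Rightarrow> complex" where
  "low_mean f k n = W.low_gen n (e k) (survival n) (\<lambda>j. f (grid n j)) / W.low_gen n (e k) (survival n) (\<lambda>_ _. 1)"

lemma gens_nonzero: "W.asc_gen n (e k) (survival n) (\<lambda>_ _. 1) \<noteq> 0" "W.low_gen n (e k) (survival n) (\<lambda>_ _. 1) \<noteq> 0"
  using W.gen_one[OF survival(1,2)[of n], of n "e k"] survival(2)[of n] by auto

lemma means_of_one [simp]: "asc_mean (\<lambda>_ _. 1) k n = 1" "low_mean (\<lambda>_ _. 1) k n = 1"
  using gens_nonzero by (simp_all add: asc_mean_def low_mean_def)

lemma continuous_section_measurable:
  fixes f :: "real \<Rightarrow> real \<Rightarrow> complex"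
  assumes f: "continuous_on UNIV (\<lambda>(t, x). f t x)"
  shows "f t \<in> borel_measurable borel"
proof -
  have "continuous_on UNIV (\<lambda>x. (\<lambda>(t, x). f t x) (t, x))"
    by (rule continuous_on_compose2[OF f]) (auto intro!: continuous_intros)
  then show ?thesis by (intro borel_measurable_continuous_onI) simp
qed

text \<open>
  The pathwise limits of the tilted maximum, its index and the end point carry over to expectations.  The
  normalising constants and the term of index \<open>0\<close> in \<open>discrete_factorization\<close> disappear, since \<open>survival\<close> tends to \<open>1\<close>.
\<close>

lemma product_expectation_limit:
  fixes f g :: "real \<Rightarrow> real \<Rightarrow> complex"
  assumes f: "continuous_on UNIV (\<lambda>(t, x). f t x)" "\<And>t x. norm (f t x) \<le> B"
    and g: "continuous_on UNIV (\<lambda>(t, x). g t x)" "\<And>t x. norm (g t x) \<le> C"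
  shows "((\<lambda>(k, n). asc_mean f k n * low_mean g k n) \<longlongrightarrow>
    (\<integral>\<omega>. case_prod f (pre_sup \<omega>) * case_prod g (post_sup \<omega>) \<partial>M)) iterated"
proof -
  have [measurable]: "f t \<in> borel_measurable borel" "g t \<in> borel_measurable borel" for t
    using continuous_section_measurable f(1) g(1) by auto
  have [measurable]: "case_prod f \<in> borel_measurable borel" "case_prod g \<in> borel_measurable borel"
    using f(1) g(1) by (auto intro: borel_measurable_continuous_onI)
  define \<kappa> where "\<kappa> k n \<omega> = grid_argmax n (e k) \<omega>" for k n \<omega>
  define F where "F k n \<omega> = f (grid n (\<kappa> k n \<omega>)) (tilted (\<lambda>t. X t \<omega>) (e k) n (\<kappa> k n \<omega>)) *
      g (grid n (grid_index n (T \<omega>) - \<kappa> k n \<omega>))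
        (tilted (\<lambda>t. X t \<omega>) (e k) n (grid_index n (T \<omega>)) - tilted (\<lambda>t. X t \<omega>) (e k) n (\<kappa> k n \<omega>))" for k n \<omega>
  have \<kappa>_le: "\<kappa> k n \<omega> \<le> grid_index n (T \<omega>)" for k n \<omega>
    unfolding \<kappa>_def grid_argmax_def by (rule first_argmax_le)
  have [measurable]: "\<kappa> k n \<in> measurable M (count_space UNIV)" for k n
    unfolding \<kappa>_def[abs_def] grid_argmax_def by (rule first_argmax_tilted_measurable) measurable
  have [measurable]: "(\<lambda>\<omega>. tilted (\<lambda>t. X t \<omega>) (e k) n (\<kappa> k n \<omega>)) \<in> borel_measurable M" for k n
    by (rule tilted_at_measurable) measurable
  have [measurable]: "(\<lambda>\<omega>. tilted (\<lambda>t. X t \<omega>) (e k) n (grid_index n (T \<omega>))) \<in> borel_measurable M" for k n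
    by (rule tilted_at_measurable[OF grid_index_T_measurable])
  have F_meas: "F k n \<in> borel_measurable M" for k n
  proof -
    have 1: "(\<lambda>\<omega>. f (grid n (\<kappa> k n \<omega>)) (tilted (\<lambda>t. X t \<omega>) (e k) n (\<kappa> k n \<omega>))) \<in> borel_measurable M"
      by (rule measurable_compose_countable[where f = "\<lambda>j \<omega>. f (grid n j) (tilted (\<lambda>t. X t \<omega>) (e k) n (\<kappa> k n \<omega>))"]) measurable
    have 2: "(\<lambda>\<omega>. g (grid n (grid_index n (T \<omega>) - \<kappa> k n \<omega>))
        (tilted (\<lambda>t. X t \<omega>) (e k) n (grid_index n (T \<omega>)) - tilted (\<lambda>t. X t \<omega>) (e k) n (\<kappa> k n \<omega>))) \<in> borel_measurable M"
      by (rule measurable_compose_countable[where f = "\<lambda>j \<omega>. g (grid n j)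
        (tilted (\<lambda>t. X t \<omega>) (e k) n (grid_index n (T \<omega>)) - tilted (\<lambda>t. X t \<omega>) (e k) n (\<kappa> k n \<omega>))"]) measurable
    show ?thesis unfolding F_def[abs_def] using 1 2 by (rule borel_measurable_times)
  qed
  have F_lim: "((\<lambda>(k, n). F k n \<omega>) \<longlongrightarrow> case_prod f (pre_sup \<omega>) * case_prod g (post_sup \<omega>)) iterated"
    if \<omega>: "\<omega> \<in> space M" for \<omega>
  proof -
    note x = path_cadlag[OF \<omega>] and t = time_nonneg[OF \<omega>]
    define \<sigma> where "\<sigma> p = (case p of (k, n) \<Rightarrow> grid n (\<kappa> k n \<omega>))" for p
    define \<mu> where "\<mu> p = (case p of (k, n) \<Rightarrow> tilted (\<lambda>t. X t \<omega>) (e k) n (\<kappa> k n \<omega>))" for p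
    define \<tau> where "\<tau> p = (case p of (k::nat, n) \<Rightarrow> grid n (grid_index n (T \<omega>)))" for p
    define \<xi> where "\<xi> p = (case p of (k, n) \<Rightarrow> tilted (\<lambda>t. X t \<omega>) (e k) n (grid_index n (T \<omega>)))" for p
    have \<sigma>: "(\<sigma> \<longlongrightarrow> sup_time (\<lambda>t. X t \<omega>) (T \<omega>)) iterated"
      using tilted_argmax_tendsto[OF x t e(1,3)] unfolding \<sigma>_def \<kappa>_def grid_argmax_def .
    have \<mu>: "(\<mu> \<longlongrightarrow> running_sup (\<lambda>t. X t \<omega>) (T \<omega>)) iterated"
      using tilted_max_tendsto[OF x t e(1,3)] unfolding \<mu>_def \<kappa>_def grid_argmax_def .
    have \<tau>: "(\<tau> \<longlongrightarrow> T \<omega>) iterated"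
      unfolding \<tau>_def using tendsto_iterated_inner[OF grid_index_tendsto[OF t]] .
    have \<xi>: "(\<xi> \<longlongrightarrow> X (T \<omega>) \<omega>) iterated"
      using tilted_end_tendsto[OF x t e(1,3)] unfolding \<xi>_def .
    have cont: "continuous (at y) (case_prod f)" "continuous (at y) (case_prod g)" for y
      using f(1) g(1) by (cases y, simp add: continuous_on_eq_continuous_at)+
    have 1: "((\<lambda>p. case_prod f (\<sigma> p, \<mu> p)) \<longlongrightarrow> case_prod f (pre_sup \<omega>)) iterated"
      unfolding pre_sup_def by (rule isCont_tendsto_compose[OF cont(1) tendsto_Pair[OF \<sigma> \<mu>]])
    have 2: "((\<lambda>p. case_prod g (\<tau> p - \<sigma> p, \<xi> p - \<mu> p)) \<longlongrightarrow> case_prod g (post_sup \<omega>)) iterated"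
      unfolding post_sup_def
      by (rule isCont_tendsto_compose[OF cont(2) tendsto_Pair[OF tendsto_diff[OF \<tau> \<sigma>] tendsto_diff[OF \<xi> \<mu>]]])
    have "grid n (grid_index n (T \<omega>) - \<kappa> k n \<omega>) = grid n (grid_index n (T \<omega>)) - grid n (\<kappa> k n \<omega>)" for k n
      using \<kappa>_le[of k n \<omega>] by (simp add: grid_def of_nat_diff diff_divide_distrib)
    then have "(\<lambda>(k, n). F k n \<omega>) = (\<lambda>p. case_prod f (\<sigma> p, \<mu> p) * case_prod g (\<tau> p - \<sigma> p, \<xi> p - \<mu> p))"
      by (auto simp: F_def \<sigma>_def \<mu>_def \<tau>_def \<xi>_def fun_eq_iff)
    then show ?thesis using tendsto_mult[OF 1 2] by simp
  qed
  have F_bdd: "norm (F k n \<omega>) \<le> B * C" for k n \<omega>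
    unfolding F_def norm_mult using order_trans[OF norm_ge_zero f(2)] by (intro mult_mono f(2) g(2)) auto
  have lim: "((\<lambda>(k, n). \<integral>\<omega>. F k n \<omega> \<partial>M) \<longlongrightarrow> (\<integral>\<omega>. case_prod f (pre_sup \<omega>) * case_prod g (post_sup \<omega>) \<partial>M)) iterated"
    by (rule iterated_dominated_convergence[OF _ F_meas _ F_bdd F_lim]) (auto intro: finite_measure_axioms)
  have EF: "(\<integral>\<omega>. F k n \<omega> \<partial>M) = of_real (1 / survival n) * (asc_mean f k n * low_mean g k n)
      - of_real ((1 - survival n) / survival n) * (f 0 0 * g 0 0)" for k n
  proof -
    let ?A = "W.asc_gen n (e k) (survival n)" and ?B = "W.low_gen n (e k) (survival n)" and ?p = "survival n"
    have p: "?p \<noteq> 0" "1 - ?p \<noteq> 0" using survival[of n] by auto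
    have "(\<integral>\<omega>. F k n \<omega> \<partial>M) = of_real ((1 - ?p) / ?p) *
        (?A (\<lambda>j. f (grid n j)) * ?B (\<lambda>j. g (grid n j)) - f (grid n 0) 0 * g (grid n 0) 0)"
      unfolding F_def \<kappa>_def
      by (rule discrete_factorization[where F = "\<lambda>j. f (grid n j)" and G = "\<lambda>j. g (grid n j)", OF _ _ f(2) g(2)]) measurable
    moreover have "?A (\<lambda>j. f (grid n j)) * ?B (\<lambda>j. g (grid n j)) =
        asc_mean f k n * low_mean g k n * (?A (\<lambda>_ _. 1) * ?B (\<lambda>_ _. 1))"
      using gens_nonzero by (simp add: asc_mean_def low_mean_def)
    moreover have "?A (\<lambda>_ _. 1) * ?B (\<lambda>_ _. 1) = of_real (1 / (1 - ?p))"
      by (rule W.gen_one[OF survival(1,2)])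
    ultimately have "(\<integral>\<omega>. F k n \<omega> \<partial>M) = of_real ((1 - ?p) / ?p) *
        (asc_mean f k n * low_mean g k n * of_real (1 / (1 - ?p)) - f 0 0 * g 0 0)" by simp
    also have "\<dots> = (of_real ((1 - ?p) / ?p) * of_real (1 / (1 - ?p))) * (asc_mean f k n * low_mean g k n)
        - of_real ((1 - ?p) / ?p) * (f 0 0 * g 0 0)" by (simp only: right_diff_distrib mult_ac)
    also have "of_real ((1 - ?p) / ?p) * of_real (1 / (1 - ?p)) = (of_real (1 / ?p) :: complex)"
      unfolding of_real_mult[symmetric] using p by simp
    finally show ?thesis .
  qed
  have "asc_mean f k n * low_mean g k n = of_real (survival n) *
      ((\<integral>\<omega>. F k n \<omega> \<partial>M) + of_real ((1 - survival n) / survival n) * (f 0 0 * g 0 0))" for k n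
    unfolding EF using survival(1)[of n] by simp
  moreover have "((\<lambda>p. (case p of (k::nat, n) \<Rightarrow> complex_of_real (survival n)) *
      ((case p of (k, n) \<Rightarrow> \<integral>\<omega>. F k n \<omega> \<partial>M) + (case p of (k::nat, n) \<Rightarrow> of_real ((1 - survival n) / survival n)) * (f 0 0 * g 0 0)))
      \<longlongrightarrow> of_real 1 * ((\<integral>\<omega>. case_prod f (pre_sup \<omega>) * case_prod g (post_sup \<omega>) \<partial>M) + 0 * (f 0 0 * g 0 0))) iterated"
    by (intro tendsto_intros lim survival_odds_tendsto tendsto_iterated_inner tendsto_of_real survival_tendsto)
  ultimately show ?thesis by (simp add: case_prod_unfold)
qed

text \<open>
  Taking one of the two test functions constant isolates the other factor.
\<close>

lemma mean_limits:
  fixes f :: "real \<Rightarrow> real \<Rightarrow> complex"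
  assumes f: "continuous_on UNIV (\<lambda>(t, x). f t x)" "\<And>t x. norm (f t x) \<le> B"
  shows asc_mean_limit: "((\<lambda>(k, n). asc_mean f k n) \<longlongrightarrow> (\<integral>\<omega>. case_prod f (pre_sup \<omega>) \<partial>M)) iterated"
    and low_mean_limit: "((\<lambda>(k, n). low_mean f k n) \<longlongrightarrow> (\<integral>\<omega>. case_prod f (post_sup \<omega>) \<partial>M)) iterated"
proof -
  have one: "continuous_on UNIV (\<lambda>(t::real, x::real). 1 :: complex)" by (simp add: case_prod_unfold)
  show "((\<lambda>(k, n). asc_mean f k n) \<longlongrightarrow> (\<integral>\<omega>. case_prod f (pre_sup \<omega>) \<partial>M)) iterated"
    using product_expectation_limit[of f B "\<lambda>_ _. 1" 1, OF f one] by (simp add: case_prod_unfold)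
  show "((\<lambda>(k, n). low_mean f k n) \<longlongrightarrow> (\<integral>\<omega>. case_prod f (post_sup \<omega>) \<partial>M)) iterated"
    using product_expectation_limit[of "\<lambda>_ _. 1" 1 f B, OF one _ f] by (simp add: case_prod_unfold)
qed

text \<open>
  Before the limit the two factors separate exactly, and each factor has its own limit.
\<close>

lemma expectation_product_aux:
  fixes f g :: "real \<Rightarrow> real \<Rightarrow> complex"
  assumes f: "continuous_on UNIV (\<lambda>(t, x). f t x)" "\<And>t x. norm (f t x) \<le> B"
    and g: "continuous_on UNIV (\<lambda>(t, x). g t x)" "\<And>t x. norm (g t x) \<le> C"
  shows "(\<integral>\<omega>. case_prod f (pre_sup \<omega>) * case_prod g (post_sup \<omega>) \<partial>M) =
    (\<integral>\<omega>. case_prod f (pre_sup \<omega>) \<partial>M) * (\<integral>\<omega>. case_prod g (post_sup \<omega>) \<partial>M)"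
proof (rule tendsto_unique[OF iterated_neq_bot product_expectation_limit[OF f g]])
  show "((\<lambda>(k, n). asc_mean f k n * low_mean g k n) \<longlongrightarrow>
    (\<integral>\<omega>. case_prod f (pre_sup \<omega>) \<partial>M) * (\<integral>\<omega>. case_prod g (post_sup \<omega>) \<partial>M)) iterated"
    using tendsto_mult[OF asc_mean_limit[OF f] low_mean_limit[OF g]] by (simp add: case_prod_unfold)
qed

lemma pre_sup_transform_aux:
  assumes u: "Re u \<le> 0" and v: "Re v \<le> 0"
  shows "(\<integral>\<omega>. exp (u * of_real (max 0 (fst (pre_sup \<omega>))) + v * of_real (max 0 (snd (pre_sup \<omega>)))) \<partial>M) =
    phi M X {0<..} (- of_real \<theta>) 0 / phi M X {0<..} (u - of_real \<theta>) v"
proof -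
  define f where "f t x = exp (u * of_real (max 0 t) + v * of_real (max 0 x))" for t x
  have f: "continuous_on UNIV (\<lambda>(t, x). f t x)" "\<And>t x. norm (f t x) \<le> 1"
    unfolding f_def case_prod_unfold using u v
    by (auto intro!: continuous_intros simp: mult_nonpos_nonneg add_nonpos_nonpos)
  have r: "asc_mean f k n = exp (\<Sum>j. W.on_set n (e k) {0<..} (Suc j) (\<lambda>x. exp (v * of_real x)) *
        exp ((u - of_real \<theta>) / of_nat (Suc n)) ^ Suc j / of_nat (Suc j)) /
      exp (\<Sum>j. W.on_set n (e k) {0<..} (Suc j) (\<lambda>_. 1) * exp (- of_real \<theta> / of_nat (Suc n)) ^ Suc j / of_nat (Suc j))" for k n
    using asc_gen_exp[OF u v, of n "e k"] asc_gen_exp[of 0 0 n "e k"] by (simp add: asc_mean_def f_def[abs_def])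
  have "((\<lambda>(k, n). asc_mean f k n) \<longlongrightarrow>
      phi M X {0<..} (- of_real \<theta>) 0 / phi M X {0<..} (u - of_real \<theta>) v) iterated"
    unfolding r by (rule ratio_tendsto[OF _ _ _ u v e]) auto
  from tendsto_unique[OF iterated_neq_bot asc_mean_limit[OF f] this]
  show ?thesis by (simp add: f_def case_prod_unfold)
qed

lemma post_sup_transform_aux:
  assumes u: "Re u \<le> 0" and v: "Re v \<le> 0"
  shows "(\<integral>\<omega>. exp (u * of_real (max 0 (fst (post_sup \<omega>))) - v * of_real (min 0 (snd (post_sup \<omega>)))) \<partial>M) =
    phi M X {..0} (- of_real \<theta>) 0 / phi M X {..0} (u - of_real \<theta>) v"
proof -
  define f where "f t x = exp (u * of_real (max 0 t) - v * of_real (min 0 x))" for t x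
  have f: "continuous_on UNIV (\<lambda>(t, x). f t x)" "\<And>t x. norm (f t x) \<le> 1"
  proof -
    show "continuous_on UNIV (\<lambda>(t, x). f t x)"
      unfolding f_def case_prod_unfold by (intro continuous_intros)
    show "norm (f t x) \<le> 1" for t x
    proof -
      have "Re u * max 0 t \<le> 0" using u by (simp add: mult_nonpos_nonneg)
      moreover have "0 \<le> Re v * min 0 x" using v by (simp add: mult_nonpos_nonpos)
      ultimately show ?thesis by (simp add: f_def)
    qed
  qed
  have r: "low_mean f k n = exp (\<Sum>j. W.on_set n (e k) {..0} (Suc j) (\<lambda>x. exp (- v * of_real x)) *
        exp ((u - of_real \<theta>) / of_nat (Suc n)) ^ Suc j / of_nat (Suc j)) /
      exp (\<Sum>j. W.on_set n (e k) {..0} (Suc j) (\<lambda>_. 1) * exp (- of_real \<theta> / of_nat (Suc n)) ^ Suc j / of_nat (Suc j))" for k n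
    using low_gen_exp[OF u v, of n "e k"] low_gen_exp[of 0 0 n "e k"] by (simp add: low_mean_def f_def[abs_def])
  have "((\<lambda>(k, n). low_mean f k n) \<longlongrightarrow>
      phi M X {..0} (- of_real \<theta>) 0 / phi M X {..0} (u - of_real \<theta>) v) iterated"
    unfolding r by (rule ratio_tendsto[OF _ _ _ u v e]) auto
  from tendsto_unique[OF iterated_neq_bot low_mean_limit[OF f] this]
  show ?thesis by (simp add: f_def case_prod_unfold)
qed

end

lemma expectation_product:
  fixes f g :: "real \<Rightarrow> real \<Rightarrow> complex"
  assumes "continuous_on UNIV (\<lambda>(t, x). f t x)" "\<And>t x. norm (f t x) \<le> B"
    and "continuous_on UNIV (\<lambda>(t, x). g t x)" "\<And>t x. norm (g t x) \<le> C"
  shows "(\<integral>\<omega>. case_prod f (pre_sup \<omega>) * case_prod g (post_sup \<omega>) \<partial>M) =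
    (\<integral>\<omega>. case_prod f (pre_sup \<omega>) \<partial>M) * (\<integral>\<omega>. case_prod g (post_sup \<omega>) \<partial>M)"
  using slopes_without_atoms expectation_product_aux[OF _ _ _ _ assms] by blast

lemma Psi_plus_eq:
  assumes uv: "Re u \<le> 0" "Re v \<le> 0"
  shows "Psi_plus M X T u v = phi M X {0<..} (- of_real \<theta>) 0 / phi M X {0<..} (u - of_real \<theta>) v"
proof -
  have "Psi_plus M X T u v = (\<integral>\<omega>. exp (u * of_real (max 0 (fst (pre_sup \<omega>))) + v * of_real (max 0 (snd (pre_sup \<omega>)))) \<partial>M)"
    unfolding Psi_plus_def
  proof (rule Bochner_Integration.integral_cong[OF refl])
    fix \<omega> assume "\<omega> \<in> space M"
    from sup_signs(1,2)[OF this]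
    show "exp (u * of_real (sup_time (\<lambda>t. X t \<omega>) (T \<omega>)) + v * of_real (running_sup (\<lambda>t. X t \<omega>) (T \<omega>))) =
        exp (u * of_real (max 0 (fst (pre_sup \<omega>))) + v * of_real (max 0 (snd (pre_sup \<omega>))))"
      by (simp add: pre_sup_def max_absorb2)
  qed
  also have "\<dots> = phi M X {0<..} (- of_real \<theta>) 0 / phi M X {0<..} (u - of_real \<theta>) v"
    using slopes_without_atoms pre_sup_transform_aux[OF _ _ _ _ uv] by blast
  finally show ?thesis .
qed

lemma Psi_minus_eq:
  assumes uv: "Re u \<le> 0" "Re v \<le> 0"
  shows "Psi_minus M X T u (- v) = phi M X {..0} (- of_real \<theta>) 0 / phi M X {..0} (u - of_real \<theta>) v"
proof -
  have "Psi_minus M X T u (- v) = (\<integral>\<omega>. exp (u * of_real (max 0 (fst (post_sup \<omega>))) - v * of_real (min 0 (snd (post_sup \<omega>)))) \<partial>M)"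
    unfolding Psi_minus_def
  proof (rule Bochner_Integration.integral_cong[OF refl])
    fix \<omega> assume "\<omega> \<in> space M"
    from sup_signs(3,4)[OF this]
    show "exp (u * of_real (T \<omega> - sup_time (\<lambda>t. X t \<omega>) (T \<omega>)) + - v * of_real (X (T \<omega>) \<omega> - running_sup (\<lambda>t. X t \<omega>) (T \<omega>))) =
        exp (u * of_real (max 0 (fst (post_sup \<omega>))) - v * of_real (min 0 (snd (post_sup \<omega>))))"
      by (simp add: post_sup_def max_absorb2 min_absorb2)
  qed
  also have "\<dots> = phi M X {..0} (- of_real \<theta>) 0 / phi M X {..0} (u - of_real \<theta>) v"
    using slopes_without_atoms post_sup_transform_aux[OF _ _ _ _ uv] by blast
  finally show ?thesis .
qed

lemma indep_pre_post: "indep_var borel pre_sup borel post_sup"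
proof (rule indep_varI_continuous[OF pre_sup_measurable post_sup_measurable])
  fix f g :: "real \<times> real \<Rightarrow> real"
  assume fg: "continuous_on UNIV f" "continuous_on UNIV g" "\<And>x. 0 \<le> f x" "\<And>x. f x \<le> 1" "\<And>x. 0 \<le> g x" "\<And>x. g x \<le> 1"
  have "(\<integral>\<omega>. complex_of_real (f (pre_sup \<omega>)) * complex_of_real (g (post_sup \<omega>)) \<partial>M) =
      (\<integral>\<omega>. complex_of_real (f (pre_sup \<omega>)) \<partial>M) * (\<integral>\<omega>. complex_of_real (g (post_sup \<omega>)) \<partial>M)"
    using expectation_product[of "\<lambda>t x. of_real (f (t, x))" 1 "\<lambda>t x. of_real (g (t, x))" 1] fg
    by (simp add: case_prod_unfold continuous_on_of_real)
  then show "(\<integral>\<omega>. f (pre_sup \<omega>) * g (post_sup \<omega>) \<partial>M) = (\<integral>\<omega>. f (pre_sup \<omega>) \<partial>M) * (\<integral>\<omega>. g (post_sup \<omega>) \<partial>M)"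
    by (simp only: of_real_mult[symmetric] integral_complex_of_real of_real_eq_iff)
qed

section \<open>The characteristic exponent\<close>

text \<open>
  The equation at time \<open>1\<close> determines the value at time \<open>1 / m\<close> only up to an \<open>m\<close>-th root of unity.  The
  quotient of both sides is a continuous function with values in this finite set, hence constant, and it equals \<open>1\<close>
  at frequency \<open>0\<close>.
\<close>

lemma charf_root:
  assumes \<Psi>: "is_characteristic_exponent M X \<Psi>"
  shows "charf (1 / real (Suc n)) w = exp (\<Psi> (\<i> * of_real w) / of_nat (Suc n))"
proof -
  define m where "m = Suc n"
  have m: "0 < m" by (simp add: m_def)
  have cont: "continuous_on {v. Re v = 0} \<Psi>" and \<Psi>0: "\<Psi> 0 = 0"
    and \<Psi>1: "\<And>v. Re v = 0 \<Longrightarrow> (\<integral>\<omega>. exp (v * of_real (X 1 \<omega>)) \<partial>M) = exp (\<Psi> v)"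
    using \<Psi> by (auto simp: is_characteristic_exponent_def)
  have mult: "charf (real k / real m) w = charf (1 / real m) w ^ k" for k w
  proof (induction k)
    case (Suc k)
    have "charf (real (Suc k) / real m) w = charf (real k / real m + 1 / real m) w"
      by (simp add: add_divide_distrib add.commute)
    also have "\<dots> = charf (real k / real m) w * charf (1 / real m) w" by (rule charf_add) auto
    finally show ?case by (simp add: Suc.IH mult.commute)
  qed simp
  have pow: "charf (1 / real m) w ^ m = exp (\<Psi> (\<i> * of_real w))" for w
    using mult[of m w] m \<Psi>1[of "\<i> * of_real w"] by (simp add: charf_def mult_ac)
  \<comment> \<open>A root of unity for every frequency.\<close>
  define d where "d w = charf (1 / real m) w * exp (- \<Psi> (\<i> * of_real w) / of_nat m)" for w
  have dm: "d w ^ m = 1" for w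
  proof -
    have "exp (- \<Psi> (\<i> * of_real w) / of_nat m) ^ m = exp (- \<Psi> (\<i> * of_real w))"
      unfolding exp_of_nat_mult[symmetric] using m by simp
    then show ?thesis by (simp add: d_def power_mult_distrib pow exp_add[symmetric])
  qed
  have "continuous_on UNIV d"
  proof -
    have "continuous_on UNIV (\<lambda>w. charf (1 / real m) w)"
      unfolding continuous_on_sequentially by (auto simp: o_def intro: charf_tendsto)
    moreover have "continuous_on UNIV (\<lambda>w. \<Psi> (\<i> * of_real w))"
      by (rule continuous_on_compose2[OF cont]) (auto intro!: continuous_intros)
    ultimately show ?thesis unfolding d_def by (intro continuous_intros) (use m in auto)
  qed
  moreover have "finite (range d)"
    by (rule finite_subset[OF _ finite_roots_unity[of m]]) (use dm m in auto)
  ultimately have "d constant_on UNIV"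
    by (intro continuous_finite_range_constant) auto
  then have "d w = d 0" by (auto simp: constant_on_def)
  also have "d 0 = 1" by (simp add: d_def \<Psi>0 charf_def prob_space)
  finally show ?thesis by (simp add: d_def m_def exp_minus field_simps del: of_nat_Suc)
qed

text \<open>
  By independence the right-hand side is \<open>E (exp (u * T + v * X T))\<close>.  On the grid this expectation is a geometric
  series with ratio \<open>exp (z / (n+1))\<close>, where \<open>z = u - \<theta> + \<Psi> v\<close>, and the limit of its value is \<open>\<theta> / (- z)\<close>.
\<close>

lemma product_Psi:
  assumes \<Psi>: "is_characteristic_exponent M X \<Psi>" and u: "Re u = 0" and v: "Re v = 0"
  shows "of_real \<theta> / (of_real \<theta> - u - \<Psi> v) = Psi_plus M X T u v * Psi_minus M X T u v"
proof -
  obtain w where w: "v = \<i> * of_real w" using v by (metis complex_eq mult.commute of_real_0 add_0)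
  have \<Psi>1: "(\<integral>\<omega>. exp (v * of_real (X 1 \<omega>)) \<partial>M) = exp (\<Psi> v)"
    using \<Psi> v by (simp add: is_characteristic_exponent_def)
  have "norm (exp (\<Psi> v)) \<le> 1"
    using norm_charf_le[of 1 w] \<Psi>1 by (simp add: w charf_def mult_ac del: norm_exp_eq_Re)
  then have Re\<Psi>: "Re (\<Psi> v) \<le> 0" by simp
  define z where "z = u - of_real \<theta> + \<Psi> v"
  have z: "Re z < 0" using u Re\<Psi> theta by (simp add: z_def)
  have "(\<lambda>n. \<integral>\<omega>. exp (u * of_real (grid n (grid_index n (T \<omega>))) + v * of_real (X (grid n (grid_index n (T \<omega>))) \<omega>)) \<partial>M)
      \<longlonglongrightarrow> (\<integral>\<omega>. exp (u * of_real (T \<omega>) + v * of_real (X (T \<omega>) \<omega>)) \<partial>M)"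
  proof (rule integral_dominated_convergence[where w = "\<lambda>_. 1"])
    have [measurable]: "(\<lambda>\<omega>. X (T \<omega>) \<omega>) \<in> borel_measurable M" by (rule X_T_measurable)
    show "(\<lambda>\<omega>. exp (u * of_real (T \<omega>) + v * of_real (X (T \<omega>) \<omega>))) \<in> borel_measurable M" by measurable
    show "(\<lambda>\<omega>. exp (u * of_real (grid n (grid_index n (T \<omega>))) + v * of_real (X (grid n (grid_index n (T \<omega>))) \<omega>))) \<in> borel_measurable M" for n
      by (rule measurable_compose_countable[where f = "\<lambda>j \<omega>. exp (u * of_real (grid n j) + v * of_real (X (grid n j) \<omega>))"]) measurable
    show "AE \<omega> in M. (\<lambda>n. exp (u * of_real (grid n (grid_index n (T \<omega>))) + v * of_real (X (grid n (grid_index n (T \<omega>))) \<omega>)))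
        \<longlonglongrightarrow> exp (u * of_real (T \<omega>) + v * of_real (X (T \<omega>) \<omega>))"
    proof (rule AE_I2)
      fix \<omega> assume \<omega>: "\<omega> \<in> space M"
      note x = path_cadlag[OF \<omega>] and t = time_nonneg[OF \<omega>]
      have "(\<lambda>n. X (grid n (grid_index n (T \<omega>))) \<omega>) \<longlonglongrightarrow> X (T \<omega>) \<omega>"
        by (rule cadlag_tendsto_right[OF x t _ grid_index_tendsto[OF t]])
           (use grid_index_bounds(1)[OF t] in \<open>auto intro: less_imp_le\<close>)
      then show "(\<lambda>n. exp (u * of_real (grid n (grid_index n (T \<omega>))) + v * of_real (X (grid n (grid_index n (T \<omega>))) \<omega>)))
        \<longlonglongrightarrow> exp (u * of_real (T \<omega>) + v * of_real (X (T \<omega>) \<omega>))"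
        by (intro tendsto_intros grid_index_tendsto[OF t])
    qed
  qed (use u v in auto)
  moreover have "(\<integral>\<omega>. exp (u * of_real (grid n (grid_index n (T \<omega>))) + v * of_real (X (grid n (grid_index n (T \<omega>))) \<omega>)) \<partial>M)
      = of_real ((1 - survival n) / survival n) * (exp (z / of_nat (Suc n)) / (1 - exp (z / of_nat (Suc n))))" for n
  proof -
    let ?r = "exp (z / of_nat (Suc n))"
    have r: "norm ?r < 1" using z by (simp add: divide_neg_pos del: of_nat_Suc)
    define G where "G m \<omega> = exp (u * of_real (grid n m) + v * of_real (walk \<omega> m))" for m \<omega>
    have G_meas: "G m \<in> borel_measurable (\<Pi>\<^sub>M i\<in>UNIV. borel)" for m
      unfolding G_def[abs_def] walk_def by measurable
    have "norm (G m \<omega>) \<le> 1" for m \<omega> using u v by (simp add: G_def)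
    from grid_expectation[OF G_meas this, of n 0]
    have s: "(\<lambda>j. of_real ((1 - survival n) * survival n ^ j) * (\<integral>w. G (Suc j) w \<partial>(\<Pi>\<^sub>M i\<in>UNIV. step_law n 0)))
        sums (\<integral>\<omega>. G (grid_index n (T \<omega>)) (steps n 0 \<omega>) \<partial>M)" .
    have summand: "of_real ((1 - survival n) * survival n ^ j) * (\<integral>w. G (Suc j) w \<partial>(\<Pi>\<^sub>M i\<in>UNIV. step_law n 0))
        = of_real ((1 - survival n) / survival n) * ?r ^ Suc j" for j
    proof -
      have "(\<integral>w. G m w \<partial>(\<Pi>\<^sub>M i\<in>UNIV. step_law n 0)) = exp (u * of_real (grid n m)) * exp (\<Psi> v / of_nat (Suc n)) ^ m" for m
      proof -
        have "(\<integral>w. G m w \<partial>(\<Pi>\<^sub>M i\<in>UNIV. step_law n 0)) = exp (u * of_real (grid n m)) * (\<integral>\<omega>. iexp (w * walk \<omega> m) \<partial>(\<Pi>\<^sub>M i\<in>UNIV. step_law n 0))"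
          unfolding G_def by (simp add: exp_add w mult_ac)
        also have "(\<integral>\<omega>. iexp (w * walk \<omega> m) \<partial>(\<Pi>\<^sub>M i\<in>UNIV. step_law n 0)) = (\<integral>\<omega>. iexp (w * walk \<omega> 1) \<partial>(\<Pi>\<^sub>M i\<in>UNIV. step_law n 0)) ^ m"
          by (rule W.char_walk)
        also have "(\<integral>\<omega>. iexp (w * walk \<omega> 1) \<partial>(\<Pi>\<^sub>M i\<in>UNIV. step_law n 0)) = (\<integral>\<omega>. iexp (w * walk (steps n 0 \<omega>) 1) \<partial>M)"
          by (rule integral_steps[symmetric, where G = "\<lambda>\<omega>. iexp (w * walk \<omega> 1)"]) (unfold walk_def, measurable)
        also have "\<dots> = charf (1 / real (Suc n)) w"
          unfolding charf_def by (rule Bochner_Integration.integral_cong) (auto simp: walk_steps tilted_def grid_def)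
        also have "\<dots> = exp (\<Psi> v / of_nat (Suc n))" unfolding charf_root[OF \<Psi>] w ..
        finally show ?thesis .
      qed
      then have "of_real ((1 - survival n) * survival n ^ j) * (\<integral>w. G (Suc j) w \<partial>(\<Pi>\<^sub>M i\<in>UNIV. step_law n 0))
          = of_real ((1 - survival n) / survival n) * (exp (u * of_real (grid n (Suc j))) * of_real (survival n) ^ Suc j * exp (\<Psi> v / of_nat (Suc n)) ^ Suc j)"
        using survival(1)[of n] by (simp add: field_simps)
      also have "exp (u * of_real (grid n (Suc j))) * of_real (survival n) ^ Suc j * exp (\<Psi> v / of_nat (Suc n)) ^ Suc j = ?r ^ Suc j"
        unfolding exp_shift power_mult_distrib[symmetric] exp_add[symmetric] z_def by (simp add: add_divide_distrib)
      finally show ?thesis .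
    qed
    have "(\<lambda>j. ?r ^ j * ?r) sums (1 / (1 - ?r) * ?r)"
      by (intro sums_mult2 geometric_sums r)
    then have "(\<lambda>j. of_real ((1 - survival n) / survival n) * ?r ^ Suc j) sums
        (of_real ((1 - survival n) / survival n) * (?r / (1 - ?r)))"
      by (intro sums_mult) (simp add: mult.commute)
    from sums_unique2[OF s[unfolded summand] this]
    have "(\<integral>\<omega>. G (grid_index n (T \<omega>)) (steps n 0 \<omega>) \<partial>M) = of_real ((1 - survival n) / survival n) * (?r / (1 - ?r))" .
    moreover have "(\<integral>\<omega>. G (grid_index n (T \<omega>)) (steps n 0 \<omega>) \<partial>M) =
        (\<integral>\<omega>. exp (u * of_real (grid n (grid_index n (T \<omega>))) + v * of_real (X (grid n (grid_index n (T \<omega>))) \<omega>)) \<partial>M)"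
      by (rule Bochner_Integration.integral_cong) (auto simp: G_def walk_steps tilted_def)
    ultimately show ?thesis by simp
  qed
  moreover have "(\<lambda>n. of_real ((1 - survival n) / survival n) * (exp (z / of_nat (Suc n)) / (1 - exp (z / of_nat (Suc n)))))
      \<longlonglongrightarrow> of_real \<theta> / (- z)"
  proof -
    have num: "(\<lambda>n. of_nat (Suc n) * (exp ((- of_real \<theta>) / of_nat (Suc n)) - 1)) \<longlonglongrightarrow> - complex_of_real \<theta>"
      by (rule exp_increment_limit)
    have den: "(\<lambda>n. of_nat (Suc n) * (exp (z / of_nat (Suc n)) - 1)) \<longlonglongrightarrow> z" by (rule exp_increment_limit)
    have sv: "(\<lambda>n. complex_of_real (survival n)) \<longlonglongrightarrow> of_real 1" by (intro tendsto_of_real survival_tendsto)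
    have "(\<lambda>n. z * of_real (inverse (real (Suc n)))) \<longlonglongrightarrow> z * of_real 0"
      by (intro tendsto_intros LIMSEQ_inverse_real_of_nat)
    then have ez: "(\<lambda>n. exp (z / of_nat (Suc n))) \<longlonglongrightarrow> exp 0"
      by (intro tendsto_exp) (simp add: divide_inverse)
    have "(\<lambda>n. (- (of_nat (Suc n) * (exp ((- of_real \<theta>) / of_nat (Suc n)) - 1))) / of_real (survival n) *
        (exp (z / of_nat (Suc n)) / (- (of_nat (Suc n) * (exp (z / of_nat (Suc n)) - 1)))))
        \<longlonglongrightarrow> (- (- complex_of_real \<theta>)) / of_real 1 * (exp 0 / (- z))"
      using z by (intro tendsto_intros num den sv ez) auto
    moreover have "(- (of_nat (Suc n) * (exp ((- of_real \<theta>) / of_nat (Suc n)) - 1))) / of_real (survival n) *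
        (exp (z / of_nat (Suc n)) / (- (of_nat (Suc n) * (exp (z / of_nat (Suc n)) - 1))))
        = of_real ((1 - survival n) / survival n) * (exp (z / of_nat (Suc n)) / (1 - exp (z / of_nat (Suc n))))" for n
    proof -
      have "(- (of_nat (Suc n) * (S - 1))) / S * (r / (- (of_nat (Suc n) * (r - 1)))) = (1 - S) / S * (r / (1 - r))"
        for S r :: complex
      proof -
        have "- (of_nat (Suc n) * (S - 1)) = of_nat (Suc n) * (1 - S)" "- (of_nat (Suc n) * (r - 1)) = of_nat (Suc n) * (1 - r)"
          by (simp_all add: algebra_simps)
        then show ?thesis by (simp del: of_nat_Suc)
      qed
      then show ?thesis unfolding survival_conv_exp[symmetric] by simp
    qed
    ultimately show ?thesis by simp
  qed
  ultimately have total: "(\<integral>\<omega>. exp (u * of_real (T \<omega>) + v * of_real (X (T \<omega>) \<omega>)) \<partial>M) = of_real \<theta> / (- z)"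
    by (simp add: LIMSEQ_unique)
  define f where "f t x = exp (u * complex_of_real t + v * of_real x)" for t x
  have f: "continuous_on UNIV (\<lambda>(t, x). f t x)" "\<And>t x. norm (f t x) \<le> 1"
    unfolding f_def case_prod_unfold using u v by (auto intro!: continuous_intros)
  have "(\<integral>\<omega>. case_prod f (pre_sup \<omega>) * case_prod f (post_sup \<omega>) \<partial>M) = Psi_plus M X T u v * Psi_minus M X T u v"
    unfolding expectation_product[OF f f] by (simp add: Psi_plus_def Psi_minus_def f_def pre_sup_def post_sup_def)
  moreover have "case_prod f (pre_sup \<omega>) * case_prod f (post_sup \<omega>) = exp (u * of_real (T \<omega>) + v * of_real (X (T \<omega>) \<omega>))" for \<omega>
    by (simp add: f_def pre_sup_def post_sup_def exp_add[symmetric] algebra_simps)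
  ultimately show ?thesis using total by (simp add: z_def algebra_simps)
qed

end

section \<open>Laplace transforms on a quadrant\<close>

text \<open>
  The sign \<open>\<sigma> = 1\<close> is for the vector before the supremum, \<open>\<sigma> = - 1\<close> for the vector after it, whose space
  component is nonpositive.
\<close>

definition quadrant :: "real \<Rightarrow> (real \<times> real) set" where
  "quadrant \<sigma> = {y. 0 \<le> fst y \<and> 0 \<le> \<sigma> * snd y}"

text \<open>
  The integrand of the Laplace transform on \<open>quadrant \<sigma>\<close>.
\<close>

definition decay :: "real \<Rightarrow> real \<Rightarrow> real \<Rightarrow> real \<times> real \<Rightarrow> real" where
  "decay \<sigma> a b y = exp (- (a * fst y + b * (\<sigma> * snd y)))"

lemma decay_measurable [measurable]: "decay \<sigma> a b \<in> borel_measurable borel"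
  unfolding decay_def[abs_def] by (intro borel_measurable_continuous_onI continuous_intros)

lemma fst_snd_borel: "fst \<in> borel_measurable (borel :: (real \<times> real) measure)"
  "snd \<in> borel_measurable (borel :: (real \<times> real) measure)"
  by (intro borel_measurable_continuous_onI continuous_intros)+

lemma quadrant_borel: "quadrant \<sigma> \<in> sets borel"
  unfolding quadrant_def by (intro borel_closed closed_Collect_conj closed_Collect_le continuous_intros)

lemma decay_pos: "0 < decay \<sigma> a b y" by (simp add: decay_def)

lemma decay_le_1: "y \<in> quadrant \<sigma> \<Longrightarrow> 0 \<le> a \<Longrightarrow> 0 \<le> b \<Longrightarrow> decay \<sigma> a b y \<le> 1"
  by (simp only: decay_def quadrant_def mem_Collect_eq exp_le_one_iff neg_le_0_iff_le
      add_nonneg_nonneg mult_nonneg_nonneg)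

lemma decay_add: "decay \<sigma> a b (x + y) = decay \<sigma> a b x * decay \<sigma> a b y"
  by (simp add: decay_def exp_add[symmetric] algebra_simps)

lemma decay_zero [simp]: "decay \<sigma> a b 0 = 1" by (simp add: decay_def)

lemma decay_sum: "decay \<sigma> a b (\<Sum>i\<in>I. y i) = (\<Prod>i\<in>I. decay \<sigma> a b (y i))"
proof (cases "finite I")
  case True
  then show ?thesis
    by induction (simp_all add: decay_add)
qed simp

lemma quadrant_sum: "(\<And>i. i \<in> I \<Longrightarrow> y i \<in> quadrant \<sigma>) \<Longrightarrow> (\<Sum>i\<in>I. y i) \<in> quadrant \<sigma>"
  by (auto simp: quadrant_def fst_sum snd_sum sum_distrib_left intro!: sum_nonneg)

definition quadrant_law :: "real \<Rightarrow> (real \<times> real) measure \<Rightarrow> bool" where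
  "quadrant_law \<sigma> \<mu> \<longleftrightarrow> prob_space \<mu> \<and> sets \<mu> = sets borel \<and> (AE y in \<mu>. y \<in> quadrant \<sigma>)"

lemma quadrant_law_return: "quadrant_law \<sigma> (return borel 0)"
proof -
  have "AE y in return borel 0. y \<in> quadrant \<sigma>"
    by (subst AE_return) (use quadrant_borel[of \<sigma>] in \<open>simp_all add: pred_def quadrant_def\<close>)
  then show ?thesis by (simp add: quadrant_law_def prob_space_return)
qed

lemma quadrant_law_decay:
  assumes "quadrant_law \<sigma> \<mu>" "0 \<le> a" "0 \<le> b"
  shows "integrable \<mu> (decay \<sigma> a b)" "0 \<le> (\<integral>y. decay \<sigma> a b y \<partial>\<mu>)" "(\<integral>y. decay \<sigma> a b y \<partial>\<mu>) \<le> 1"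
proof -
  interpret prob_space \<mu> using assms by (simp add: quadrant_law_def)
  have [measurable_cong]: "sets \<mu> = sets borel" and ae: "AE y in \<mu>. y \<in> quadrant \<sigma>"
    using assms by (auto simp: quadrant_law_def)
  have le: "AE y in \<mu>. decay \<sigma> a b y \<le> 1"
    using ae by eventually_elim (use decay_le_1 assms in auto)
  show int: "integrable \<mu> (decay \<sigma> a b)"
    by (rule integrable_const_bound[of _ 1]) (use le decay_pos in \<open>auto simp: abs_of_pos\<close>)
  show "0 \<le> (\<integral>y. decay \<sigma> a b y \<partial>\<mu>)"
    by (intro integral_nonneg_AE) (auto simp: decay_pos less_imp_le)
  have "(\<integral>y. decay \<sigma> a b y \<partial>\<mu>) \<le> (\<integral>y. 1 \<partial>\<mu>)"
    using int le by (intro integral_mono_AE) auto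
  then show "(\<integral>y. decay \<sigma> a b y \<partial>\<mu>) \<le> 1" by (simp add: prob_space)
qed

lemma quadrant_law_distr:
  assumes "prob_space M" and [measurable]: "f \<in> borel_measurable M" and "AE \<omega> in M. f \<omega> \<in> quadrant \<sigma>"
  shows "quadrant_law \<sigma> (distr M borel f)"
  using assms quadrant_borel[of \<sigma>]
  by (simp add: quadrant_law_def AE_distr_iff prob_space.prob_space_distr)

text \<open>
  The algebra of polynomial functions in two variables.
\<close>

inductive bipolynomial :: "(real \<times> real \<Rightarrow> real) \<Rightarrow> bool" where
  monomial: "bipolynomial (\<lambda>z. fst z ^ j * snd z ^ k)"
| add: "bipolynomial f \<Longrightarrow> bipolynomial g \<Longrightarrow> bipolynomial (\<lambda>z. f z + g z)"
| cmult: "bipolynomial f \<Longrightarrow> bipolynomial (\<lambda>z. c * f z)"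

lemma bipolynomial_mult:
  assumes "bipolynomial f" "bipolynomial g" shows "bipolynomial (\<lambda>z. f z * g z)"
  using assms(1)
proof induction
  case (monomial j k)
  show ?case
    using assms(2)
  proof induction
    case (monomial j' k')
    have "bipolynomial (\<lambda>z. fst z ^ (j + j') * snd z ^ (k + k'))" by (rule bipolynomial.monomial)
    then show ?case by (simp add: power_add mult_ac)
  next
    case (add f g)
    from bipolynomial.add[OF add.IH] show ?case by (simp add: distrib_left)
  next
    case (cmult f c)
    from bipolynomial.cmult[OF cmult.IH, of c] show ?case by (simp add: mult_ac)
  qed
next
  case (add f g)
  from bipolynomial.add[OF add.IH] show ?case by (simp add: distrib_right)
next
  case (cmult f c)
  from bipolynomial.cmult[OF cmult.IH, of c] show ?case by (simp add: mult_ac)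
qed

lemma bipolynomial_const: "bipolynomial (\<lambda>z. c)"
  using bipolynomial.cmult[OF bipolynomial.monomial[of 0 0], of c] by simp

lemma bipolynomial_dense:
  fixes f :: "real \<times> real \<Rightarrow> real"
  assumes "continuous_on ({0..1} \<times> {0..1}) f" "0 < \<epsilon>"
  shows "\<exists>g. bipolynomial g \<and> (\<forall>z\<in>{0..1} \<times> {0..1}. \<bar>f z - g z\<bar> < \<epsilon>)"
proof (rule Stone_Weierstrass_HOL[where P = bipolynomial, OF _ _ _ _ _ _ assms])
  show "compact ({0..1::real} \<times> {0..1::real})" by (intro compact_Times compact_Icc)
  show "bipolynomial (\<lambda>x. c)" for c by (rule bipolynomial_const)
  show "continuous_on ({0..1} \<times> {0..1}) g" if "bipolynomial g" for g
    using that by induction (auto intro!: continuous_intros)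
  show "bipolynomial (\<lambda>x. f x + g x)" if "bipolynomial f \<and> bipolynomial g" for f g
    using that by (auto intro: bipolynomial.add)
  show "bipolynomial (\<lambda>x. f x * g x)" if "bipolynomial f \<and> bipolynomial g" for f g
    using that by (auto intro: bipolynomial_mult)
  have "bipolynomial fst" "bipolynomial snd"
    using bipolynomial.monomial[of 1 0] bipolynomial.monomial[of 0 1] by simp_all
  then show "\<exists>g. bipolynomial g \<and> g x \<noteq> g y" if "x \<in> {0..1} \<times> {0..1} \<and> y \<in> {0..1} \<times> {0..1} \<and> x \<noteq> y" for x y
    using that prod_eqI[of x y] by blast
qed

text \<open>
  The map \<open>y \<mapsto> (exp (- fst y), exp (- \<sigma> * snd y))\<close> embeds the quadrant into the unit square.  There the
  Laplace transforms at integers are the moments, and polynomials are dense in the continuous functions.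
\<close>

lemma laplace_uniqueness:
  assumes \<sigma>: "\<sigma> * \<sigma> = 1" and \<mu>: "quadrant_law \<sigma> \<mu>" and \<nu>: "quadrant_law \<sigma> \<nu>"
    and eq: "\<And>(j::nat) (k::nat). (\<integral>y. decay \<sigma> j k y \<partial>\<mu>) = (\<integral>y. decay \<sigma> j k y \<partial>\<nu>)"
  shows "\<mu> = \<nu>"
proof -
  define \<phi> :: "real \<times> real \<Rightarrow> real \<times> real" where "\<phi> y = (exp (- fst y), exp (- (\<sigma> * snd y)))" for y
  define \<psi> :: "real \<times> real \<Rightarrow> real \<times> real" where "\<psi> z = (- ln (fst z), - (\<sigma> * ln (snd z)))" for z
  have \<phi>m [measurable]: "\<phi> \<in> borel_measurable borel" and \<psi>m [measurable]: "\<psi> \<in> borel_measurable borel"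
    unfolding \<phi>_def[abs_def] \<psi>_def[abs_def] borel_prod[symmetric] by measurable
  have \<psi>\<phi>: "\<psi> (\<phi> y) = y" for y
    using \<sigma> by (cases y) (simp add: \<phi>_def \<psi>_def mult.assoc[symmetric])
  have \<phi>_quadrant: "\<phi> y \<in> {0..1} \<times> {0..1}" if "y \<in> quadrant \<sigma>" for y
    using that by (simp add: quadrant_def \<phi>_def)
  have mono: "fst (\<phi> y) ^ j * snd (\<phi> y) ^ k = decay \<sigma> j k y" for y j k
    by (simp add: \<phi>_def decay_def exp_of_nat_mult[symmetric] exp_add[symmetric])
  have poly: "integrable \<rho> (\<lambda>y. g (\<phi> y))" if "quadrant_law \<sigma> \<rho>" "bipolynomial g" for g \<rho>
    using that(2) by induction (use quadrant_law_decay(1)[OF that(1)] in \<open>simp_all add: mono\<close>)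
  have poly_eq: "(\<integral>y. g (\<phi> y) \<partial>\<mu>) = (\<integral>y. g (\<phi> y) \<partial>\<nu>)" if "bipolynomial g" for g
    using that
  proof induction
    case (add f g)
    then show ?case using poly[OF \<mu>] poly[OF \<nu>] by simp
  qed (simp_all add: mono eq)
  have "distr \<mu> borel \<phi> = distr \<nu> borel \<phi>"
  proof (rule measure_eqI_continuous)
    interpret \<mu>: prob_space \<mu> using \<mu> by (simp add: quadrant_law_def)
    interpret \<nu>: prob_space \<nu> using \<nu> by (simp add: quadrant_law_def)
    have [measurable_cong]: "sets \<mu> = sets borel" "sets \<nu> = sets borel"
      using \<mu> \<nu> by (auto simp: quadrant_law_def)
    show "prob_space (distr \<mu> borel \<phi>)" by (rule \<mu>.prob_space_distr) measurable
    show "prob_space (distr \<nu> borel \<phi>)" by (rule \<nu>.prob_space_distr) measurable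
    fix f :: "real \<times> real \<Rightarrow> real"
    assume f: "continuous_on UNIV f" "\<And>x. 0 \<le> f x" "\<And>x. f x \<le> 1"
    have [measurable]: "f \<in> borel_measurable borel" by (rule borel_measurable_continuous_onI[OF f(1)])
    have approx: "\<bar>(\<integral>y. f (\<phi> y) \<partial>\<rho>) - (\<integral>y. g (\<phi> y) \<partial>\<rho>)\<bar> \<le> \<epsilon>"
      if \<rho>: "quadrant_law \<sigma> \<rho>" and g: "bipolynomial g" "\<forall>z\<in>{0..1} \<times> {0..1}. \<bar>f z - g z\<bar> < \<epsilon>" for \<rho> g \<epsilon>
    proof -
      interpret \<rho>: prob_space \<rho> using \<rho> by (simp add: quadrant_law_def)
      have [measurable_cong]: "sets \<rho> = sets borel" and ae: "AE y in \<rho>. y \<in> quadrant \<sigma>"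
        using \<rho> by (auto simp: quadrant_law_def)
      have intf: "integrable \<rho> (\<lambda>y. f (\<phi> y))"
        by (rule \<rho>.integrable_const_bound[of _ 1]) (use f in auto)
      have "\<bar>(\<integral>y. f (\<phi> y) \<partial>\<rho>) - (\<integral>y. g (\<phi> y) \<partial>\<rho>)\<bar> = \<bar>\<integral>y. f (\<phi> y) - g (\<phi> y) \<partial>\<rho>\<bar>"
        using intf poly[OF \<rho> g(1)] by simp
      also have "\<dots> \<le> (\<integral>y. \<bar>f (\<phi> y) - g (\<phi> y)\<bar> \<partial>\<rho>)" by (rule integral_abs_bound)
      also have "\<dots> \<le> (\<integral>y. \<epsilon> \<partial>\<rho>)"
      proof (rule integral_mono_AE)
        show "AE y in \<rho>. \<bar>f (\<phi> y) - g (\<phi> y)\<bar> \<le> \<epsilon>"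
          using ae by eventually_elim (rule less_imp_le, rule bspec[OF g(2) \<phi>_quadrant])
      qed (use intf poly[OF \<rho> g(1)] in auto)
      finally show ?thesis by (simp add: \<rho>.prob_space)
    qed
    have close: "\<bar>(\<integral>y. f (\<phi> y) \<partial>\<mu>) - (\<integral>y. f (\<phi> y) \<partial>\<nu>)\<bar> \<le> 2 * \<epsilon>" if eps: "0 < \<epsilon>" for \<epsilon>
    proof -
      obtain g where g: "bipolynomial g" "\<forall>z\<in>{0..1} \<times> {0..1}. \<bar>f z - g z\<bar> < \<epsilon>"
        using bipolynomial_dense[OF continuous_on_subset[OF f(1) subset_UNIV] eps] by blast
      show ?thesis using approx[OF \<mu> g] approx[OF \<nu> g] poly_eq[OF g(1)] by linarith
    qed
    have "\<bar>(\<integral>y. f (\<phi> y) \<partial>\<mu>) - (\<integral>y. f (\<phi> y) \<partial>\<nu>)\<bar> \<le> 0"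
    proof (rule field_le_epsilon)
      fix \<epsilon> :: real assume "0 < \<epsilon>"
      then show "\<bar>(\<integral>y. f (\<phi> y) \<partial>\<mu>) - (\<integral>y. f (\<phi> y) \<partial>\<nu>)\<bar> \<le> 0 + \<epsilon>"
        using close[of "\<epsilon> / 2"] by simp
    qed
    then show "(\<integral>x. f x \<partial>distr \<mu> borel \<phi>) = (\<integral>x. f x \<partial>distr \<nu> borel \<phi>)"
      by (simp add: integral_distr)
  qed auto
  then have images: "distr (distr \<mu> borel \<phi>) borel \<psi> = distr (distr \<nu> borel \<phi>) borel \<psi>" by simp
  have "distr (distr \<rho> borel \<phi>) borel \<psi> = \<rho>" if "quadrant_law \<sigma> \<rho>" for \<rho>
  proof -
    have s [measurable_cong]: "sets \<rho> = sets borel" using that by (simp add: quadrant_law_def)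
    have "distr (distr \<rho> borel \<phi>) borel \<psi> = distr \<rho> borel (\<lambda>y. y)"
      by (subst distr_distr) (auto simp: o_def \<psi>\<phi>)
    also have "\<dots> = \<rho>" using s by (intro distr_id2) simp
    finally show ?thesis .
  qed
  from box_equals[OF images this[OF \<mu>] this[OF \<nu>]] show ?thesis .
qed

lemma integral_prod_decay:
  assumes D: "\<And>i. quadrant_law \<sigma> (D i)" and ab: "0 \<le> a" "0 \<le> b" and J: "finite J" "J \<subseteq> I"
  shows "(\<integral>\<omega>. decay \<sigma> a b (\<Sum>i\<in>J. \<omega> i) \<partial>Pi\<^sub>M I D) = (\<Prod>i\<in>J. \<integral>y. decay \<sigma> a b y \<partial>D i)"
proof -
  interpret P: product_prob_space D I
    using D by (auto intro!: product_prob_spaceI simp: quadrant_law_def)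
  have [measurable_cong]: "sets (D i) = sets borel" for i using D by (simp add: quadrant_law_def)
  have "(\<integral>\<omega>. decay \<sigma> a b (\<Sum>i\<in>J. \<omega> i) \<partial>Pi\<^sub>M I D) = (\<integral>\<omega>. (\<Prod>i\<in>J. decay \<sigma> a b (\<omega> i)) \<partial>Pi\<^sub>M J D)"
  proof -
    have "(\<integral>\<omega>. (\<Prod>i\<in>J. decay \<sigma> a b (\<omega> i)) \<partial>Pi\<^sub>M J D)
        = (\<integral>\<omega>. (\<Prod>i\<in>J. decay \<sigma> a b (restrict \<omega> J i)) \<partial>Pi\<^sub>M I D)"
      by (subst P.distr_PiM_restrict_finite[OF J, symmetric], subst integral_distr)
         (use J in \<open>auto intro!: measurable_restrict_subset\<close>)
    then show ?thesis by (simp add: decay_sum)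
  qed
  also have "\<dots> = (\<Prod>i\<in>J. \<integral>y. decay \<sigma> a b y \<partial>D i)"
    using J by (intro P.product_integral_prod quadrant_law_decay(1)[OF D ab]) auto
  finally show ?thesis .
qed

lemma AE_quadrant_PiM:
  assumes D: "\<And>i. quadrant_law \<sigma> (D i)" and I: "countable I"
  shows "AE \<omega> in Pi\<^sub>M I D. \<forall>i\<in>I. \<omega> i \<in> quadrant \<sigma>"
  using D I by (auto simp: AE_ball_countable quadrant_law_def intro!: AE_PiM_component)

section \<open>Infinite divisibility\<close>

text \<open>
  The sum of a Poisson number of independent variables with law \<open>D\<close>: conditionally on the number \<open>n\<close> the transform
  is the \<open>n\<close>-th power of that of \<open>D\<close>, and the Poisson weights sum these powers to an exponential.
\<close>

lemma compound_poisson_exists: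
  assumes r: "0 \<le> r" and D: "quadrant_law \<sigma> D"
  shows "\<exists>C. quadrant_law \<sigma> C \<and> (\<forall>a\<ge>0. \<forall>b\<ge>0.
    (\<integral>y. decay \<sigma> a b y \<partial>C) = exp (- (r * (1 - (\<integral>y. decay \<sigma> a b y \<partial>D)))))"
proof (cases "r = 0")
  case True
  have "quadrant_law \<sigma> (return borel 0)" by (rule quadrant_law_return)
  then show ?thesis using True
    by (intro exI[of _ "return borel 0"]) (simp add: integral_return)
next
  case False
  with r have r: "0 < r" by simp
  interpret D: prob_space D using D by (simp add: quadrant_law_def)
  interpret S: sequence_space D ..
  have [measurable_cong]: "sets D = sets borel" using D by (simp add: quadrant_law_def)
  let ?S = "\<Pi>\<^sub>M i\<in>(UNIV :: nat set). D"
  let ?N = "measure_pmf (poisson_pmf r)"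
  interpret S': prob_space ?S by (rule S.P.prob_space_axioms)
  interpret N: prob_space ?N by (rule measure_pmf.prob_space_axioms)
  interpret P: pair_prob_space ?N ?S ..
  define f where "f p = (\<Sum>i<fst p. snd p i)" for p :: "nat \<times> (nat \<Rightarrow> real \<times> real)"
  have [measurable]: "(\<lambda>\<omega>. \<omega> i) \<in> borel_measurable ?S" for i
    using measurable_component_singleton[of i UNIV "\<lambda>_. D"] measurable_cong_sets[OF refl, of D borel] D
    by (auto simp: quadrant_law_def)
  have [measurable]: "f \<in> borel_measurable (?N \<Otimes>\<^sub>M ?S)"
    unfolding f_def[abs_def]
    by (rule measurable_compose_countable[where f = "\<lambda>n p. \<Sum>i<n. snd p i"]) measurable
  define C where "C = distr (?N \<Otimes>\<^sub>M ?S) borel f"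
  have aeS: "AE \<omega> in ?S. \<forall>i\<in>UNIV. \<omega> i \<in> quadrant \<sigma>" by (rule AE_quadrant_PiM[OF D]) simp
  have qm: "{y. y \<in> quadrant \<sigma>} \<in> sets borel" by (simp add: quadrant_borel)
  have f_quad: "AE p in ?N \<Otimes>\<^sub>M ?S. f p \<in> quadrant \<sigma>"
  proof (rule P.AE_pair_measure)
    show "{p \<in> space (?N \<Otimes>\<^sub>M ?S). f p \<in> quadrant \<sigma>} \<in> sets (?N \<Otimes>\<^sub>M ?S)"
      using measurable_sets[OF \<open>f \<in> borel_measurable (?N \<Otimes>\<^sub>M ?S)\<close> qm] by (simp add: vimage_def Int_def conj_commute)
    show "AE n in ?N. AE \<omega> in ?S. f (n, \<omega>) \<in> quadrant \<sigma>"
      using aeS by (auto simp: f_def elim!: eventually_mono intro!: quadrant_sum)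
  qed
  have C: "quadrant_law \<sigma> C"
    unfolding C_def by (rule quadrant_law_distr[OF P.prob_space_axioms _ f_quad]) measurable
  have "(\<integral>y. decay \<sigma> a b y \<partial>C) = exp (- (r * (1 - (\<integral>y. decay \<sigma> a b y \<partial>D))))" if ab: "0 \<le> a" "0 \<le> b" for a b
  proof -
    define L where "L = (\<integral>y. decay \<sigma> a b y \<partial>D)"
    have L: "0 \<le> L" "L \<le> 1" using quadrant_law_decay[OF D ab] by (auto simp: L_def)
    have inner: "(\<integral>\<omega>. decay \<sigma> a b (f (n, \<omega>)) \<partial>?S) = L ^ n" for n
      using integral_prod_decay[of \<sigma> "\<lambda>_. D" a b "{..<n}" UNIV] D ab by (simp add: f_def L_def)
    have "(\<integral>y. decay \<sigma> a b y \<partial>C) = (\<integral>p. decay \<sigma> a b (f p) \<partial>(?N \<Otimes>\<^sub>M ?S))"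
      unfolding C_def by (rule integral_distr) measurable
    also have "\<dots> = (\<integral>n. (\<integral>\<omega>. decay \<sigma> a b (f (n, \<omega>)) \<partial>?S) \<partial>?N)"
    proof (rule P.integral_fst'[symmetric])
      have "integrable C (decay \<sigma> a b)" by (rule quadrant_law_decay(1)[OF C ab])
      then show "integrable (?N \<Otimes>\<^sub>M ?S) (\<lambda>p. decay \<sigma> a b (f p))"
        unfolding C_def by (subst (asm) integrable_distr_eq) auto
    qed
    also have "\<dots> = (\<integral>n. L ^ n \<partial>?N)" unfolding inner ..
    also have "\<dots> = (\<integral>n. pmf (poisson_pmf r) n *\<^sub>R L ^ n \<partial>count_space UNIV)"
      unfolding measure_pmf_eq_density by (rule integral_density) auto
    also have "\<dots> = exp (- r) * exp (r * L)"
    proof -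
      have "(\<lambda>n. exp (- r) * ((r * L) ^ n /\<^sub>R fact n)) sums (exp (- r) * exp (r * L))"
        by (intro sums_mult exp_converges)
      moreover have "exp (- r) * ((r * L) ^ n /\<^sub>R fact n) = pmf (poisson_pmf r) n *\<^sub>R L ^ n" for n
        using r by (simp add: power_mult_distrib field_simps)
      ultimately have s: "(\<lambda>n. pmf (poisson_pmf r) n *\<^sub>R L ^ n) sums (exp (- r) * exp (r * L))" by simp
      moreover have "norm (pmf (poisson_pmf r) n *\<^sub>R L ^ n) = pmf (poisson_pmf r) n *\<^sub>R L ^ n" for n
        using L by simp
      ultimately have "integrable (count_space UNIV) (\<lambda>n. pmf (poisson_pmf r) n *\<^sub>R L ^ n)"
        unfolding integrable_count_space_nat_iff by (simp add: sums_iff)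
      from integral_count_space_nat[OF this] s show ?thesis by (simp add: sums_iff)
    qed
    also have "\<dots> = exp (- (r * (1 - L)))" by (simp add: exp_add[symmetric] algebra_simps)
    finally show ?thesis by (simp add: L_def)
  qed
  with C show ?thesis by (intro exI[of _ C] conjI allI impI)
qed

text \<open>
  Eventually \<open>x j\<close> is small, and then \<open>1 - exp (- x j)\<close> is at least \<open>x j / 2\<close>.
\<close>

lemma summable_of_one_minus_exp:
  fixes x :: "nat \<Rightarrow> real"
  assumes x: "\<And>j. 0 \<le> x j" and s: "summable (\<lambda>j. 1 - exp (- x j))"
  shows "summable x"
proof (rule summable_comparison_test_ev)
  show "summable (\<lambda>j. 2 * (1 - exp (- x j)))" using s by (rule summable_mult)
  \<comment> \<open>Equivalently \<open>exp (x j) < 2\<close>, the factor that compares \<open>exp (x j) - 1\<close> with \<open>1 - exp (- x j)\<close>.\<close>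
  have "\<forall>\<^sub>F j in sequentially. 1 - exp (- x j) < 1 / 2"
    by (rule order_tendstoD(2)[OF summable_LIMSEQ_zero[OF s]]) simp
  then show "\<forall>\<^sub>F j in sequentially. norm (x j) \<le> 2 * (1 - exp (- x j))"
  proof eventually_elim
    case (elim j)
    have "x j \<le> exp (x j) - 1" using exp_ge_add_one_self[of "x j"] by linarith
    also have "\<dots> = (1 - exp (- x j)) * exp (x j)" by (simp add: left_diff_distrib exp_add[symmetric])
    also have "\<dots> \<le> (1 - exp (- x j)) * 2"
    proof (rule mult_left_mono)
      have "1 / 2 < exp (- x j)" using elim by simp
      then show "exp (x j) \<le> 2" by (simp add: exp_minus field_simps)
    qed (use x in simp)
    finally show ?case using x[of j] by simp
  qed
qed

text \<open>
  The sum of independent variables with laws \<open>C j\<close>.  Convergence is read off the transforms: the sum of the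
  expectations of \<open>1 - decay \<sigma> 1 1\<close> is finite, hence almost surely these quantities are summable, and
  by \<open>summable_of_one_minus_exp\<close> so are the nonnegative exponents.
\<close>

lemma independent_sum_exists:
  fixes C :: "nat \<Rightarrow> (real \<times> real) measure" and q :: "nat \<Rightarrow> real \<Rightarrow> real \<Rightarrow> real"
  assumes \<sigma>: "\<sigma> * \<sigma> = 1" and C: "\<And>j. quadrant_law \<sigma> (C j)"
    and dec: "\<And>j a b. 0 \<le> a \<Longrightarrow> 0 \<le> b \<Longrightarrow> (\<integral>y. decay \<sigma> a b y \<partial>C j) = exp (- q j a b)"
    and q: "\<And>j a b. 0 \<le> a \<Longrightarrow> 0 \<le> b \<Longrightarrow> 0 \<le> q j a b"
    and sum: "\<And>a b. 0 \<le> a \<Longrightarrow> 0 \<le> b \<Longrightarrow> summable (\<lambda>j. q j a b)"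
  shows "\<exists>\<nu>. quadrant_law \<sigma> \<nu> \<and> (\<forall>a\<ge>0. \<forall>b\<ge>0. (\<integral>y. decay \<sigma> a b y \<partial>\<nu>) = exp (- (\<Sum>j. q j a b)))"
proof -
  let ?P = "Pi\<^sub>M UNIV C"
  interpret P: product_prob_space C UNIV
    using C by (auto intro!: product_prob_spaceI simp: quadrant_law_def)
  have sC [measurable_cong]: "sets (C j) = sets borel" for j using C by (simp add: quadrant_law_def)
  have comp [measurable]: "(\<lambda>\<omega>. \<omega> j) \<in> borel_measurable ?P" for j
    using measurable_component_singleton[of j UNIV C] measurable_cong_sets[OF refl sC] by auto
  have quad: "AE \<omega> in ?P. \<forall>j. \<omega> j \<in> quadrant \<sigma>" using AE_quadrant_PiM[where D = C and I = UNIV, OF C] by simp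
  define d where "d j \<omega> = 1 - decay \<sigma> 1 1 (\<omega> j)" for j and \<omega> :: "nat \<Rightarrow> real \<times> real"
  have [measurable]: "d j \<in> borel_measurable ?P" for j unfolding d_def[abs_def] by measurable
  have Ed: "(\<integral>\<^sup>+\<omega>. ennreal (d j \<omega>) \<partial>?P) \<le> ennreal (q j 1 1)" for j
  proof -
    have int: "integrable ?P (\<lambda>\<omega>. decay \<sigma> 1 1 (\<omega> j))"
      by (rule P.P.integrable_const_bound[of _ 1])
         (use quad in \<open>auto elim!: eventually_mono intro: decay_le_1 simp: abs_of_pos decay_pos\<close>)
    have nn: "AE \<omega> in ?P. 0 \<le> d j \<omega>"
      using quad by eventually_elim (auto simp: d_def intro: decay_le_1)
    have "(\<integral>\<^sup>+\<omega>. ennreal (d j \<omega>) \<partial>?P) = ennreal (\<integral>\<omega>. d j \<omega> \<partial>?P)"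
      by (rule nn_integral_eq_integral) (use int nn in \<open>auto simp: d_def\<close>)
    also have "(\<integral>\<omega>. d j \<omega> \<partial>?P) = 1 - exp (- q j 1 1)"
      using int integral_prod_decay[of \<sigma> C 1 1 "{j}" UNIV] C dec[of 1 1 j]
      by (simp add: d_def P.P.prob_space)
    also have "\<dots> \<le> q j 1 1" using exp_ge_add_one_self[of "- q j 1 1"] by simp
    finally show ?thesis by (simp add: ennreal_leI)
  qed
  have "(\<integral>\<^sup>+\<omega>. (\<Sum>j. ennreal (d j \<omega>)) \<partial>?P) = (\<Sum>j. \<integral>\<^sup>+\<omega>. ennreal (d j \<omega>) \<partial>?P)"
    by (rule nn_integral_suminf) measurable
  also have "\<dots> \<le> (\<Sum>j. ennreal (q j 1 1))" by (intro suminf_le Ed) auto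
  also have "\<dots> < \<infinity>"
    using sum[of 1 1] q[of 1 1] by (simp add: suminf_ennreal2)
  finally have "(\<integral>\<^sup>+\<omega>. (\<Sum>j. ennreal (d j \<omega>)) \<partial>?P) \<noteq> \<infinity>" by simp
  then have fin: "AE \<omega> in ?P. (\<Sum>j. ennreal (d j \<omega>)) \<noteq> \<infinity>"
    by (rule nn_integral_PInf_AE[rotated]) measurable
  define good where "good \<omega> \<longleftrightarrow> (\<forall>j. \<omega> j \<in> quadrant \<sigma>) \<and> summable (\<lambda>j. fst (\<omega> j)) \<and> summable (\<lambda>j. snd (\<omega> j))"
    for \<omega> :: "nat \<Rightarrow> real \<times> real"
  have good: "AE \<omega> in ?P. good \<omega>"
    using quad fin
  proof eventually_elim
    case (elim \<omega>)
    define x where "x j = fst (\<omega> j) + \<sigma> * snd (\<omega> j)" for j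
    have nn: "0 \<le> fst (\<omega> j)" "0 \<le> \<sigma> * snd (\<omega> j)" for j using elim(1) by (auto simp: quadrant_def)
    have d0: "0 \<le> d j \<omega>" for j using elim(1) decay_le_1[of "\<omega> j" \<sigma> 1 1] by (simp add: d_def)
    have "summable (\<lambda>j. d j \<omega>)" using summable_suminf_not_top[OF d0 elim(2)[unfolded infinity_ennreal_def]] .
    then have "summable (\<lambda>j. 1 - exp (- x j))" by (simp add: d_def decay_def x_def)
    then have "summable x"
      by (rule summable_of_one_minus_exp[rotated]) (use nn in \<open>simp add: x_def\<close>)
    then have s: "summable (\<lambda>j. fst (\<omega> j))" "summable (\<lambda>j. \<sigma> * snd (\<omega> j))"
      by (rule summable_comparison_test'[of _ 0], simp only: real_norm_def abs_of_nonneg[OF nn(1)] abs_of_nonneg[OF nn(2)] x_def le_add_same_cancel1 le_add_same_cancel2 nn)+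
    have "\<sigma> \<noteq> 0" using \<sigma> by auto
    then have "summable (\<lambda>j. snd (\<omega> j))" by (rule summable_mult_D[OF s(2)])
    with s elim show ?case by (simp add: good_def)
  qed
  define T where "T \<omega> = (\<Sum>j. fst (\<omega> j), \<Sum>j. snd (\<omega> j))" for \<omega> :: "nat \<Rightarrow> real \<times> real"
  have [measurable]: "T \<in> borel_measurable ?P"
  proof -
    have [measurable]: "(\<lambda>\<omega>. fst (\<omega> j)) \<in> borel_measurable ?P" "(\<lambda>\<omega>. snd (\<omega> j)) \<in> borel_measurable ?P" for j
      using measurable_compose[OF comp, of fst borel] measurable_compose[OF comp, of snd borel] fst_snd_borel by auto
    show ?thesis unfolding T_def[abs_def] by measurable
  qed
  have T_lim: "(\<lambda>n. \<Sum>j<n. \<omega> j) \<longlonglongrightarrow> T \<omega>" if "good \<omega>" for \<omega>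
  proof -
    have "(\<lambda>n. (\<Sum>j<n. fst (\<omega> j), \<Sum>j<n. snd (\<omega> j))) \<longlonglongrightarrow> T \<omega>"
      using that unfolding good_def T_def by (intro tendsto_Pair summable_LIMSEQ) auto
    moreover have "(\<Sum>j<n. fst (\<omega> j), \<Sum>j<n. snd (\<omega> j)) = (\<Sum>j<n. \<omega> j)" for n
      by (simp add: prod_eq_iff fst_sum snd_sum)
    ultimately show ?thesis by simp
  qed
  have T_quad: "T \<omega> \<in> quadrant \<sigma>" if "good \<omega>" for \<omega>
  proof -
    have "\<sigma> * (\<Sum>j. snd (\<omega> j)) = (\<Sum>j. \<sigma> * snd (\<omega> j))"
      using that by (simp add: good_def suminf_mult)
    moreover have "0 \<le> (\<Sum>j. \<sigma> * snd (\<omega> j))" "0 \<le> (\<Sum>j. fst (\<omega> j))"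
      using that by (auto simp: good_def quadrant_def intro!: suminf_nonneg summable_mult)
    ultimately show ?thesis by (simp add: T_def quadrant_def)
  qed
  define \<nu> where "\<nu> = distr ?P borel T"
  have "quadrant_law \<sigma> \<nu>"
    unfolding \<nu>_def
    by (rule quadrant_law_distr[OF P.P.prob_space_axioms]) (use good T_quad in \<open>auto elim: eventually_mono\<close>)
  moreover have "(\<integral>y. decay \<sigma> a b y \<partial>\<nu>) = exp (- (\<Sum>j. q j a b))" if ab: "0 \<le> a" "0 \<le> b" for a b
  proof -
    have "(\<lambda>n. \<integral>\<omega>. decay \<sigma> a b (\<Sum>j<n. \<omega> j) \<partial>?P) \<longlonglongrightarrow> (\<integral>\<omega>. decay \<sigma> a b (T \<omega>) \<partial>?P)"
    proof (rule integral_dominated_convergence[where w = "\<lambda>_. 1"])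
      show "AE \<omega> in ?P. (\<lambda>n. decay \<sigma> a b (\<Sum>j<n. \<omega> j)) \<longlonglongrightarrow> decay \<sigma> a b (T \<omega>)"
        using good by eventually_elim (auto simp: decay_def intro!: tendsto_intros T_lim)
      show "AE \<omega> in ?P. norm (decay \<sigma> a b (\<Sum>j<n. \<omega> j)) \<le> 1" for n
        using quad by eventually_elim (use ab decay_pos in \<open>auto simp: abs_of_pos intro!: decay_le_1 quadrant_sum\<close>)
    qed auto
    moreover have "(\<integral>\<omega>. decay \<sigma> a b (\<Sum>j<n. \<omega> j) \<partial>?P) = exp (- (\<Sum>j<n. q j a b))" for n
      using integral_prod_decay[of \<sigma> C a b "{..<n}" UNIV] C ab dec[OF ab] by (simp add: exp_sum sum_negf[symmetric])
    moreover have "(\<lambda>n. exp (- (\<Sum>j<n. q j a b))) \<longlonglongrightarrow> exp (- (\<Sum>j. q j a b))"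
      by (intro tendsto_intros summable_LIMSEQ sum[OF ab])
    ultimately have "(\<integral>\<omega>. decay \<sigma> a b (T \<omega>) \<partial>?P) = exp (- (\<Sum>j. q j a b))"
      by (simp add: LIMSEQ_unique)
    then show ?thesis unfolding \<nu>_def by (subst integral_distr) auto
  qed
  ultimately show ?thesis by blast
qed

text \<open>
  An exponent that is a sum of compound Poisson exponents can be divided by \<open>n\<close>: it suffices to divide the
  intensities \<open>r j\<close>.
\<close>

lemma infinitely_divisible_of_levy_exponent:
  fixes r :: "nat \<Rightarrow> real" and D :: "nat \<Rightarrow> (real \<times> real) measure"
  assumes \<sigma>: "\<sigma> * \<sigma> = 1" and \<mu>: "quadrant_law \<sigma> \<mu>"
    and r: "\<And>j. 0 \<le> r j" and D: "\<And>j. quadrant_law \<sigma> (D j)"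
    and dec: "\<And>a b. 0 \<le> a \<Longrightarrow> 0 \<le> b \<Longrightarrow> (\<lambda>j. r j * (1 - (\<integral>y. decay \<sigma> a b y \<partial>D j))) sums e a b"
      "\<And>a b. 0 \<le> a \<Longrightarrow> 0 \<le> b \<Longrightarrow> (\<integral>y. decay \<sigma> a b y \<partial>\<mu>) = exp (- e a b)"
  shows "infinitely_divisible \<mu>"
proof -
  have "\<exists>\<nu>. prob_space \<nu> \<and> sets \<nu> = sets borel \<and> \<mu> = distr (Pi\<^sub>M {..<n} (\<lambda>_. \<nu>)) borel (\<lambda>y. \<Sum>i<n. y i)"
    if n: "1 \<le> n" for n :: nat
  proof -
    define q where "q j a b = (r j / real n) * (1 - (\<integral>y. decay \<sigma> a b y \<partial>D j))" for j a b
    have "\<forall>j. \<exists>C. quadrant_law \<sigma> C \<and> (\<forall>a\<ge>0. \<forall>b\<ge>0. (\<integral>y. decay \<sigma> a b y \<partial>C) = exp (- q j a b))"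
    proof
      fix j
      have "0 \<le> r j / real n" using r by simp
      from compound_poisson_exists[OF this D[of j]]
      show "\<exists>C. quadrant_law \<sigma> C \<and> (\<forall>a\<ge>0. \<forall>b\<ge>0. (\<integral>y. decay \<sigma> a b y \<partial>C) = exp (- q j a b))"
        unfolding q_def .
    qed
    from choice[OF this] obtain C where C: "\<And>j. quadrant_law \<sigma> (C j)"
      "\<And>j a b. 0 \<le> a \<Longrightarrow> 0 \<le> b \<Longrightarrow> (\<integral>y. decay \<sigma> a b y \<partial>C j) = exp (- q j a b)" by blast
    have q0: "0 \<le> q j a b" if "0 \<le> a" "0 \<le> b" for j a b
      using quadrant_law_decay(3)[OF D that] r by (simp add: q_def)
    have qs: "(\<lambda>j. q j a b) sums (e a b / real n)" if "0 \<le> a" "0 \<le> b" for a b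
      using sums_divide[OF dec(1)[OF that], of "real n"] by (simp add: q_def)
    obtain \<nu> where \<nu>: "quadrant_law \<sigma> \<nu>"
      "\<And>a b. 0 \<le> a \<Longrightarrow> 0 \<le> b \<Longrightarrow> (\<integral>y. decay \<sigma> a b y \<partial>\<nu>) = exp (- (\<Sum>j. q j a b))"
      using independent_sum_exists[where q = q, OF \<sigma> C q0 sums_summable[OF qs]] by blast
    have sn [measurable_cong]: "sets \<nu> = sets borel" and pn: "prob_space \<nu>" using \<nu> by (auto simp: quadrant_law_def)
    interpret P: product_prob_space "\<lambda>_. \<nu>" "{..<n}" using pn by (intro product_prob_spaceI)
    have [measurable]: "(\<lambda>y. \<Sum>i<n. y i) \<in> borel_measurable (Pi\<^sub>M {..<n} (\<lambda>_. \<nu>))"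
    proof (rule borel_measurable_sum)
      fix i assume "i \<in> {..<n}"
      then show "(\<lambda>y. y i) \<in> borel_measurable (Pi\<^sub>M {..<n} (\<lambda>_. \<nu>))"
        using measurable_component_singleton[of i "{..<n}" "\<lambda>_. \<nu>"] measurable_cong_sets[OF refl sn] by auto
    qed
    let ?m = "distr (Pi\<^sub>M {..<n} (\<lambda>_. \<nu>)) borel (\<lambda>y. \<Sum>i<n. y i)"
    have m: "quadrant_law \<sigma> ?m"
      using AE_quadrant_PiM[of \<sigma> "\<lambda>_. \<nu>" "{..<n}"] \<nu>(1)
      by (intro quadrant_law_distr P.P.prob_space_axioms) (auto elim!: eventually_mono intro!: quadrant_sum)
    have "\<mu> = ?m"
    proof (rule laplace_uniqueness[OF \<sigma> \<mu> m])
      fix j k :: nat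
      have "(\<integral>y. decay \<sigma> j k y \<partial>?m) = (\<integral>y. decay \<sigma> j k y \<partial>\<nu>) ^ n"
        using integral_prod_decay[of \<sigma> "\<lambda>_. \<nu>" j k "{..<n}" "{..<n}"] \<nu>(1) by (subst integral_distr) auto
      also have "\<dots> = exp (- e j k)"
        using \<nu>(2)[of j k] qs[of j k] n by (simp add: exp_of_nat_mult[symmetric] sums_iff)
      finally show "(\<integral>y. decay \<sigma> j k y \<partial>\<mu>) = (\<integral>y. decay \<sigma> j k y \<partial>?m)" using dec(2)[of j k] by simp
    qed
    then show ?thesis using sn pn by blast
  qed
  then show ?thesis using \<mu> by (auto simp: infinitely_divisible_def quadrant_law_def)
qed

text \<open>
  Compound Poisson laws have a rate and a jump law, whereas the pieces of a measure of jumps come as finite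
  measures, which may be zero.
\<close>

lemma normalize_finite_measure:
  assumes \<rho>: "finite_measure \<rho>" "sets \<rho> = sets borel" "AE y in \<rho>. y \<in> quadrant \<sigma>"
  shows "\<exists>r D. 0 \<le> r \<and> quadrant_law \<sigma> D \<and> (\<forall>a b. 0 \<le> a \<longrightarrow> 0 \<le> b \<longrightarrow>
    r * (1 - (\<integral>y. decay \<sigma> a b y \<partial>D)) = (\<integral>y. 1 - decay \<sigma> a b y \<partial>\<rho>))"
proof -
  interpret finite_measure \<rho> by fact
  have [measurable_cong]: "sets \<rho> = sets borel" by fact
  define r where "r = measure \<rho> (space \<rho>)"
  show ?thesis
  proof (cases "r = 0")
    case True
    have "quadrant_law \<sigma> (return borel 0)" by (rule quadrant_law_return)
    moreover have "(\<integral>y. 1 - decay \<sigma> a b y \<partial>\<rho>) = 0" for a b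
    proof (rule integral_eq_zero_AE)
      have "space \<rho> \<in> null_sets \<rho>" using True by (auto simp: r_def null_sets_def emeasure_eq_measure)
      then show "AE y in \<rho>. 1 - decay \<sigma> a b y = 0" by (rule AE_I'[of "space \<rho>"]) auto
    qed
    ultimately show ?thesis by (intro exI[of _ 0] exI[of _ "return borel 0"]) simp
  next
    case False
    then have r: "0 < r" using measure_nonneg[of \<rho> "space \<rho>"] by (simp add: r_def less_le)
    define D where "D = density \<rho> (\<lambda>_. ennreal (1 / r))"
    have "emeasure D (space D) = ennreal (1 / r) * ennreal r"
      unfolding D_def by (simp add: emeasure_density emeasure_eq_measure r_def)
    also have "\<dots> = 1" using r by (simp add: ennreal_mult[symmetric])
    finally have "prob_space D" by (rule prob_spaceI)
    moreover have "AE y in D. y \<in> quadrant \<sigma>"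
      unfolding D_def using \<rho>(3) by (subst AE_density) auto
    moreover have "sets D = sets borel" by (simp add: D_def \<rho>(2))
    ultimately have D: "quadrant_law \<sigma> D" by (simp add: quadrant_law_def)
    have "r * (1 - (\<integral>y. decay \<sigma> a b y \<partial>D)) = (\<integral>y. 1 - decay \<sigma> a b y \<partial>\<rho>)" if ab: "0 \<le> a" "0 \<le> b" for a b
    proof -
      have int: "integrable \<rho> (decay \<sigma> a b)"
        by (rule integrable_const_bound[of _ 1])
           (use \<rho>(3) ab decay_pos decay_le_1 in \<open>auto elim!: eventually_mono simp: abs_of_pos\<close>)
      have "(\<integral>y. decay \<sigma> a b y \<partial>D) = (\<integral>y. (1 / r) *\<^sub>R decay \<sigma> a b y \<partial>\<rho>)"
        unfolding D_def by (rule integral_density) (use r in auto)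
      also have "\<dots> = (\<integral>y. decay \<sigma> a b y \<partial>\<rho>) / r" by simp
      finally show ?thesis using r int by (simp add: field_simps r_def)
    qed
    with D r show ?thesis by (intro exI[of _ r] exI[of _ D]) auto
  qed
qed

lemma floor_inverse_measurable: "(\<lambda>t::real. nat \<lfloor>1 / t\<rfloor>) \<in> measurable borel (count_space UNIV)"
  by measurable

context levy_exp_time
begin

text \<open>
  The difference of the integrands at \<open>(- a - \<theta>, - b)\<close> and \<open>(- \<theta>, 0)\<close> is the nonnegative function
  \<open>exp (- \<theta> * t) / t * (1 - decay \<sigma> a b (t, x))\<close>; the compensating term \<open>exp (- t)\<close> cancels.
\<close>

lemma decay_marginal:
  assumes A: "A \<in> sets borel" and sign: "\<And>x. x \<in> A \<Longrightarrow> \<bar>x\<bar> = \<sigma> * x" and ab: "0 \<le> a" "0 \<le> b" and t: "0 < t"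
  shows "Re (marginal A (- of_real a - of_real \<theta>) (- of_real b) 0 t) - Re (marginal A (- of_real \<theta>) 0 0 t) =
    exp (- (\<theta> * t)) / t * (\<integral>\<omega>. indicator A (X (max 0 t) \<omega>) * (1 - decay \<sigma> a b (t, X (max 0 t) \<omega>)) \<partial>M)"
proof -
  note A[measurable]
  have int: "integrable M (\<lambda>\<omega>. indicator A (X (max 0 t) \<omega>) *\<^sub>R phi_integrand c d t (X (max 0 t) \<omega>))"
    if "Re c \<le> 0" "Re d \<le> 0" for c d
  proof (rule integrable_const_bound[of _ "2 / t"])
    have "norm (indicator A x *\<^sub>R phi_integrand c d t x) \<le> 2 / t" for x
      using phi_integrand_bound_const[OF t that, of x] t by (simp add: indicator_def)
    then show "AE \<omega> in M. norm (indicator A (X (max 0 t) \<omega>) *\<^sub>R phi_integrand c d t (X (max 0 t) \<omega>)) \<le> 2 / t" by simp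
  qed measurable
  let ?p = "\<lambda>\<omega>. indicator A (X (max 0 t) \<omega>) *\<^sub>R phi_integrand (- of_real a - of_real \<theta>) (- of_real b) t (X (max 0 t) \<omega>)"
  let ?q = "\<lambda>\<omega>. indicator A (X (max 0 t) \<omega>) *\<^sub>R phi_integrand (- of_real \<theta>) 0 t (X (max 0 t) \<omega>)"
  have pq: "integrable M ?p" "integrable M ?q" using ab theta by (auto intro!: int)
  have "Re (marginal A (- of_real a - of_real \<theta>) (- of_real b) 0 t) - Re (marginal A (- of_real \<theta>) 0 0 t) =
      Re (\<integral>\<omega>. ?p \<omega> - ?q \<omega> \<partial>M)"
    using pq by (simp add: marginal_def)
  also have "\<dots> = (\<integral>\<omega>. Re (?p \<omega> - ?q \<omega>) \<partial>M)"
    using pq by (intro integral_Re[symmetric] Bochner_Integration.integrable_diff)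
  also have "\<dots> = (\<integral>\<omega>. exp (- (\<theta> * t)) / t * (indicator A (X (max 0 t) \<omega>) * (1 - decay \<sigma> a b (t, X (max 0 t) \<omega>))) \<partial>M)"
  proof (rule Bochner_Integration.integral_cong[OF refl])
    fix \<omega>
    have "phi_integrand (- of_real a - of_real \<theta>) (- of_real b) t x - phi_integrand (- of_real \<theta>) 0 t x
        = of_real (exp (- (\<theta> * t)) / t * (1 - decay \<sigma> a b (t, x)))" if "x \<in> A" for x
    proof -
      have "(- of_real a - of_real \<theta>) * of_real t + - of_real b * of_real \<bar>x\<bar> =
          complex_of_real (- (\<theta> * t) + - (a * t + b * (\<sigma> * x)))"
        by (simp add: sign[OF that] algebra_simps)
      then have 1: "exp ((- of_real a - of_real \<theta>) * of_real t + - of_real b * of_real \<bar>x\<bar>) =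
          complex_of_real (exp (- (\<theta> * t)) * decay \<sigma> a b (t, x))"
        by (simp only: exp_of_real exp_add decay_def fst_conv snd_conv)
      have "- of_real \<theta> * of_real t + 0 * of_real \<bar>x\<bar> = complex_of_real (- (\<theta> * t))" by simp
      then have 2: "exp (- of_real \<theta> * of_real t + 0 * of_real \<bar>x\<bar>) = complex_of_real (exp (- (\<theta> * t)))"
        by (simp only: exp_of_real)
      show ?thesis unfolding phi_integrand_def 1 2 by (simp add: diff_divide_distrib[symmetric] algebra_simps)
    qed
    from this[of "X (max 0 t) \<omega>"]
    show "Re (?p \<omega> - ?q \<omega>) = exp (- (\<theta> * t)) / t * (indicator A (X (max 0 t) \<omega>) * (1 - decay \<sigma> a b (t, X (max 0 t) \<omega>)))"
      by (cases "X (max 0 t) \<omega> \<in> A") (simp_all add: scaleR_diff_right[symmetric] del: of_real_mult of_real_divide)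
  qed
  also have "\<dots> = exp (- (\<theta> * t)) / t * (\<integral>\<omega>. indicator A (X (max 0 t) \<omega>) * (1 - decay \<sigma> a b (t, X (max 0 t) \<omega>)) \<partial>M)"
    by simp
  finally show ?thesis .
qed

text \<open>
  The measure of jumps \<open>exp (- \<theta> * t) / t * P(X t \<in> dx) dt\<close> on \<open>x \<in> A\<close> is infinite at most near \<open>t = 0\<close>.  It is cut
  along the integer part \<open>j\<close> of \<open>1 / t\<close>, which bounds \<open>1 / t\<close> by \<open>j + 1\<close> on each piece.
\<close>

lemma jump_pieces:
  assumes A: "A \<in> sets borel" and \<sigma>: "\<sigma> * \<sigma> = 1" and sign: "\<And>x. x \<in> A \<Longrightarrow> \<bar>x\<bar> = \<sigma> * x"
  shows "\<exists>r D. \<forall>j. 0 \<le> r j \<and> quadrant_law \<sigma> (D j) \<and> (\<forall>a b. 0 \<le> a \<longrightarrow> 0 \<le> b \<longrightarrow>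
    r j * (1 - (\<integral>y. decay \<sigma> a b y \<partial>D j)) = (\<integral>t. indicator {t. nat \<lfloor>1 / t\<rfloor> = j} t *\<^sub>R (indicator {0<..} t *\<^sub>R
      (Re (marginal A (- of_real a - of_real \<theta>) (- of_real b) 0 t) - Re (marginal A (- of_real \<theta>) 0 0 t))) \<partial>lborel))"
proof -
  note A[measurable]
  define K where "K = density lborel (\<lambda>t. ennreal (exponential_density \<theta> t))"
  have K[measurable_cong]: "sets K = sets borel" by (simp add: K_def)
  interpret K: prob_space K
    unfolding K_def by (rule prob_space_exponential_density[OF theta])
  interpret P: pair_prob_space K M ..
  have "\<exists>r D. 0 \<le> r \<and> quadrant_law \<sigma> D \<and> (\<forall>a b. 0 \<le> a \<longrightarrow> 0 \<le> b \<longrightarrow>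
    r * (1 - (\<integral>y. decay \<sigma> a b y \<partial>D)) = (\<integral>t. indicator {t. nat \<lfloor>1 / t\<rfloor> = j} t *\<^sub>R (indicator {0<..} t *\<^sub>R
      (Re (marginal A (- of_real a - of_real \<theta>) (- of_real b) 0 t) - Re (marginal A (- of_real \<theta>) 0 0 t))) \<partial>lborel))" for j
  proof -
    define S where "S = {t::real. 0 < t \<and> nat \<lfloor>1 / t\<rfloor> = j}"
    \<comment> \<open>The density with respect to the exponential law, which already contains the factor \<open>\<theta> * exp (- \<theta> * t)\<close>.\<close>
    define w where "w p = indicator S (fst p) * indicator A (X (max 0 (fst p)) (snd p)) / (\<theta> * fst p)" for p
    define g where "g p = (fst p, X (max 0 (fst p)) (snd p))" for p
    define \<rho> where "\<rho> = distr (density (K \<Otimes>\<^sub>M M) (\<lambda>p. ennreal (w p))) borel g"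
    have [measurable]: "S \<in> sets borel" unfolding S_def by measurable
    have [measurable]: "w \<in> borel_measurable (K \<Otimes>\<^sub>M M)" unfolding w_def[abs_def] by measurable
    have [measurable]: "g \<in> borel_measurable (K \<Otimes>\<^sub>M M)" unfolding g_def[abs_def] by measurable
    have S: "1 / t \<le> real j + 1" "0 < t" if "t \<in> S" for t
    proof -
      show "0 < t" using that by (simp add: S_def)
      then have "0 \<le> \<lfloor>1 / t\<rfloor>" by simp
      then have "real_of_int \<lfloor>1 / t\<rfloor> = real j" using that by (simp add: S_def nat_eq_iff)
      then show "1 / t \<le> real j + 1" using real_of_int_floor_add_one_ge[of "1 / t"] by linarith
    qed
    have w0: "0 \<le> w p" for p using theta S(2)[of "fst p"] by (auto simp: w_def indicator_def)
    have w1: "w p \<le> (real j + 1) / \<theta>" for p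
    proof (cases "fst p \<in> S")
      case True
      have "w p \<le> 1 / (\<theta> * fst p)" using theta S(2)[OF True] by (auto simp: w_def indicator_def)
      also have "\<dots> = (1 / fst p) / \<theta>" by simp
      also have "\<dots> \<le> (real j + 1) / \<theta>" using S(1)[OF True] theta by (intro divide_right_mono) auto
      finally show ?thesis .
    qed (use theta in \<open>simp add: w_def\<close>)
    have wq: "g p \<in> quadrant \<sigma>" if "w p \<noteq> 0" for p
    proof -
      have "fst p \<in> S" "X (max 0 (fst p)) (snd p) \<in> A" using that by (auto simp: w_def indicator_def split: if_splits)
      then show ?thesis using S(2) sign[of "X (max 0 (fst p)) (snd p)"] by (auto simp: g_def quadrant_def less_imp_le)
    qed
    have "finite_measure \<rho>"
    proof
      have "emeasure \<rho> (space \<rho>) = (\<integral>\<^sup>+p. ennreal (w p) \<partial>(K \<Otimes>\<^sub>M M))"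
        unfolding \<rho>_def by (simp add: emeasure_distr emeasure_density cong: nn_integral_cong)
      also have "\<dots> \<le> (\<integral>\<^sup>+p. ennreal ((real j + 1) / \<theta>) \<partial>(K \<Otimes>\<^sub>M M))"
        by (intro nn_integral_mono ennreal_leI w1)
      also have "\<dots> < \<infinity>" by (simp add: P.emeasure_space_1)
      finally show "emeasure \<rho> (space \<rho>) \<noteq> \<infinity>" by simp
    qed
    moreover have "sets \<rho> = sets borel" by (simp add: \<rho>_def)
    moreover have "AE y in \<rho>. y \<in> quadrant \<sigma>"
    proof -
      have "AE p in density (K \<Otimes>\<^sub>M M) (\<lambda>p. ennreal (w p)). g p \<in> quadrant \<sigma>"
        by (subst AE_density, measurable, rule always_eventually) (use wq in force)
      then show ?thesis
        unfolding \<rho>_def using quadrant_borel[of \<sigma>] by (subst AE_distr_iff) auto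
    qed
    ultimately obtain r D where rD: "0 \<le> r" "quadrant_law \<sigma> D"
      "\<forall>a b. 0 \<le> a \<longrightarrow> 0 \<le> b \<longrightarrow> r * (1 - (\<integral>y. decay \<sigma> a b y \<partial>D)) = (\<integral>y. 1 - decay \<sigma> a b y \<partial>\<rho>)"
      using normalize_finite_measure by blast
    have "(\<integral>y. 1 - decay \<sigma> a b y \<partial>\<rho>) = (\<integral>t. indicator {t. nat \<lfloor>1 / t\<rfloor> = j} t *\<^sub>R (indicator {0<..} t *\<^sub>R
        (Re (marginal A (- of_real a - of_real \<theta>) (- of_real b) 0 t) - Re (marginal A (- of_real \<theta>) 0 0 t))) \<partial>lborel)"
      if ab: "0 \<le> a" "0 \<le> b" for a b
    proof -
      let ?I = "\<lambda>t. \<integral>\<omega>. indicator A (X (max 0 t) \<omega>) * (1 - decay \<sigma> a b (t, X (max 0 t) \<omega>)) \<partial>M"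
      have "(\<integral>y. 1 - decay \<sigma> a b y \<partial>\<rho>) = (\<integral>p. w p * (1 - decay \<sigma> a b (g p)) \<partial>(K \<Otimes>\<^sub>M M))"
        unfolding \<rho>_def
        by (subst integral_distr, measurable, subst integral_density) (use w0 in auto)
      also have "\<dots> = (\<integral>t. (\<integral>\<omega>. w (t, \<omega>) * (1 - decay \<sigma> a b (g (t, \<omega>))) \<partial>M) \<partial>K)"
      proof (rule P.integral_fst'[symmetric], rule P.integrable_const_bound)
        have "norm (w p * (1 - decay \<sigma> a b (g p))) \<le> (real j + 1) / \<theta>" for p
        proof (cases "w p = 0")
          case False
          have d: "0 \<le> 1 - decay \<sigma> a b (g p)" "1 - decay \<sigma> a b (g p) \<le> 1"
            using decay_le_1[OF wq[OF False] ab] decay_pos[of \<sigma> a b "g p"] by auto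
          have "w p * (1 - decay \<sigma> a b (g p)) \<le> w p * 1" by (rule mult_left_mono[OF d(2) w0])
          with w1[of p] show ?thesis using mult_nonneg_nonneg[OF w0[of p] d(1)] by simp
        qed (use theta in simp)
        then show "AE p in K \<Otimes>\<^sub>M M. norm (w p * (1 - decay \<sigma> a b (g p))) \<le> (real j + 1) / \<theta>" by simp
      qed measurable
      also have "\<dots> = (\<integral>t. (indicator S t / (\<theta> * t)) * ?I t \<partial>K)"
        by (intro Bochner_Integration.integral_cong refl) (simp add: w_def g_def mult.assoc flip: integral_mult_right_zero)
      also have "\<dots> = (\<integral>t. exponential_density \<theta> t *\<^sub>R ((indicator S t / (\<theta> * t)) * ?I t) \<partial>lborel)"
        unfolding K_def by (rule integral_density) (use theta in \<open>auto simp: exponential_density_def\<close>)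
      also have "\<dots> = (\<integral>t. indicator {t. nat \<lfloor>1 / t\<rfloor> = j} t *\<^sub>R (indicator {0<..} t *\<^sub>R
        (Re (marginal A (- of_real a - of_real \<theta>) (- of_real b) 0 t) - Re (marginal A (- of_real \<theta>) 0 0 t))) \<partial>lborel)"
      proof (rule Bochner_Integration.integral_cong[OF refl])
        fix t :: real
        show "exponential_density \<theta> t *\<^sub>R ((indicator S t / (\<theta> * t)) * ?I t) =
          indicator {t. nat \<lfloor>1 / t\<rfloor> = j} t *\<^sub>R (indicator {0<..} t *\<^sub>R
          (Re (marginal A (- of_real a - of_real \<theta>) (- of_real b) 0 t) - Re (marginal A (- of_real \<theta>) 0 0 t)))"
        proof (cases "t \<in> S")
          case True
          then have t: "0 < t" "nat \<lfloor>1 / t\<rfloor> = j" by (auto simp: S_def)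
          show ?thesis
            using decay_marginal[OF A sign ab t(1)] True t theta
            by (simp add: exponential_density_def mult_ac)
        qed (auto simp: S_def)
      qed
      finally show ?thesis .
    qed
    with rD show ?thesis by (intro exI[of _ r] exI[of _ D]) auto
  qed
  then have "\<forall>j. \<exists>p. 0 \<le> fst p \<and> quadrant_law \<sigma> (snd p) \<and> (\<forall>a b. 0 \<le> a \<longrightarrow> 0 \<le> b \<longrightarrow>
    fst p * (1 - (\<integral>y. decay \<sigma> a b y \<partial>snd p)) = (\<integral>t. indicator {t. nat \<lfloor>1 / t\<rfloor> = j} t *\<^sub>R (indicator {0<..} t *\<^sub>R
      (Re (marginal A (- of_real a - of_real \<theta>) (- of_real b) 0 t) - Re (marginal A (- of_real \<theta>) 0 0 t))) \<partial>lborel))"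
    by simp
  from choice[OF this] obtain p where p: "\<forall>j. 0 \<le> fst (p j) \<and> quadrant_law \<sigma> (snd (p j)) \<and> (\<forall>a b. 0 \<le> a \<longrightarrow> 0 \<le> b \<longrightarrow>
    fst (p j) * (1 - (\<integral>y. decay \<sigma> a b y \<partial>snd (p j))) = (\<integral>t. indicator {t. nat \<lfloor>1 / t\<rfloor> = j} t *\<^sub>R (indicator {0<..} t *\<^sub>R
      (Re (marginal A (- of_real a - of_real \<theta>) (- of_real b) 0 t) - Re (marginal A (- of_real \<theta>) 0 0 t))) \<partial>lborel))"
    by (rule exE)
  show ?thesis by (rule exI[of _ "\<lambda>j. fst (p j)"], rule exI[of _ "\<lambda>j. snd (p j)"]) (rule p)
qed

text \<open>
  Both sides of the formula are real and positive, so that passing to absolute values replaces the complex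
  exponents by their real parts, which are the integrals against the measure of jumps.
\<close>

lemma infinitely_divisible_of_transform:
  assumes A: "A \<in> sets borel" and \<sigma>: "\<sigma> * \<sigma> = 1" and sign: "\<And>x. x \<in> A \<Longrightarrow> \<bar>x\<bar> = \<sigma> * x"
    and \<mu>: "quadrant_law \<sigma> \<mu>"
    and transform: "\<And>a b. 0 \<le> a \<Longrightarrow> 0 \<le> b \<Longrightarrow> of_real (\<integral>y. decay \<sigma> a b y \<partial>\<mu>) =
      phi M X A (- of_real \<theta>) 0 / phi M X A (- of_real a - of_real \<theta>) (- of_real b)"
  shows "infinitely_divisible \<mu>"
proof -
  let ?E = "\<lambda>a b. exponent A (- of_real a - of_real \<theta>) (- of_real b) 0 - exponent A (- of_real \<theta>) 0 0"
  let ?h = "\<lambda>a b t. Re (marginal A (- of_real a - of_real \<theta>) (- of_real b) 0 t) - Re (marginal A (- of_real \<theta>) 0 0 t)"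
  obtain r D where rD: "\<forall>j. 0 \<le> r j \<and> quadrant_law \<sigma> (D j) \<and> (\<forall>a b. 0 \<le> a \<longrightarrow> 0 \<le> b \<longrightarrow>
    r j * (1 - (\<integral>y. decay \<sigma> a b y \<partial>D j)) = (\<integral>t. indicator {t. nat \<lfloor>1 / t\<rfloor> = j} t *\<^sub>R (indicator {0<..} t *\<^sub>R ?h a b t) \<partial>lborel))"
    using jump_pieces[OF A \<sigma> sign] by blast
  show ?thesis
  proof (rule infinitely_divisible_of_levy_exponent[OF \<sigma> \<mu>])
    show "0 \<le> r j" "quadrant_law \<sigma> (D j)" for j using rD by auto
    fix a b :: real assume ab: "0 \<le> a" "0 \<le> b"
    have int: "integrable lborel (\<lambda>t. indicator {0<..} t *\<^sub>R marginal A c d 0 t)" if "Re c < 0" "Re d \<le> 0" for c d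
      by (rule exponent_limit(2)[OF A that, where s = "\<lambda>_ t. t" and e = "\<lambda>_. 0" and e' = 0]) auto
    have i1: "integrable lborel (\<lambda>t. indicator {0<..} t *\<^sub>R marginal A (- of_real a - of_real \<theta>) (- of_real b) 0 t)"
      and i2: "integrable lborel (\<lambda>t. indicator {0<..} t *\<^sub>R marginal A (- of_real \<theta>) 0 0 t)"
      using ab theta by (auto intro!: int)
    have h: "indicator {0<..} t *\<^sub>R ?h a b t = Re (indicator {0<..} t *\<^sub>R marginal A (- of_real a - of_real \<theta>) (- of_real b) 0 t)
        - Re (indicator {0<..} t *\<^sub>R marginal A (- of_real \<theta>) 0 0 t)" for t :: real
      by (simp add: algebra_simps)
    have ih: "integrable lborel (\<lambda>t. indicator {0<..} t *\<^sub>R ?h a b t)"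
      unfolding h by (intro Bochner_Integration.integrable_diff integrable_Re i1 i2)
    have eh: "(\<integral>t. indicator {0<..} t *\<^sub>R ?h a b t \<partial>lborel) = Re (?E a b)"
      unfolding h exponent_def
      by (subst Bochner_Integration.integral_diff) (use i1 i2 in \<open>simp_all only: integrable_Re integral_Re minus_complex.simps\<close>)
    have m: "(\<lambda>t::real. nat \<lfloor>1 / t\<rfloor>) \<in> measurable lborel (count_space UNIV)"
      using floor_inverse_measurable by simp
    show "(\<lambda>j. r j * (1 - (\<integral>y. decay \<sigma> a b y \<partial>D j))) sums Re (?E a b)"
      using integral_sums_over_index[OF ih m] rD ab eh by simp
    have "of_real (\<integral>y. decay \<sigma> a b y \<partial>\<mu>) = exp (- ?E a b)"
      unfolding transform[OF ab] phi_eq_exp_exponent[OF A] by (simp add: exp_diff)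
    then have "norm (complex_of_real (\<integral>y. decay \<sigma> a b y \<partial>\<mu>)) = exp (- Re (?E a b))"
      by (simp only: norm_exp_eq_Re uminus_complex.simps)
    then show "(\<integral>y. decay \<sigma> a b y \<partial>\<mu>) = exp (- Re (?E a b))"
      using quadrant_law_decay(2)[OF \<mu> ab] by simp
  qed
qed

lemma infinitely_divisible_pre_sup: "infinitely_divisible (distr M borel pre_sup)"
proof (rule infinitely_divisible_of_transform[of "{0<..}" 1])
  show "quadrant_law 1 (distr M borel pre_sup)"
    using sup_signs by (intro quadrant_law_distr prob_space_axioms AE_I2) (auto simp: quadrant_def)
  fix a b :: real assume ab: "0 \<le> a" "0 \<le> b"
  have "complex_of_real (\<integral>y. decay 1 a b y \<partial>distr M borel pre_sup) = (\<integral>\<omega>. complex_of_real (decay 1 a b (pre_sup \<omega>)) \<partial>M)"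
    by (simp add: integral_distr)
  also have "\<dots> = Psi_plus M X T (- of_real a) (- of_real b)"
    unfolding Psi_plus_def by (simp add: decay_def pre_sup_def flip: exp_of_real)
  finally have "complex_of_real (\<integral>y. decay 1 a b y \<partial>distr M borel pre_sup) = Psi_plus M X T (- of_real a) (- of_real b)" .
  with Psi_plus_eq[of "- of_real a" "- of_real b"] ab
  show "of_real (\<integral>y. decay 1 a b y \<partial>distr M borel pre_sup) =
      phi M X {0<..} (- of_real \<theta>) 0 / phi M X {0<..} (- of_real a - of_real \<theta>) (- of_real b)" by simp
qed auto

lemma infinitely_divisible_post_sup: "infinitely_divisible (distr M borel post_sup)"
proof (rule infinitely_divisible_of_transform[of "{..0}" "-1"])
  show "quadrant_law (-1) (distr M borel post_sup)"
    using sup_signs by (intro quadrant_law_distr prob_space_axioms AE_I2) (auto simp: quadrant_def)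
  fix a b :: real assume ab: "0 \<le> a" "0 \<le> b"
  have "complex_of_real (\<integral>y. decay (-1) a b y \<partial>distr M borel post_sup) = (\<integral>\<omega>. complex_of_real (decay (-1) a b (post_sup \<omega>)) \<partial>M)"
    by (simp add: integral_distr)
  also have "\<dots> = Psi_minus M X T (- of_real a) (- (- of_real b))"
    unfolding Psi_minus_def by (simp add: decay_def post_sup_def algebra_simps flip: exp_of_real)
  finally have "complex_of_real (\<integral>y. decay (-1) a b y \<partial>distr M borel post_sup) = Psi_minus M X T (- of_real a) (- (- of_real b))" .
  with Psi_minus_eq[of "- of_real a" "- of_real b"] ab
  show "of_real (\<integral>y. decay (-1) a b y \<partial>distr M borel post_sup) =
      phi M X {..0} (- of_real \<theta>) 0 / phi M X {..0} (- of_real a - of_real \<theta>) (- of_real b)" by simp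
qed auto

end

theorem theorem8:
  fixes M :: "'w measure" and X :: "real \<Rightarrow> 'w \<Rightarrow> real" and T :: "'w \<Rightarrow> real" and \<theta> :: real
  assumes levy: "levy_process M X"
    and nonzero: "\<not> (AE \<omega> in M. \<forall>t\<ge>0. X t \<omega> = 0)"
    and theta: "0 < \<theta>"
    and exp_time: "distributed M lborel T (exponential_density \<theta>)"
    and time_nonneg: "\<forall>\<omega>\<in>space M. 0 \<le> T \<omega>"
    and indep: "indep_of_process M T X"
  defines "Y \<equiv> (\<lambda>\<omega>. (sup_time (\<lambda>t. X t \<omega>) (T \<omega>), running_sup (\<lambda>t. X t \<omega>) (T \<omega>)))"
    and "Z \<equiv> (\<lambda>\<omega>. (T \<omega> - sup_time (\<lambda>t. X t \<omega>) (T \<omega>),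
                    X (T \<omega>) \<omega> - running_sup (\<lambda>t. X t \<omega>) (T \<omega>)))"
  shows "prob_space.indep_var M borel Y borel Z
    \<and> infinitely_divisible (distr M borel Y)
    \<and> infinitely_divisible (distr M borel Z)
    \<and> (\<forall>a b. Re a < 0 \<and> Re b \<le> 0 \<longrightarrow>
         phi_integral_exists M X {0<..} a b \<and> phi_integral_exists M X {..0} a b)
    \<and> (\<forall>u v. Re u \<le> 0 \<and> Re v \<le> 0 \<longrightarrow>
         Psi_plus M X T u v
           = phi M X {0<..} (- of_real \<theta>) 0 / phi M X {0<..} (u - of_real \<theta>) v
         \<and> Psi_minus M X T u (- v)
           = phi M X {..0} (- of_real \<theta>) 0 / phi M X {..0} (u - of_real \<theta>) v)
    \<and> (\<forall>\<Psi>. is_characteristic_exponent M X \<Psi> \<longrightarrow>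
         (\<forall>u v. Re u = 0 \<and> Re v = 0 \<longrightarrow>
            of_real \<theta> / (of_real \<theta> - u - \<Psi> v) = Psi_plus M X T u v * Psi_minus M X T u v))"
proof -
  interpret levy_exp_time M X T \<theta>
    using levy theta exp_time time_nonneg indep by unfold_locales auto
  have YZ: "Y = pre_sup" "Z = post_sup"
    by (simp_all add: Y_def Z_def pre_sup_def[abs_def] post_sup_def[abs_def])
  show ?thesis
    unfolding YZ
    using indep_pre_post infinitely_divisible_pre_sup infinitely_divisible_post_sup
      phi_integral_exists[of "{0<..}"] phi_integral_exists[of "{..0}"] Psi_plus_eq Psi_minus_eq product_Psi
    by auto
qed

end
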